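(* Let $P,Q$ be simply connected polygons with $(P;u_0)\approx(Q;v_0)$, where $P$ is a rational triangle and $u_0$ is non-exceptional. Then $Q$ is similar to $P$.
   Context: A polygonal billiard table is a planar simply connected compact polygon $P$ with boundary $\partial P$ oriented counterclockwise. The billiard flow is the free motion of a point mass in $P$ with elastic reflection (angle of incidence equals angle of reflection) at the sides; it is not defined after hitting a corner nor for directions tangent to a side. The billiard map $T\colon V_P\to V_P$ is the first return map of the flow to the boundary, where $V_P=\bigcup e\times\theta\subset\partial P\times S^1$, the union being over all sides $e$ of $P$ and all inner pointing directions $\theta\in S^1$. Points of $V_P$ are written $u=(x,\theta)$, with projections $\pi_1(u)=x$ (foot point) and $\pi_2(u)=\theta$ (direction). The billiard map of $Q$ is denoted $S\colon V_Q\to V_Q$. Let $D$ be the group generated by the reflections in the lines through the origin parallel to the sides of $P$. $P$ is rational if all its angles are rational multiples of $\pi$ (equivalently, $D$ is finite). For $x,x'\in\partial P$, $[x,x']$ is the closed counterclockwise arc of $\partial P$ from $x$ to $x'$. Sequences $\{x_n\}_{n\ge0}\subset\partial P$, $\{y_n\}_{n\ge0}\subset\partial Q$ have the same combinatorial order if for all non-negative integers $k,l,m$: $x_k\in[x_l,x_m]\iff y_k\in[y_l,y_m]$. $(P;u_0)\approx(Q;v_0)$ (order equivalent with leaders $u_0\in V_P,v_0\in V_Q$) means: (i) the infinite forward orbits are defined and $\{\pi_1(T^n(u_0))\}_{n\ge0}$ is dense in $\partial P$, $\{\pi_1(S^n(v_0))\}_{n\ge0}$ is dense in $\partial Q$;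 (ii) these two sequences have the same combinatorial order. A generalized diagonal is a billiard trajectory going from a corner to a corner. A direction is exceptional if it is the direction of a generalized diagonal, directions being understood modulo the action of $D$ (a generalized diagonal changes its direction by an element of $D$ at each reflection); a point $u$ is exceptional if $\pi_2(u)$ is. Otherwise it is non-exceptional. *)

theory Defs
  imports "HOL-Complex_Analysis.Complex_Analysis"
begin

section \<open>Polygons\<close>

text \<open>A polygon is given by the cyclic list of its corners in counterclockwise order;
  indices are read modulo the length of the list.\<close>

fun polyline :: "complex list \<Rightarrow> real \<Rightarrow> complex" where
  "polyline [] = linepath 0 0"
| "polyline [a] = linepath a a"
| "polyline [a, b] = linepath a b"
| "polyline (a # b # c # xs) = linepath a b +++ polyline (b # c # xs)"

definition boundary_path :: "complex list \<Rightarrow> real \<Rightarrow> complex" where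
  "boundary_path vs = polyline (vs @ [hd vs])"

definition boundary :: "complex list \<Rightarrow> complex set" where
  "boundary vs = path_image (boundary_path vs)"

definition table :: "complex list \<Rightarrow> complex set" where
  "table vs = boundary vs \<union> inside (boundary vs)"

definition side_vector :: "complex list \<Rightarrow> nat \<Rightarrow> complex" where
  "side_vector vs i = vs ! (Suc i mod length vs) - vs ! i"

definition side :: "complex list \<Rightarrow> nat \<Rightarrow> complex set" where
  "side vs i = closed_segment (vs ! i) (vs ! (Suc i mod length vs))"

text \<open>The angle at corner \<open>i\<close>, swept counterclockwise from the outgoing to the incoming side; for
  a counterclockwise polygon this sector lies in the table, also at reflex corners.\<close>

definition interior_angle :: "complex list \<Rightarrow> nat \<Rightarrow> real" where
  "interior_angle vs i =
     Arg2pi ((vs ! ((i + length vs - 1) mod length vs) - vs ! i) / side_vector vs i)"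

text \<open>The winding number condition is the counterclockwise orientation. Angles equal to \<open>\<pi>\<close> are
  excluded, so that every listed vertex is a genuine corner.\<close>

definition polygon :: "complex list \<Rightarrow> bool" where
  "polygon vs \<longleftrightarrow> 3 \<le> length vs \<and> simple_path (boundary_path vs) \<and>
     (\<forall>z \<in> inside (boundary vs). winding_number (boundary_path vs) z = 1) \<and>
     (\<forall>i < length vs. interior_angle vs i \<noteq> pi)"

definition rational_polygon :: "complex list \<Rightarrow> bool" where
  "rational_polygon vs \<longleftrightarrow> (\<forall>i < length vs. \<exists>q \<in> \<rat>. interior_angle vs i = q * pi)"

definition similar :: "complex set \<Rightarrow> complex set \<Rightarrow> bool" where
  "similar A B \<longleftrightarrow>
     (\<exists>f r. 0 < r \<and> (\<forall>x y. dist (f x) (f y) = r * dist x y) \<and> f ` A = B)"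

text \<open>The closed counterclockwise boundary arc from \<open>x\<close> to \<open>y\<close>. The base point is counted only as
  parameter 0, so every boundary point has a unique parameter; the arc from \<open>x\<close> to \<open>x\<close> is the
  single point \<open>x\<close>.\<close>

definition ccw_arc :: "complex list \<Rightarrow> complex \<Rightarrow> complex \<Rightarrow> complex set" where
  "ccw_arc vs x y = {boundary_path vs r | r s t.
     r \<in> {0..<1} \<and> s \<in> {0..<1} \<and> t \<in> {0..<1} \<and>
     boundary_path vs s = x \<and> boundary_path vs t = y \<and>
     (if s \<le> t then s \<le> r \<and> r \<le> t else s \<le> r \<or> r \<le> t)}"

section \<open>The billiard map\<close>

type_synonym phase_point = "complex \<times> complex"

text \<open>A pair of a foot point and a unit direction that points into the open table. Directions
  tangent to a side are thereby excluded. A foot point may be a corner: an orbit can start, but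
  not continue, there (see \<open>orbit_defined\<close> below).\<close>

definition phase_space :: "complex list \<Rightarrow> phase_point set" where
  "phase_space vs = {(x, \<theta>). x \<in> boundary vs \<and> norm \<theta> = 1 \<and>
     (\<exists>\<epsilon>>0. \<forall>t. 0 < t \<and> t < \<epsilon> \<longrightarrow> x + t *\<^sub>R \<theta> \<in> inside (boundary vs))}"

definition hit_time :: "complex list \<Rightarrow> phase_point \<Rightarrow> real" where
  "hit_time vs u = Inf {t. 0 < t \<and> fst u + t *\<^sub>R snd u \<in> boundary vs}"

definition hit_point :: "complex list \<Rightarrow> phase_point \<Rightarrow> complex" where
  "hit_point vs u = fst u + hit_time vs u *\<^sub>R snd u"

text \<open>Reflection in the line through the origin parallel to side \<open>i\<close>: it is real-linear, fixes
  \<open>w\<close> and negates \<open>\<i> w\<close>.\<close>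

definition side_reflection :: "complex list \<Rightarrow> nat \<Rightarrow> complex \<Rightarrow> complex" where
  "side_reflection vs i z = (let w = side_vector vs i in w / cnj w * cnj z)"

text \<open>The value is meaningful only if the hit point is not a corner, in which case the side that
  contains it is unique.\<close>

definition billiard_map :: "complex list \<Rightarrow> phase_point \<Rightarrow> phase_point" where
  "billiard_map vs u =
     (hit_point vs u,
      side_reflection vs (THE i. i < length vs \<and> hit_point vs u \<in> side vs i) (snd u))"

definition foot :: "complex list \<Rightarrow> phase_point \<Rightarrow> nat \<Rightarrow> complex" where
  "foot vs u n = fst ((billiard_map vs ^^ n) u)"

definition orbit_defined :: "complex list \<Rightarrow> phase_point \<Rightarrow> bool" where
  "orbit_defined vs u \<longleftrightarrow>
     u \<in> phase_space vs \<and> (\<forall>n. hit_point vs ((billiard_map vs ^^ n) u) \<notin> set vs)"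

section \<open>Order equivalence\<close>

definition same_combinatorial_order ::
    "complex list \<Rightarrow> (nat \<Rightarrow> complex) \<Rightarrow> complex list \<Rightarrow> (nat \<Rightarrow> complex) \<Rightarrow> bool" where
  "same_combinatorial_order P x Q y \<longleftrightarrow>
     (\<forall>k l m. x k \<in> ccw_arc P (x l) (x m) \<longleftrightarrow> y k \<in> ccw_arc Q (y l) (y m))"

definition order_equivalent ::
    "complex list \<Rightarrow> phase_point \<Rightarrow> complex list \<Rightarrow> phase_point \<Rightarrow> bool" where
  "order_equivalent P u Q v \<longleftrightarrow>
     orbit_defined P u \<and> orbit_defined Q v \<and>
     boundary P \<subseteq> closure (range (foot P u)) \<and>
     boundary Q \<subseteq> closure (range (foot Q v)) \<and>
     same_combinatorial_order P (foot P u) Q (foot Q v)"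

section \<open>Exceptional points\<close>

text \<open>The group generated by the side reflections; these are involutions, so closure under left
  multiplication by generators suffices.\<close>

inductive_set reflection_group :: "complex list \<Rightarrow> (complex \<Rightarrow> complex) set"
  for vs :: "complex list" where
  one: "id \<in> reflection_group vs"
| step: "g \<in> reflection_group vs \<Longrightarrow> i < length vs \<Longrightarrow>
    side_reflection vs i \<circ> g \<in> reflection_group vs"

text \<open>\<open>u\<close> starts a trajectory from a corner to a corner. The sides themselves do not count, since
  the flow is not defined for directions tangent to a side.\<close>

definition generalized_diagonal :: "complex list \<Rightarrow> phase_point \<Rightarrow> bool" where
  "generalized_diagonal vs u \<longleftrightarrow> u \<in> phase_space vs \<and> fst u \<in> set vs \<and>
     (\<exists>n. (\<forall>k<n. hit_point vs ((billiard_map vs ^^ k) u) \<notin> set vs) \<and>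
          hit_point vs ((billiard_map vs ^^ n) u) \<in> set vs)"

definition exceptional_direction :: "complex list \<Rightarrow> complex \<Rightarrow> bool" where
  "exceptional_direction vs \<theta> \<longleftrightarrow>
     (\<exists>u. generalized_diagonal vs u \<and> (\<exists>g \<in> reflection_group vs. \<theta> = g (snd u)))"

definition exceptional_point :: "complex list \<Rightarrow> phase_point \<Rightarrow> bool" where
  "exceptional_point vs u \<longleftrightarrow> exceptional_direction vs (snd u)"

end

theory Submission
  imports Defs
begin

text \<open>Order equivalence extends the matching of foot points to a homeomorphism \<open>\<phi>\<close> of the boundaries.
  Since \<open>P\<close> is rational, the orbit of \<open>u\<^sub>0\<close> takes finitely many directions, and non-exceptionality
  makes it dense among all chords of \<open>P\<close> in each of these directions: the endpoint of a gap in the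
  limit set would meet a corner both in the future and in the past, which is a generalized diagonal.
  Hence \<open>\<phi>\<close> conjugates the billiard on these finitely many parallel chord families to the one in \<open>Q\<close>.

  The images in \<open>Q\<close> of the chords of one family are parallel. Cut the family into pieces on which \<open>n\<close>
  iterates see neither a corner of \<open>P\<close> nor of \<open>Q\<close>. If the image direction varies by \<open>d\<close> along a piece,
  unfolding shows that its two end trajectories drift apart in \<open>Q\<close> by an amount of order \<open>n d\<close>; but
  the images of the pieces at time \<open>n\<close> are disjoint, so the total drift is bounded by a multiple of
  the perimeter of \<open>Q\<close>, independently of \<open>n\<close>.

  So \<open>\<phi>\<close> induces a map \<open>f\<close> of directions. A corner of \<open>Q\<close> in the image of a side interior would force
  its two sides to reflect some direction equally, hence to be parallel; thus \<open>Q\<close> is a triangle and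
  \<open>f\<close> is equivariant under the side reflections. The linear map \<open>z \<mapsto> \<Sum>\<theta>. \<langle>z, \<theta>\<rangle> f \<theta>\<close> then intertwines
  these reflections. It is nonzero because \<open>f\<close> preserves the side into which a direction points, and
  it carries sides and their normals to multiples of sides and normals of \<open>Q\<close>, so \<open>Q\<close> is similar to
  \<open>P\<close>.\<close>

section \<open>Sides and corners of a simple polygon\<close>

text \<open>A priori the orbit in Q may take infinitely many directions, and \<phi> only yields
  segments between boundary points of Q, not known to be billiard chords. So every fact about Q is
  first known along the orbit and reaches other chords by density and continuity. The drift grows
  linearly because of P: rationality forces each window of \<open>B\<close> reflections to visit all
  three sides, hence to contain a chord of length at least \<open>\<eta>\<close>, whose image has
  length at least some \<open>c > 0\<close> by uniform continuity of \<psi>. The bound is the number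
  of directions in P times the perimeter of Q, by injectivity of the billiard map. Since the image
  direction is continuous in the level, the finitely many levels that see a corner cost nothing,
  however their number grows with \<open>n\<close>. At the end, intertwining alone permits different
  factors for a side and its normal; but the complex-linear and the antilinear part of the map each
  carry sides to real multiples of sides, and the closing relation of a triangle makes these
  multiples equal.\<close>

lemma Im_cnj_mult_eq_0:
  assumes "Im (cnj w * z) = 0" "w \<noteq> 0"
  obtains r where "z = r *\<^sub>R w"
proof
  have "cnj w * z = of_real (Re (cnj w * z))" using assms(1) by (simp only: complex_eq_iff Re_complex_of_real Im_complex_of_real)
  then have "w * cnj w * z = of_real (Re (cnj w * z)) * w" by (metis mult.assoc mult.commute)
  then show "z = (Re (cnj w * z) / (cmod w)\<^sup>2) *\<^sub>R w"
    using assms(2) by (simp add: scaleR_conv_of_real field_simps flip: complex_norm_square)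
qed

lemma pathstart_polyline: "xs \<noteq> [] \<Longrightarrow> pathstart (polyline xs) = hd xs"
  by (induction xs rule: polyline.induct) auto

lemma pathfinish_polyline: "xs \<noteq> [] \<Longrightarrow> pathfinish (polyline xs) = last xs"
  by (induction xs rule: polyline.induct) auto

lemma path_image_polyline:
  "2 \<le> length xs \<Longrightarrow>
   path_image (polyline xs) = (\<Union>i<length xs - 1. closed_segment (xs ! i) (xs ! Suc i))"
proof (induction xs rule: polyline.induct)
  case (4 a b c xs)
  have "path_image (polyline (a # b # c # xs)) =
        closed_segment a b \<union> path_image (polyline (b # c # xs))"
    by (simp add: path_image_join pathstart_polyline)
  also have "\<dots> = (\<Union>i<Suc (Suc (length xs)). closed_segment ((a # b # c # xs) ! i) ((a # b # c # xs) ! Suc i))"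
    unfolding lessThan_Suc_eq_insert_0[of "Suc (length xs)"] using 4 by (simp add: image_image)
  finally show ?case
    by simp
qed (simp_all add: lessThan_Suc)

lemma vertices_subset_polyline:
  assumes "2 \<le> length xs" shows "set xs \<subseteq> path_image (polyline xs)"
proof
  fix x assume "x \<in> set xs"
  then obtain i where i: "i < length xs" "x = xs ! i"
    by (auto simp: in_set_conv_nth)
  show "x \<in> path_image (polyline xs)"
  proof (cases "i < length xs - 1")
    case True
    then show ?thesis using i assms by (auto simp: path_image_polyline)
  next
    case False
    then have "Suc (i - 1) = i" "i - 1 < length xs - 1" using i assms by auto
    then have "x \<in> closed_segment (xs ! (i - 1)) (xs ! Suc (i - 1))"
      using i by simp
    then show ?thesis using \<open>i - 1 < length xs - 1\<close> assms by (auto simp: path_image_polyline)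
  qed
qed

lemma arc_polyline_distinct:
  "2 \<le> length xs \<Longrightarrow> arc (polyline xs) \<Longrightarrow> distinct xs"
proof (induction xs rule: polyline.induct)
  case (3 a b)
  then show ?case using arc_distinct_ends by fastforce
next
  case (4 a b c xs)
  have a: "arc (linepath a b)" "arc (polyline (b # c # xs))"
    "path_image (linepath a b) \<inter> path_image (polyline (b # c # xs)) \<subseteq> {b}"
    using 4(3) by (simp_all add: arc_join_eq pathstart_polyline)
  have "a \<noteq> b" using a(1) arc_distinct_ends by fastforce
  then have "a \<notin> path_image (polyline (b # c # xs))" using a(3) by auto
  then have "a \<notin> set (b # c # xs)" using vertices_subset_polyline[of "b # c # xs"] by auto
  then show ?case using 4(1) a(2) by simp
qed auto

lemma arc_polyline_sides_meet:
  assumes "2 \<le> length xs" "arc (polyline xs)" "i < j" "Suc j < length xs"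
    "z \<in> closed_segment (xs ! i) (xs ! Suc i)" "z \<in> closed_segment (xs ! j) (xs ! Suc j)"
  shows "z \<in> set xs"
  using assms
proof (induction xs arbitrary: i j rule: polyline.induct)
  case (4 a b c xs)
  have a: "arc (linepath a b)" "arc (polyline (b # c # xs))"
    "path_image (linepath a b) \<inter> path_image (polyline (b # c # xs)) \<subseteq> {b}"
    using 4(3) by (simp_all add: arc_join_eq pathstart_polyline)
  obtain j' where j: "j = Suc j'" using 4(4) by (cases j) auto
  have j': "z \<in> closed_segment ((b # c # xs) ! j') ((b # c # xs) ! Suc j')"
    "Suc j' < length (b # c # xs)"
    using 4 j by auto
  show ?case
  proof (cases i)
    case 0
    have "z \<in> path_image (polyline (b # c # xs))"
      using j' by (subst path_image_polyline) auto
    then show ?thesis using a(3) 4(6) 0 by auto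
  next
    case (Suc i')
    then show ?thesis using 4(1)[of i' j'] a(2) j j' 4(4,6) by auto
  qed
qed auto

locale simple_polygon =
  fixes vs :: "complex list"
  assumes length_ge: "3 \<le> length vs" and simple: "simple_path (boundary_path vs)"
begin

lemma nonempty: "vs \<noteq> []" and length_pos [simp]: "0 < length vs"
  using length_ge by auto

lemma closing_vertex:
  assumes "i < length vs"
  shows "(vs @ [hd vs]) ! i = vs ! i" "(vs @ [hd vs]) ! Suc i = vs ! (Suc i mod length vs)"
  using assms nonempty by (auto simp: nth_append hd_conv_nth not_less_eq less_Suc_eq)

lemma side_closing: "i < length vs \<Longrightarrow>
    side vs i = closed_segment ((vs @ [hd vs]) ! i) ((vs @ [hd vs]) ! Suc i)"
  by (simp only: closing_vertex side_def)

lemma boundary_eq: "boundary vs = (\<Union>i<length vs. side vs i)"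
  unfolding boundary_def boundary_path_def
  using length_ge by (subst path_image_polyline) (auto simp: side_closing)

lemma closed_loop: "pathfinish (boundary_path vs) = pathstart (boundary_path vs)"
  unfolding boundary_path_def using nonempty by (simp add: pathstart_polyline pathfinish_polyline)

text \<open>Splitting off the first side leaves an arc, to which the two preceding lemmas apply; the
  loop condition lets the first side meet that arc only in the corners \<open>a\<close> and
  \<open>b\<close>.\<close>

lemma
  shows distinct_corners: "distinct vs"
    and sides_meet: "i < length vs \<Longrightarrow> j < length vs \<Longrightarrow> i \<noteq> j \<Longrightarrow>
      z \<in> side vs i \<Longrightarrow> z \<in> side vs j \<Longrightarrow> z \<in> set vs"
proof -
  obtain a b c xs where vs: "vs = a # b # c # xs"
    using length_ge by (metis Suc_le_length_iff numeral_3_eq_3)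
  let ?r = "b # c # xs @ [a]"
  have pl: "pathstart (polyline ?r) = b" "pathfinish (polyline ?r) = a"
    by (simp_all add: pathstart_polyline pathfinish_polyline)
  have "simple_path (linepath a b +++ polyline ?r)"
    using simple by (simp add: boundary_path_def vs)
  then have A: "arc (polyline ?r)" "path_image (linepath a b) \<inter> path_image (polyline ?r) \<subseteq> {a, b}"
    using pl by (auto simp: simple_path_join_loop_eq)
  have "distinct ?r" using arc_polyline_distinct[OF _ A(1)] by simp
  then show "distinct vs" unfolding vs by auto
  have *: "z \<in> set vs" if ij: "i < j" "j < length vs" "z \<in> side vs i" "z \<in> side vs j" for i j
  proof -
    obtain j' where j: "j = Suc j'" using ij by (cases j) auto
    have zj: "z \<in> closed_segment (?r ! j') (?r ! Suc j')" "Suc j' < length ?r"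
      using ij(2,4) j side_closing[of j] by (auto simp: vs simp del: nth_Cons_Suc nth_Cons_0)
    have zi: "z \<in> closed_segment ((a # ?r) ! i) ((a # ?r) ! Suc i)"
      using ij side_closing[of i] by (auto simp: vs)
    show ?thesis
    proof (cases i)
      case 0
      have "z \<in> path_image (polyline ?r)" using zj by (subst path_image_polyline) auto
      then show ?thesis using A(2) zi 0 vs by auto
    next
      case (Suc i')
      have "z \<in> set ?r"
        by (rule arc_polyline_sides_meet[of ?r i' j', OF _ A(1)]) (use zj zi Suc ij j in auto)
      then show ?thesis by (auto simp: vs)
    qed
  qed
  show "i < length vs \<Longrightarrow> j < length vs \<Longrightarrow> i \<noteq> j \<Longrightarrow>
      z \<in> side vs i \<Longrightarrow> z \<in> side vs j \<Longrightarrow> z \<in> set vs"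
    using *[of i j] *[of j i] by linarith
qed

lemma compact_boundary: "compact (boundary vs)"
  unfolding boundary_def using simple compact_simple_path_image by blast

lemma closed_boundary: "closed (boundary vs)"
  by (simp add: compact_boundary compact_imp_closed)

lemma corners_in_side: "i < length vs \<Longrightarrow> vs ! i \<in> side vs i"
  "i < length vs \<Longrightarrow> vs ! (Suc i mod length vs) \<in> side vs i"
  by (simp_all add: side_def)

lemma corners_subset: "set vs \<subseteq> boundary vs"
  unfolding boundary_eq using corners_in_side by (force simp: in_set_conv_nth)

lemma side_vector_nz: "i < length vs \<Longrightarrow> side_vector vs i \<noteq> 0"
proof -
  assume i: "i < length vs"
  have "Suc i mod length vs \<noteq> i"
    using i length_ge by (auto simp: mod_Suc)
  then show ?thesis
    using distinct_corners i length_pos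
    by (auto simp: side_vector_def nth_eq_iff_index_eq)
qed

lemma ex1_side:
  assumes "z \<in> boundary vs" "z \<notin> set vs"
  shows "\<exists>!i. i < length vs \<and> z \<in> side vs i"
  using assms sides_meet by (auto simp: boundary_eq)

lemma closed_side: "closed (side vs i)"
  by (simp add: side_def)

lemma side_noncorner_nbhd:
  assumes "i < length vs" "z \<in> side vs i" "z \<notin> set vs"
  shows "\<exists>e>0. \<forall>y\<in>boundary vs. dist y z < e \<longrightarrow> y \<in> side vs i \<and> y \<notin> set vs"
proof -
  let ?C = "set vs \<union> (\<Union>j\<in>{..<length vs} - {i}. side vs j)"
  have "closed ?C" by (intro closed_Un finite_imp_closed closed_UN) (auto simp: closed_side)
  moreover have "z \<notin> ?C" using sides_meet assms by auto
  ultimately obtain e where "e > 0" "\<forall>y. dist y z < e \<longrightarrow> y \<notin> ?C"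
    by (metis ComplD ComplI open_Compl open_dist)
  then show ?thesis unfolding boundary_eq by (intro exI[of _ e]) auto
qed

text \<open>The sides are closed and meet only in corners, so a connected set without corners cannot
  change side. This makes a whole beam of chords exit through one side and keeps its image curve on
  one side of the other polygon.\<close>

lemma connected_in_side:
  assumes "connected S" "S \<subseteq> boundary vs" "S \<inter> set vs = {}" "i < length vs" "z \<in> S" "z \<in> side vs i"
  shows "S \<subseteq> side vs i"
proof -
  let ?B = "\<Union>j\<in>{..<length vs} - {i}. side vs j"
  have "closed (side vs i)" "closed ?B" by (auto simp: closed_side)
  moreover have "S \<subseteq> side vs i \<union> ?B" using assms(2) by (auto simp: boundary_eq)
  moreover have "side vs i \<inter> ?B \<inter> S = {}"
    using sides_meet assms(3,4) by blast
  moreover have "side vs i \<inter> S \<noteq> {}" using assms by auto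
  ultimately have "?B \<inter> S = {}"
    using assms(1) unfolding connected_closed by (metis Int_commute)
  then show ?thesis using \<open>S \<subseteq> side vs i \<union> ?B\<close> by blast
qed


lemma connected_in_inside:
  assumes "connected R" "R \<inter> boundary vs = {}" "p \<in> R" "p \<in> inside (boundary vs)"
  shows "R \<subseteq> inside (boundary vs)"
proof
  fix y assume y: "y \<in> R"
  then have "connected_component (- boundary vs) p y"
    unfolding connected_component_def using assms by (intro exI[of _ R]) auto
  then show "y \<in> inside (boundary vs)"
    using inside_same_component assms(4) by metis
qed

lemma inside_disjoint: "p \<in> inside (boundary vs) \<Longrightarrow> p \<notin> boundary vs"
  using inside_no_overlap by blast

subsection \<open>The billiard map\<close>

text \<open>Inside points near the start keep the hit times away from 0, and boundedness of the
  inside forces a hit; since the set of hit times is closed, the infimum in \<open>hit_time\<close>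
  is attained.\<close>

lemma hit_properties:
  assumes u: "u \<in> phase_space vs"
  shows hit_time_pos: "0 < hit_time vs u"
    and hit_point_boundary: "hit_point vs u \<in> boundary vs"
    and before_hit_inside:
      "0 < t \<Longrightarrow> t < hit_time vs u \<Longrightarrow> fst u + t *\<^sub>R snd u \<in> inside (boundary vs)"
proof -
  obtain x \<theta> where u': "u = (x, \<theta>)" by (cases u)
  obtain e where th: "norm \<theta> = 1" and e: "e > 0"
    "\<And>t. 0 < t \<Longrightarrow> t < e \<Longrightarrow> x + t *\<^sub>R \<theta> \<in> inside (boundary vs)"
    using u by (auto simp: u' phase_space_def)
  define H where "H = {t. 0 < t \<and> x + t *\<^sub>R \<theta> \<in> boundary vs}"
  have He: "e \<le> t" if "t \<in> H" for t
    using that e(2) inside_disjoint unfolding H_def by force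
  have conn: "connected ((\<lambda>t. x + t *\<^sub>R \<theta>) ` {0<..<b})" "connected ((\<lambda>t. x + t *\<^sub>R \<theta>) ` {0<..})" for b
    by (intro connected_continuous_image continuous_intros connected_Ioo connected_Ioi)+
  have e2: "x + (e/2) *\<^sub>R \<theta> \<in> inside (boundary vs)" using e by simp
  have "H \<noteq> {}"
  proof
    assume "H = {}"
    then have "(\<lambda>t. x + t *\<^sub>R \<theta>) ` {0<..} \<subseteq> inside (boundary vs)"
      using e(1) by (intro connected_in_inside[OF conn(2) _ _ e2]) (auto simp: H_def)
    then have "bounded ((\<lambda>t. x + t *\<^sub>R \<theta>) ` {0<..})"
      using bounded_inside bounded_subset compact_boundary compact_imp_bounded by blast
    then obtain B where B: "\<And>t. 0 < t \<Longrightarrow> norm (x + t *\<^sub>R \<theta>) \<le> B"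
      by (auto simp: bounded_iff)
    define t where "t = \<bar>B\<bar> + norm x + 1"
    have "0 < t" unfolding t_def by (simp add: add_nonneg_pos)
    have "norm (t *\<^sub>R \<theta>) \<le> norm (x + t *\<^sub>R \<theta>) + norm x"
      using norm_triangle_ineq4[of "x + t *\<^sub>R \<theta>" x] by simp
    then have "t \<le> B + norm x" using B[OF \<open>0 < t\<close>] th \<open>0 < t\<close> by simp
    then show False by (simp add: t_def)
  qed
  have "H = {e..} \<inter> (\<lambda>t. x + t *\<^sub>R \<theta>) -` boundary vs"
    using He e(1) by (auto simp: H_def)
  moreover have "closed ({e..} \<inter> (\<lambda>t. x + t *\<^sub>R \<theta>) -` boundary vs)"
    by (intro continuous_closed_preimage continuous_intros closed_boundary)
  ultimately have "closed H" by simp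
  have bb: "bdd_below H" using He by (intro bdd_belowI)
  have ht: "hit_time vs u = Inf H" by (simp add: hit_time_def H_def u')
  have inf: "Inf H \<in> H" using closed_contains_Inf \<open>closed H\<close> bb \<open>H \<noteq> {}\<close> by blast
  then show pos: "0 < hit_time vs u" and "hit_point vs u \<in> boundary vs"
    by (auto simp: ht[unfolded u'] H_def hit_point_def u')
  have eH: "e \<le> Inf H" using inf He by auto
  have "(\<lambda>t. x + t *\<^sub>R \<theta>) ` {0<..<Inf H} \<subseteq> inside (boundary vs)"
  proof (rule connected_in_inside[OF conn(1) _ _ e2])
    show "(\<lambda>t. x + t *\<^sub>R \<theta>) ` {0<..<Inf H} \<inter> boundary vs = {}"
      using cInf_lower[OF _ bb] by (force simp: H_def)
  qed (use e(1) eH in auto)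
  then show "0 < t \<Longrightarrow> t < hit_time vs u \<Longrightarrow> fst u + t *\<^sub>R snd u \<in> inside (boundary vs)"
    by (auto simp: ht[unfolded u'] u' image_subset_iff)
qed

lemma hit_time_eqI:
  assumes "0 < t" "fst u + t *\<^sub>R snd u \<in> boundary vs"
    "\<And>s. 0 < s \<Longrightarrow> s < t \<Longrightarrow> fst u + s *\<^sub>R snd u \<notin> boundary vs"
  shows "hit_time vs u = t" "hit_point vs u = fst u + t *\<^sub>R snd u"
proof -
  show "hit_time vs u = t" unfolding hit_time_def
    using assms by (intro cInf_eq_minimum) (auto simp: not_less[symmetric])
  then show "hit_point vs u = fst u + t *\<^sub>R snd u" by (simp add: hit_point_def)
qed

lemma billiard_map_eq:
  assumes "i < length vs" "hit_point vs u \<in> side vs i" "hit_point vs u \<notin> set vs"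
  shows "billiard_map vs u = (hit_point vs u, side_reflection vs i (snd u))"
proof -
  have "(THE j. j < length vs \<and> hit_point vs u \<in> side vs j) = i"
    using assms sides_meet by (intro the_equality) auto
  then show ?thesis by (simp add: billiard_map_def)
qed

lemma norm_side_reflection: "i < length vs \<Longrightarrow> norm (side_reflection vs i z) = norm z"
  using side_vector_nz by (simp add: side_reflection_def Let_def norm_mult norm_divide)

lemma side_reflection_involutive: "i < length vs \<Longrightarrow> side_reflection vs i (side_reflection vs i z) = z"
  using side_vector_nz by (simp add: side_reflection_def Let_def field_simps)

lemma Im_side_line:
  assumes "y \<in> side vs i" "z \<in> side vs i"
  shows "Im (cnj (side_vector vs i) * (y - z)) = 0"
proof -
  obtain a b where "y = vs ! i + a *\<^sub>R side_vector vs i" "z = vs ! i + b *\<^sub>R side_vector vs i"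
    using assms by (auto simp: side_def side_vector_def in_segment algebra_simps)
  then have yz: "y - z = (a - b) *\<^sub>R side_vector vs i" by (simp add: algebra_simps)
  show ?thesis unfolding yz by (simp add: algebra_simps)
qed

lemma noncorner_side_interior:
  assumes "i < length vs" "z \<in> side vs i" "z \<notin> set vs"
  shows "\<exists>e>0. \<forall>t. \<bar>t\<bar> < e \<longrightarrow> z + t *\<^sub>R side_vector vs i \<in> side vs i"
proof -
  obtain a where a: "0 \<le> a" "a \<le> 1" "z = vs ! i + a *\<^sub>R side_vector vs i"
    using assms by (auto simp: side_def side_vector_def in_segment algebra_simps)
  have "a \<noteq> 0" "a \<noteq> 1" using a assms nth_mem[of i vs]
      nth_mem[of "Suc i mod length vs" vs, OF mod_less_divisor[OF length_pos]]
    by (auto simp: side_vector_def)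
  then have a01: "0 < a" "a < 1" using a by auto
  show ?thesis
  proof (intro exI[of _ "min a (1 - a)"] conjI allI impI)
    fix t :: real assume "\<bar>t\<bar> < min a (1 - a)"
    then show "z + t *\<^sub>R side_vector vs i \<in> side vs i"
      unfolding a(3) side_def in_segment side_vector_def
      by (intro exI[of _ "a + t"]) (auto simp: algebra_simps)
  qed (use a01 in auto)
qed

text \<open>A half disc at a point of a side avoids the boundary; since it contains the end of the
  incoming segment, it lies inside, and the reflected direction enters it.\<close>

lemma billiard_map_phase_space:
  assumes u: "u \<in> phase_space vs" and nc: "hit_point vs u \<notin> set vs"
  shows "billiard_map vs u \<in> phase_space vs"
proof -
  define z where "z = hit_point vs u"
  define \<theta> where "\<theta> = snd u"
  have zb: "z \<in> boundary vs" "z \<notin> set vs" using hit_point_boundary u nc by (auto simp: z_def)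
  then obtain i where i: "i < length vs" "z \<in> side vs i" using ex1_side by blast
  have th: "norm \<theta> = 1" using u by (auto simp: phase_space_def \<theta>_def)
  have T: "billiard_map vs u = (z, side_reflection vs i \<theta>)"
    unfolding z_def \<theta>_def using i zb by (intro billiard_map_eq) (auto simp: z_def)
  define w where "w = side_vector vs i"
  have w0: "w \<noteq> 0" using side_vector_nz i by (simp add: w_def)
  obtain e where e: "e > 0" "\<And>y. y \<in> boundary vs \<Longrightarrow> dist y z < e \<Longrightarrow> y \<in> side vs i"
    using side_noncorner_nbhd i zb by blast
  define h where "h = hit_time vs u"
  have h: "h > 0" using hit_time_pos u by (simp add: h_def)
  have bef: "z - t *\<^sub>R \<theta> \<in> inside (boundary vs)" if "0 < t" "t < h" for t
    using before_hit_inside[OF u, of "h - t"] that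
    by (simp add: z_def hit_point_def h_def \<theta>_def algebra_simps)
  define k where "k = Im (cnj w * \<theta>)"
  \<comment> \<open>A direction parallel to the side would have run along the side just before the
    hit, but the incoming segment lies inside.\<close>
  have k: "k \<noteq> 0"
  proof
    assume "k = 0"
    then obtain r where wt: "\<theta> = r *\<^sub>R w" using w0 Im_cnj_mult_eq_0 unfolding k_def by blast
    obtain e' where e': "e' > 0" "\<And>t. \<bar>t\<bar> < e' \<Longrightarrow> z + t *\<^sub>R w \<in> side vs i"
      using noncorner_side_interior i zb unfolding w_def by blast
    have "r \<noteq> 0" using wt th by auto
    define t where "t = min (h / 2) (e' / (2 * \<bar>r\<bar>))"
    have t: "0 < t" "t < h" "t * \<bar>r\<bar> < e'"
      using h e'(1) \<open>r \<noteq> 0\<close> by (auto simp: t_def min_def field_simps)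
    have "z - t *\<^sub>R \<theta> = z + (- t * r) *\<^sub>R w" by (subst wt) simp
    also have "\<dots> \<in> side vs i" using t by (intro e') (simp add: abs_mult)
    finally have "z - t *\<^sub>R \<theta> \<in> boundary vs" using i by (auto simp: boundary_eq)
    then show False using bef t inside_disjoint by blast
  qed
  \<comment> \<open>The factor \<open>- k\<close> turns the normal towards the incoming trajectory;
    both \<open>- \<theta>\<close> and the reflected direction then have a positive component along
    it.\<close>
  define A where "A = ball z e \<inter> {y. inner (- k *\<^sub>R (\<i> * w)) (y - z) > 0}"
  have inn: "inner (- k *\<^sub>R (\<i> * w)) y = - k * Im (cnj w * y)" for y
    by (simp add: inner_complex_def algebra_simps)
  have hs: "convex {y. 0 < inner a (y - z)}" for a :: complex
    using convex_halfspace_gt[of "inner a z" a] by (simp add: inner_diff_right)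
  have "convex A" unfolding A_def by (intro convex_Int convex_ball hs)
  have mem: "z + t *\<^sub>R v \<in> A" if "0 < t" "t < e" "norm v = 1" "Im (cnj w * v) = - k" for t v
  proof -
    have "Im (cnj w * (t *\<^sub>R v)) = t * (- k)" using that(4) by (simp flip: that(4))
    then have "inner (- k *\<^sub>R (\<i> * w)) (t *\<^sub>R v) = t * k\<^sup>2"
      unfolding inn by (simp add: power2_eq_square)
    moreover have "0 < t * k\<^sup>2" using that k by simp
    ultimately have "0 < inner (- k *\<^sub>R (\<i> * w)) (t *\<^sub>R v)" by (simp only:)
    moreover have "z + t *\<^sub>R v \<in> ball z e" using that by (simp add: dist_norm)
    ultimately show ?thesis by (simp only: A_def Int_iff mem_Collect_eq add_diff_cancel_left')
  qed
  have disj: "A \<inter> boundary vs = {}"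
  proof -
    have False if "y \<in> A" "y \<in> boundary vs" for y
    proof -
      have "y \<in> side vs i" using e(2)[of y] that by (auto simp: A_def dist_commute)
      then have "Im (cnj w * (y - z)) = 0" using Im_side_line i by (simp add: w_def)
      moreover have "inner (- k *\<^sub>R (\<i> * w)) (y - z) > 0" using that by (simp add: A_def)
      ultimately show False unfolding inn by simp
    qed
    then show ?thesis by auto
  qed
  define t where "t = min e h / 2"
  have t: "0 < t" "t < e" "t < h" using e h by (auto simp: t_def)
  have "A \<subseteq> inside (boundary vs)"
  proof (rule connected_in_inside[OF _ disj])
    show "connected A" using \<open>convex A\<close> convex_connected by blast
    show "z - t *\<^sub>R \<theta> \<in> A" using mem[of t "- \<theta>"] t th by (simp add: k_def)
    show "z - t *\<^sub>R \<theta> \<in> inside (boundary vs)" using bef t by auto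
  qed
  moreover have "z + s *\<^sub>R side_reflection vs i \<theta> \<in> A" if "0 < s" "s < e" for s
  proof (rule mem[OF that])
    show "norm (side_reflection vs i \<theta>) = 1" using norm_side_reflection i th by simp
    have "cnj w * side_reflection vs i \<theta> = cnj (cnj w * \<theta>)"
      using w0 by (simp add: side_reflection_def w_def Let_def)
    then show "Im (cnj w * side_reflection vs i \<theta>) = - k" by (simp add: k_def)
  qed
  ultimately show ?thesis
    unfolding T phase_space_def using zb norm_side_reflection i th e(1) by auto
qed

end

section \<open>Order equivalence induces a homeomorphism of the boundaries\<close>

text \<open>Moving the base point of the loop to \<open>x 0\<close> turns the cyclic order seen from
  \<open>x 0\<close> into the linear order of the parameters in \<open>[0,1)\<close>.\<close>

lemma (in simple_polygon) ordered_loop: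
  fixes x :: "nat \<Rightarrow> complex"
  assumes x: "\<And>n. x n \<in> boundary vs"
  obtains g a where "simple_path g" "pathfinish g = pathstart g" "path_image g = boundary vs"
    "\<And>n. 0 \<le> a n" "\<And>n. a n < 1" "\<And>n. g (a n) = x n" "a 0 = 0"
    "\<And>k m. x k \<in> ccw_arc vs (x 0) (x m) \<longleftrightarrow> a k \<le> a m"
proof -
  let ?p = "boundary_path vs"
  have lf: "loop_free ?p" using simple by (simp add: simple_path_def)
  have ex: "\<exists>t\<in>{0..<1}. ?p t = z" if z: "z \<in> boundary vs" for z
  proof -
    obtain t where "t \<in> {0..1}" "?p t = z" using z unfolding boundary_def path_image_def by blast
    then show ?thesis using closed_loop
      by (cases "t = 1") (auto simp: pathfinish_def pathstart_def intro: bexI[of _ 0] bexI[of _ t])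
  qed
  have uniq: "s = t" if "s \<in> {0..<1}" "t \<in> {0..<1}" "?p s = ?p t" for s t
    using lf that unfolding loop_free_def by force
  obtain b where b: "\<And>n. b n \<in> {0..<1}" "\<And>n. ?p (b n) = x n"
    using ex[OF x] by metis
  have arc: "x k \<in> ccw_arc vs (x l) (x m) \<longleftrightarrow>
      (if b l \<le> b m then b l \<le> b k \<and> b k \<le> b m else b l \<le> b k \<or> b k \<le> b m)" for k l m
  proof
    assume "x k \<in> ccw_arc vs (x l) (x m)"
    then obtain r s t where rst: "r \<in> {0..<1}" "s \<in> {0..<1}" "t \<in> {0..<1}"
      "?p r = x k" "?p s = x l" "?p t = x m"
      "if s \<le> t then s \<le> r \<and> r \<le> t else s \<le> r \<or> r \<le> t"
      unfolding ccw_arc_def by auto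
    then have "r = b k" "s = b l" "t = b m" using uniq b by auto
    then show "if b l \<le> b m then b l \<le> b k \<and> b k \<le> b m else b l \<le> b k \<or> b k \<le> b m"
      using rst(7) by (simp split: if_splits)
  next
    assume "if b l \<le> b m then b l \<le> b k \<and> b k \<le> b m else b l \<le> b k \<or> b k \<le> b m"
    then show "x k \<in> ccw_arc vs (x l) (x m)"
      unfolding ccw_arc_def using b by (intro CollectI exI[of _ "b k"] exI[of _ "b l"] exI[of _ "b m"]) auto
  qed
  define a where "a n = (if b 0 \<le> b n then b n - b 0 else b n - b 0 + 1)" for n
  let ?g = "shiftpath (b 0) ?p"
  have b0: "b 0 \<in> {0..1}" using b(1)[of 0] by auto
  show thesis
  proof
    show "simple_path ?g" using b0 simple closed_loop by (intro simple_path_shiftpath) auto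
    show "pathfinish ?g = pathstart ?g" using b0 closed_loop by (intro closed_shiftpath)
    show "path_image ?g = boundary vs" using b0 closed_loop by (simp add: path_image_shiftpath boundary_def)
    show "0 \<le> a n" "a n < 1" for n using b(1)[of n] b(1)[of 0] by (auto simp: a_def)
    show "?g (a n) = x n" for n
      using b(1)[of n] b(1)[of 0] b(2)[of n] closed_loop
      by (auto simp: a_def shiftpath_def pathfinish_def pathstart_def)
    show "a 0 = 0" by (simp add: a_def)
    show "x k \<in> ccw_arc vs (x 0) (x m) \<longleftrightarrow> a k \<le> a m" for k m
      unfolding arc a_def using b(1)[of k] b(1)[of m] b(1)[of 0] by auto
  qed
qed

text \<open>The loop maps the parameters outside \<open>(s, t)\<close> to a compact set that misses
  the value at the midpoint, so density supplies a point off this set, and its parameter lies in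
  \<open>(s, t)\<close>.\<close>

lemma dense_parameters:
  fixes g :: "real \<Rightarrow> complex"
  assumes g: "simple_path g" and dense: "path_image g \<subseteq> closure (range x)"
    and a: "\<And>n. 0 \<le> a n" "\<And>n. a n < 1" "\<And>n. g (a n) = x n"
    and st: "0 \<le> s" "s < t" "t \<le> 1"
  shows "\<exists>n. s < a n \<and> a n < t"
proof -
  let ?C = "g ` ({0..s} \<union> {t..1})" and ?m = "(s + t) / 2"
  have "continuous_on {0..1} g" using g by (simp add: simple_path_def path_def)
  then have "compact ?C"
    using st by (intro compact_continuous_image compact_Un compact_Icc) (auto elim: continuous_on_subset)
  then have "open (- ?C)" by (simp add: compact_imp_closed open_Compl)
  moreover have "g ?m \<in> - ?C"
  proof
    assume "g ?m \<in> ?C"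
    then obtain r where r: "r \<in> {0..s} \<union> {t..1}" "g ?m = g r" by (rule imageE)
    then have "?m \<in> {0..1}" "r \<in> {0..1}" using st by auto
    then have "?m = r \<or> ?m = 0 \<and> r = 1 \<or> ?m = 1 \<and> r = 0"
      using g r(2) unfolding simple_path_def loop_free_def by blast
    then show False using r(1) st by auto
  qed
  moreover have "g ?m \<in> closure (range x)"
    using dense st by (auto simp: path_image_def)
  ultimately have "- ?C \<inter> range x \<noteq> {}"
    using open_Int_closure_eq_empty by blast
  then obtain n where "x n \<notin> ?C" by auto
  then have "a n \<notin> {0..s} \<union> {t..1}" using a(3) by (metis imageI)
  then show ?thesis using a(1)[of n] a(2)[of n] by (intro exI[of _ n]) auto
qed

text \<open>An order isomorphism of two dense sets extends by suprema. Density of \<open>a\<close>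
  makes the extension strictly increasing; density of \<open>b\<close> excludes jumps.\<close>

lemma monotone_extension:
  fixes a b :: "nat \<Rightarrow> real"
  assumes a: "\<And>n. 0 \<le> a n" "\<And>n. a n < 1" "a 0 = 0"
    and b: "\<And>n. 0 \<le> b n" "\<And>n. b n < 1" "b 0 = 0"
    and ord: "\<And>k m. a k \<le> a m \<longleftrightarrow> b k \<le> b m"
    and da: "\<And>s t. 0 \<le> s \<Longrightarrow> s < t \<Longrightarrow> t \<le> 1 \<Longrightarrow> \<exists>n. s < a n \<and> a n < t"
    and db: "\<And>s t. 0 \<le> s \<Longrightarrow> s < t \<Longrightarrow> t \<le> 1 \<Longrightarrow> \<exists>n. s < b n \<and> b n < t"
  obtains h where "continuous_on {0..1} h" "strict_mono_on {0..1} h" "h 0 = 0" "h 1 = 1"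
    "\<And>n. h (a n) = b n"
proof -
  define h where "h t = Sup {b n | n. a n \<le> t}" for t
  have bdd: "bdd_above {b n | n. a n \<le> t}" for t
  proof (rule bdd_aboveI[of _ 1])
    fix z assume "z \<in> {b n | n. a n \<le> t}"
    then obtain n where "z = b n" by blast
    then show "z \<le> 1" using less_imp_le[OF b(2)] by simp
  qed
  have upper: "b n \<le> h t" if "a n \<le> t" for n t
    unfolding h_def by (rule cSup_upper[OF _ bdd]) (use that in blast)
  have lower: "h t \<le> c" if "0 \<le> t" "\<And>n. a n \<le> t \<Longrightarrow> b n \<le> c" for t c
  proof -
    have "b 0 \<in> {b n | n. a n \<le> t}" using a(3) that(1) by (intro CollectI exI[of _ 0]) simp
    then show ?thesis unfolding h_def using that(2) by (intro cSup_least) blast+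
  qed
  have hb: "h t \<le> b n" if "0 \<le> t" "t \<le> a n" for t n
    using that ord[of _ n] by (intro lower) force+
  have ha: "h (a n) = b n" for n
    using hb[of "a n" n] upper[of n "a n"] a(1) by force
  have h01: "0 \<le> h t" "h t \<le> 1" if "0 \<le> t" for t
    using upper[of 0 t] b(3) a(3) that lower[of t 1] less_imp_le[OF b(2)] by auto
  have sm: "strict_mono_on {0..1} h"
  proof (rule strict_mono_onI)
    fix s t :: real assume st: "s \<in> {0..1}" "t \<in> {0..1}" "s < t"
    obtain n where n: "s < a n" "a n < t" using da[of s t] st by auto
    obtain m where m: "a n < a m" "a m < t" using da[of "a n" t] a(1) n st by auto
    have "b n < b m" using ord[of m n] m by auto
    then show "h s < h t" using hb[of s n] upper[of m t] n m st by auto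
  qed
  have h0: "h 0 = 0" using ha[of 0] a b by simp
  have h1: "h 1 = 1"
  proof (rule ccontr)
    assume "h 1 \<noteq> 1"
    then have "h 1 < 1" using h01[of 1] by auto
    then obtain n where "h 1 < b n" using db[of "h 1" 1] h01[of 1] by auto
    then show False using upper[of n 1] a(2)[of n] by auto
  qed
  have "continuous_on {0..1} h"
    unfolding continuous_on_iff
  proof (intro ballI allI impI)
    fix t e :: real assume t: "t \<in> {0..1}" and e: "0 < e"
    have "\<exists>d>0. \<forall>s\<in>{0..1}. t - d < s \<longrightarrow> h t - e < h s"
    proof (cases "h t = 0")
      case True
      then show ?thesis using h01 e by (intro exI[of _ 1]) fastforce
    next
      case False
      then have "0 < h t" using h01[of t] t by auto
      then obtain n where n: "max 0 (h t - e) < b n" "b n < h t"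
        using db[of "max 0 (h t - e)" "h t"] h01[of t] t e by auto
      have "a n < t" using hb[of t n] n t by force
      moreover have "h t - e < h s" if "a n < s" for s using upper[of n s] n that by auto
      ultimately show ?thesis by (intro exI[of _ "t - a n"]) auto
    qed
    then obtain d1 where d1: "d1 > 0" "\<And>s. s \<in> {0..1} \<Longrightarrow> t - d1 < s \<Longrightarrow> h t - e < h s" by auto
    have "\<exists>d>0. \<forall>s\<in>{0..1}. s < t + d \<longrightarrow> h s < h t + e"
    proof (cases "h t = 1")
      case True
      then show ?thesis using h01 e by (intro exI[of _ 1]) fastforce
    next
      case False
      then have "h t < 1" using h01[of t] t by auto
      then obtain n where n: "h t < b n" "b n < min 1 (h t + e)"
        using db[of "h t" "min 1 (h t + e)"] h01[of t] t e by auto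
      have "t < a n" using upper[of n t] n by force
      moreover have "h s < h t + e" if "0 \<le> s" "s < a n" for s using hb[of s n] n that by auto
      ultimately show ?thesis by (intro exI[of _ "a n - t"]) auto
    qed
    then obtain d2 where d2: "d2 > 0" "\<And>s. s \<in> {0..1} \<Longrightarrow> s < t + d2 \<Longrightarrow> h s < h t + e" by auto
    show "\<exists>d>0. \<forall>s\<in>{0..1}. dist s t < d \<longrightarrow> dist (h s) (h t) < e"
    proof (intro exI[of _ "min d1 d2"] conjI ballI impI)
      fix s assume "s \<in> {0..1}" "dist s t < min d1 d2"
      moreover from this have "t - d1 < s" "s < t + d2" by (auto simp: dist_real_def)
      ultimately show "dist (h s) (h t) < e" using d1(2)[of s] d2(2)[of s] by (auto simp: dist_real_def)
    qed (use d1 d2 in auto)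
  qed
  then show thesis using that sm h0 h1 ha by blast
qed

lemma simple_loop_eq_iff:
  assumes "simple_path g" "pathfinish g = pathstart g" "s \<in> {0..1}" "t \<in> {0..1}"
  shows "g s = g t \<longleftrightarrow> s = t \<or> s = 0 \<and> t = 1 \<or> s = 1 \<and> t = 0"
proof
  show "g s = g t \<Longrightarrow> s = t \<or> s = 0 \<and> t = 1 \<or> s = 1 \<and> t = 0"
    using assms unfolding simple_path_def loop_free_def by blast
qed (use assms(2) in \<open>auto simp: pathfinish_def pathstart_def\<close>)

lemma boundary_homeomorphism:
  assumes P: "simple_polygon P" and Q: "simple_polygon Q"
    and x: "\<And>n. x n \<in> boundary P" and y: "\<And>n. y n \<in> boundary Q"
    and dx: "boundary P \<subseteq> closure (range x)" and dy: "boundary Q \<subseteq> closure (range y)"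
    and ord: "same_combinatorial_order P x Q y"
  obtains \<phi> \<psi> where "homeomorphism (boundary P) (boundary Q) \<phi> \<psi>" "\<And>n. \<phi> (x n) = y n"
proof -
  obtain g a where g: "simple_path g" "pathfinish g = pathstart g" "path_image g = boundary P"
    and a: "\<And>n. 0 \<le> a n" "\<And>n. a n < 1" "\<And>n. g (a n) = x n" "a 0 = 0"
      "\<And>k m. x k \<in> ccw_arc P (x 0) (x m) \<longleftrightarrow> a k \<le> a m"
    by (rule simple_polygon.ordered_loop[where x = x, OF P x]) blast
  obtain g' b where g': "simple_path g'" "pathfinish g' = pathstart g'" "path_image g' = boundary Q"
    and b: "\<And>n. 0 \<le> b n" "\<And>n. b n < 1" "\<And>n. g' (b n) = y n" "b 0 = 0"
      "\<And>k m. y k \<in> ccw_arc Q (y 0) (y m) \<longleftrightarrow> b k \<le> b m"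
    by (rule simple_polygon.ordered_loop[where x = y, OF Q y]) blast
  have ab: "a k \<le> a m \<longleftrightarrow> b k \<le> b m" for k m
    using ord a(5) b(5) unfolding same_combinatorial_order_def by metis
  obtain h where h: "continuous_on {0..1} h" "strict_mono_on {0..1} h" "h 0 = 0" "h 1 = 1"
    "\<And>n. h (a n) = b n"
    by (rule monotone_extension[of a b, OF a(1,2,4) b(1,2,4) ab])
      (use dense_parameters[OF g(1) _ a(1-3)] dense_parameters[OF g'(1) _ b(1-3)] dx dy g(3) g'(3) in auto)
  have hI: "h ` {0..1} = {0..1}"
  proof
    have mono: "mono_on {0..1} h" using h(2) by (simp add: strict_mono_on_imp_mono_on)
    have "0 \<le> h t \<and> h t \<le> 1" if "t \<in> {0..1}" for t
      using mono_onD[OF mono, of 0 t] mono_onD[OF mono, of t 1] h that by auto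
    then show "h ` {0..1} \<subseteq> {0..1}" by auto
    show "{0..1} \<subseteq> h ` {0..1}"
      using IVT'[of h 0 _ 1] h by (force simp: image_iff)
  qed
  define H where "H = g' \<circ> h"
  have cg: "continuous_on {0..1} g" "continuous_on {0..1} g'"
    using g(1) g'(1) by (auto simp: simple_path_def path_def)
  have cH: "continuous_on {0..1} H"
    unfolding H_def using h(1) cg(2) hI by (intro continuous_on_compose) auto
  have HI: "H ` {0..1} = boundary Q"
    unfolding H_def using g'(3) hI by (metis image_comp path_image_def)
  have GI: "g ` {0..1} = boundary P" using g(3) by (simp add: path_image_def)
  have inj: "h s = h t \<longleftrightarrow> s = t" if "s \<in> {0..1}" "t \<in> {0..1}" for s t
    using strict_mono_on_imp_inj_on[OF h(2)] that by (auto dest: inj_onD)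
  have gg: "g s = g t \<longleftrightarrow> s = t \<or> s = 0 \<and> t = 1 \<or> s = 1 \<and> t = 0" if "s \<in> {0..1}" "t \<in> {0..1}" for s t
    by (rule simple_loop_eq_iff) (use g that in auto)
  have gg': "g' s = g' t \<longleftrightarrow> s = t \<or> s = 0 \<and> t = 1 \<or> s = 1 \<and> t = 0" if "s \<in> {0..1}" "t \<in> {0..1}" for s t
    by (rule simple_loop_eq_iff) (use g' that in auto)
  have h01: "h s = 0 \<longleftrightarrow> s = 0" "h s = 1 \<longleftrightarrow> s = 1" if "s \<in> {0..1}" for s
    using inj[of s 0] inj[of s 1] h(3,4) that by simp_all
  have hm: "h s \<in> {0..1}" if "s \<in> {0..1}" for s using hI that by blast
  have GH: "g s = g t \<longleftrightarrow> H s = H t" if st: "s \<in> {0..1}" "t \<in> {0..1}" for s t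
    unfolding H_def o_apply gg[OF st] gg'[OF hm[OF st(1)] hm[OF st(2)]] inj[OF st] h01[OF st(1)] h01[OF st(2)] ..
  \<comment> \<open>At the base point \<open>inv_into\<close> may return 0 or 1; by
    \<open>GH\<close> the value does not depend on this.\<close>
  define \<phi> where "\<phi> z = H (inv_into {0..1} g z)" for z
  have \<phi>g: "\<phi> (g t) = H t" if "t \<in> {0..1}" for t
  proof -
    have "g (inv_into {0..1} g (g t)) = g t" "inv_into {0..1} g (g t) \<in> {0..1}"
      using that f_inv_into_f[of "g t" g "{0..1}"] inv_into_into[of "g t" g "{0..1}"] by auto
    then show ?thesis using GH that by (simp add: \<phi>_def)
  qed
  \<comment> \<open>\<open>g\<close> maps closed subsets of the interval to closed sets, so it acts
    as a quotient map: closedness of preimages is checked for \<open>H\<close> instead.\<close>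
  have "continuous_on (boundary P) \<phi>"
  proof (subst continuous_on_closed_vimage)
    show "closed (boundary P)" using P by (rule simple_polygon.closed_boundary)
    show "\<forall>C. closed C \<longrightarrow> closed (\<phi> -` C \<inter> boundary P)"
    proof (intro allI impI)
      fix C :: "complex set" assume "closed C"
      have "\<phi> -` C \<inter> boundary P = g ` ({0..1} \<inter> H -` C)"
        unfolding GI[symmetric] using \<phi>g by auto
      moreover have "compact ({0..1} \<inter> H -` C)"
        using continuous_closed_preimage[OF cH _ \<open>closed C\<close>] by (simp add: compact_eq_bounded_closed bounded_Int)
      then have "compact (g ` ({0..1} \<inter> H -` C))"
        using cg by (intro compact_continuous_image) (auto elim: continuous_on_subset)
      ultimately show "closed (\<phi> -` C \<inter> boundary P)" by (simp add: compact_imp_closed)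
    qed
  qed
  moreover have "\<phi> ` boundary P = boundary Q"
    unfolding GI[symmetric] HI[symmetric] image_image using \<phi>g by auto
  moreover have "inj_on \<phi> (boundary P)"
    unfolding GI[symmetric] using \<phi>g GH by (auto simp: inj_on_def)
  ultimately obtain \<psi> where "homeomorphism (boundary P) (boundary Q) \<phi> \<psi>"
    using homeomorphism_compact simple_polygon.compact_boundary[OF P] by blast
  moreover have "\<phi> (x n) = y n" for n
    using \<phi>g[of "a n"] a(1,2,3)[of n] b(3)[of n] h(5)[of n] by (simp add: H_def)
  ultimately show thesis using that by blast
qed

section \<open>Time reversal\<close>

text \<open>Reverses a chord without reflecting it, so that it makes sense also when the chord ends
  in a corner; it is an involution of the phase space.\<close>

definition flip :: "complex list \<Rightarrow> phase_point \<Rightarrow> phase_point" where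
  "flip vs u = (hit_point vs u, - snd u)"

lemma snd_flip [simp]: "snd (flip vs u) = - snd u"
  and fst_flip [simp]: "fst (flip vs u) = hit_point vs u"
  by (simp_all add: flip_def)

lemma phase_spaceD:
  assumes "u \<in> phase_space vs"
  shows "fst u \<in> boundary vs" "norm (snd u) = 1"
  using assms by (auto simp: phase_space_def)

lemma side_reflection_minus [simp]: "side_reflection vs i (- z) = - side_reflection vs i z"
  by (simp add: side_reflection_def Let_def)

context simple_polygon
begin

lemma
  assumes u: "u \<in> phase_space vs"
  shows flip_phase_space: "flip vs u \<in> phase_space vs"
    and hit_point_flip: "hit_point vs (flip vs u) = fst u"
    and flip_flip: "flip vs (flip vs u) = u"
proof -
  define h where "h = hit_time vs u"
  have h: "0 < h" using hit_time_pos[OF u] by (simp add: h_def)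
  have y: "hit_point vs u = fst u + h *\<^sub>R snd u" by (simp add: hit_point_def h_def)
  have ins: "hit_point vs u + s *\<^sub>R (- snd u) \<in> inside (boundary vs)" if "0 < s" "s < h" for s
    using before_hit_inside[OF u, of "h - s"] that unfolding y h_def by (simp add: algebra_simps)
  show "flip vs u \<in> phase_space vs"
    unfolding flip_def phase_space_def
    using hit_point_boundary[OF u] phase_spaceD[OF u] h ins by auto
  show *: "hit_point vs (flip vs u) = fst u"
    using hit_time_eqI(2)[OF h, of "flip vs u"] ins inside_disjoint phase_spaceD[OF u] y by auto
  show "flip vs (flip vs u) = u"
    unfolding flip_def[of _ "flip vs u"] * by simp
qed

lemma billiard_map_noncorner:
  assumes "u \<in> phase_space vs" "hit_point vs u \<notin> set vs"
  obtains i where "i < length vs" "hit_point vs u \<in> side vs i"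
    "billiard_map vs u = (hit_point vs u, side_reflection vs i (snd u))"
  using billiard_map_eq ex1_side[OF hit_point_boundary[OF assms(1)] assms(2)] assms by metis

lemma fst_billiard_map [simp]: "fst (billiard_map vs u) = hit_point vs u"
  by (simp add: billiard_map_def)

text \<open>Reversing, stepping and reversing again undoes a step: the reflection is an involution
  and commutes with negation. Injectivity of the billiard map and the treatment of the past are read
  off from this.\<close>

lemma billiard_map_flip:
  assumes u: "u \<in> phase_space vs" and nc: "hit_point vs u \<notin> set vs"
  shows "hit_point vs (flip vs (billiard_map vs u)) = hit_point vs u"
    and "billiard_map vs (flip vs (billiard_map vs u)) = flip vs u"
proof -
  obtain i where i: "i < length vs" "hit_point vs u \<in> side vs i"
    "billiard_map vs u = (hit_point vs u, side_reflection vs i (snd u))"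
    by (rule billiard_map_noncorner[OF u nc])
  have T: "billiard_map vs u \<in> phase_space vs" using billiard_map_phase_space u nc .
  show h: "hit_point vs (flip vs (billiard_map vs u)) = hit_point vs u"
    using hit_point_flip[OF T] by simp
  show "billiard_map vs (flip vs (billiard_map vs u)) = flip vs u"
  proof -
    have "billiard_map vs (flip vs (billiard_map vs u)) =
        (hit_point vs u, side_reflection vs i (snd (flip vs (billiard_map vs u))))"
      using billiard_map_eq[of i "flip vs (billiard_map vs u)"] i(1,2) nc unfolding h by blast
    also have "snd (flip vs (billiard_map vs u)) = - side_reflection vs i (snd u)"
      using i(3) by simp
    finally show ?thesis using side_reflection_involutive i(1) by (simp add: flip_def)
  qed
qed

lemma billiard_map_inj:
  assumes "u \<in> phase_space vs" "hit_point vs u \<notin> set vs"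
    and "u' \<in> phase_space vs" "hit_point vs u' \<notin> set vs"
    and "billiard_map vs u = billiard_map vs u'"
  shows "u = u'"
  using billiard_map_flip(2)[of u] billiard_map_flip(2)[of u'] flip_flip[of u] flip_flip[of u'] assms
  by metis

text \<open>The first \<open>n\<close> steps exist. The chord at time \<open>n\<close> may itself
  end in a corner; the gap argument stops exactly there.\<close>

definition runs :: "nat \<Rightarrow> phase_point \<Rightarrow> bool" where
  "runs n u \<longleftrightarrow> u \<in> phase_space vs \<and> (\<forall>k<n. hit_point vs ((billiard_map vs ^^ k) u) \<notin> set vs)"

lemma runs_0 [simp]: "runs 0 u \<longleftrightarrow> u \<in> phase_space vs"
  by (simp add: runs_def)

lemma runs_mono: "runs n u \<Longrightarrow> k \<le> n \<Longrightarrow> runs k u"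
  by (simp add: runs_def)

lemma runs_in_phase_space: "runs n u \<Longrightarrow> (billiard_map vs ^^ n) u \<in> phase_space vs"
proof (induction n)
  case (Suc n)
  then show ?case using billiard_map_phase_space runs_mono[of "Suc n" u n] by (auto simp: runs_def)
qed simp

lemma runs_add: "runs (m + n) u \<longleftrightarrow> runs m u \<and> runs n ((billiard_map vs ^^ m) u)"
proof
  assume r: "runs (m + n) u"
  have "hit_point vs ((billiard_map vs ^^ k) ((billiard_map vs ^^ m) u)) \<notin> set vs" if "k < n" for k
    using r that unfolding runs_def
    by (metis add.commute add_less_cancel_left comp_apply funpow_add)
  then show "runs m u \<and> runs n ((billiard_map vs ^^ m) u)"
    using r runs_mono[of "m + n" u m] runs_in_phase_space[of m u] by (auto simp: runs_def)
next
  assume *: "runs m u \<and> runs n ((billiard_map vs ^^ m) u)"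
  show "runs (m + n) u" unfolding runs_def
  proof (intro conjI allI impI)
    fix k assume k: "k < m + n"
    show "hit_point vs ((billiard_map vs ^^ k) u) \<notin> set vs"
    proof (cases "k < m")
      case False
      then have "(billiard_map vs ^^ k) u = (billiard_map vs ^^ (k - m)) ((billiard_map vs ^^ m) u)"
        by (simp flip: funpow_add[THEN fun_cong, unfolded comp_apply])
      then show ?thesis using * k False by (auto simp: runs_def)
    qed (use * in \<open>auto simp: runs_def\<close>)
  qed (use * in \<open>auto simp: runs_def\<close>)
qed

lemma runs_Suc: "runs (Suc n) u \<longleftrightarrow> runs n u \<and> hit_point vs ((billiard_map vs ^^ n) u) \<notin> set vs"
  by (auto simp: runs_def less_Suc_eq)

lemma runs_flip:
  "runs n u \<Longrightarrow> runs n (flip vs ((billiard_map vs ^^ n) u)) \<and>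
    (billiard_map vs ^^ n) (flip vs ((billiard_map vs ^^ n) u)) = flip vs u"
proof (induction n arbitrary: u)
  case 0
  then show ?case by (simp add: flip_phase_space)
next
  case (Suc n)
  have u: "u \<in> phase_space vs" "hit_point vs u \<notin> set vs" and r: "runs n (billiard_map vs u)"
    using Suc.prems runs_add[of 1 n u] by (auto simp: runs_def)
  let ?v = "flip vs ((billiard_map vs ^^ n) (billiard_map vs u))"
  have IH: "runs n ?v" "(billiard_map vs ^^ n) ?v = flip vs (billiard_map vs u)"
    using Suc.IH[OF r] by auto
  have "(billiard_map vs ^^ Suc n) u = (billiard_map vs ^^ n) (billiard_map vs u)"
    by (simp add: funpow_swap1)
  then show ?case using IH billiard_map_flip[OF u] u by (simp add: runs_Suc)
qed

lemma billiard_funpow_inj: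
  assumes "runs n u" "runs n u'" "(billiard_map vs ^^ n) u = (billiard_map vs ^^ n) u'"
  shows "u = u'"
  using runs_flip[OF assms(1)] runs_flip[OF assms(2)] assms(3) flip_flip[of u] flip_flip[of u'] assms
  by (metis runs_def)

lemma snd_billiard_funpow:
  assumes "runs n u"
  shows "\<exists>g\<in>reflection_group vs. snd ((billiard_map vs ^^ n) u) = g (snd u)"
  using assms
proof (induction n)
  case 0
  then show ?case by (intro bexI[of _ id]) (auto intro: reflection_group.one)
next
  case (Suc n)
  then obtain g where g: "g \<in> reflection_group vs" "snd ((billiard_map vs ^^ n) u) = g (snd u)"
    by (auto simp: runs_Suc)
  obtain i where "i < length vs" "billiard_map vs ((billiard_map vs ^^ n) u) =
      (hit_point vs ((billiard_map vs ^^ n) u), side_reflection vs i (snd ((billiard_map vs ^^ n) u)))"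
    using Suc.prems runs_in_phase_space billiard_map_noncorner unfolding runs_Suc by metis
  then show ?case
    using g by (intro bexI[of _ "side_reflection vs i \<circ> g"]) (auto intro: reflection_group.step)
qed

text \<open>\<open>reflection_group\<close> grows by composition on the left, whereas the inverse of
  \<open>side_reflection vs i \<circ> g\<close> has the generator on the right; closure under right
  multiplication is proved for this purpose.\<close>

lemma reflection_group_sym:
  assumes "g \<in> reflection_group vs"
  shows "\<exists>g'\<in>reflection_group vs. \<forall>z. g' (g z) = z"
proof -
  have right: "g \<circ> side_reflection vs i \<in> reflection_group vs"
    if "g \<in> reflection_group vs" "i < length vs" for g i
    using that
  proof (induction rule: reflection_group.induct)
    case one
    then show ?case using reflection_group.step[OF reflection_group.one, of i vs] by simp
  next
    case (step g j)
    then show ?case using reflection_group.step[of "g \<circ> side_reflection vs i" vs j] by (simp add: o_def)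
  qed
  show ?thesis using assms
  proof (induction rule: reflection_group.induct)
    case one
    then show ?case by (intro bexI[of _ id]) (auto intro: reflection_group.one)
  next
    case (step g i)
    then obtain g' where "g' \<in> reflection_group vs" "\<forall>z. g' (g z) = z" by blast
    then show ?case using right[of g' i] step(2) side_reflection_involutive
      by (intro bexI[of _ "g' \<circ> side_reflection vs i"]) auto
  qed
qed

end

section \<open>Triangles\<close>

lemma less_3_cases: "(i::nat) < 3 \<longleftrightarrow> i = 0 \<or> i = Suc 0 \<or> i = 2"
  by auto

lemma Suc_mod_3: "Suc 0 mod 3 = Suc 0" "Suc (Suc 0) mod 3 = 2" "Suc 2 mod 3 = 0"
  by simp_all

text \<open>\<open>a / cnj a\<close> is the square of the unit direction of \<open>a\<close>; it
  ignores the sign of \<open>a\<close>, and the reflection in the line of \<open>a\<close>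
  multiplies the conjugate by it. The quotient for two sides thus has twice the angle between them
  as argument.\<close>

lemma root_of_unity_conj_quotient:
  assumes "a \<noteq> 0" "b \<noteq> 0" and q: "q \<in> \<rat>" "Arg2pi (- a / b) = q * pi"
  shows "\<exists>m>0. ((a / cnj a) / (b / cnj b)) ^ m = 1"
proof -
  obtain k n :: int where kn: "n > 0" "q = of_int k / of_int n"
    using q(1) by (metis Rats_cases')
  define r where "r = cmod (- a / b)"
  have r: "r > 0" using assms by (simp add: r_def)
  have "- a / b = of_real r * exp (\<i> * of_real (q * pi))"
    unfolding r_def q(2)[symmetric] by (rule Arg2pi_eq)
  then have "- a = of_real r * exp (\<i> * of_real (q * pi)) * b"
    using assms(2) by (metis nonzero_divide_eq_eq)
  then have ab: "a = - (of_real r * exp (\<i> * of_real (q * pi))) * b"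
    by (metis minus_minus mult_minus_left)
  have "(a / cnj a) / (b / cnj b) = exp (\<i> * of_real (q * pi)) / cnj (exp (\<i> * of_real (q * pi)))"
    unfolding ab using assms r by simp
  also have "\<dots> = exp (\<i> * of_real (2 * q * pi))"
    unfolding exp_cnj by (simp add: exp_diff[symmetric] algebra_simps)
  finally have "((a / cnj a) / (b / cnj b)) ^ nat n = exp (of_nat (nat n) * (\<i> * of_real (2 * q * pi)))"
    by (simp add: exp_of_nat_mult)
  also have "of_nat (nat n) * (\<i> * of_real (2 * q * pi)) = \<i> * (of_real q * of_int n) * (of_real pi * 2)"
    using kn(1) by (simp add: mult_ac)
  also have "complex_of_real q * of_int n = of_int k"
    unfolding kn(2) using kn(1) by simp
  also have "exp (\<i> * of_int k * (of_real pi * 2)) = 1"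
    using exp_2pi_1_int[of k] by (simp add: mult_ac)
  finally show ?thesis using kn(1) by (intro exI[of _ "nat n"]) auto
qed

lemma cross_barycentric:
  fixes p q r :: complex
  assumes "a + b + c = 1"
  shows "Im (cnj (q - p) * (a *\<^sub>R p + b *\<^sub>R q + c *\<^sub>R r - p)) = c * Im (cnj (q - p) * (r - p))"
proof -
  have a: "a = 1 - b - c" using assms by simp
  show ?thesis unfolding a by (simp add: algebra_simps)
qed

lemma cross_cyclic:
  fixes p q r :: complex
  shows "Im (cnj (r - q) * (p - q)) = Im (cnj (q - p) * (r - p))"
  by (simp add: algebra_simps)

text \<open>Cramer's rule in the plane: the three cross products are doubled signed areas, that is,
  unnormalized barycentric coordinates of \<open>z\<close>.\<close>

lemma cross_expansion:
  fixes p q r z :: complex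
  shows "Im (cnj (q - p) * (r - p)) *\<^sub>R z = Im (cnj (r - q) * (z - q)) *\<^sub>R p
      + Im (cnj (p - r) * (z - r)) *\<^sub>R q + Im (cnj (q - p) * (z - p)) *\<^sub>R r"
    and "Im (cnj (r - q) * (z - q)) + Im (cnj (p - r) * (z - r)) + Im (cnj (q - p) * (z - p))
      = Im (cnj (q - p) * (r - p))"
  unfolding complex_eq_iff by (simp_all add: algebra_simps)

locale triangle = simple_polygon +
  assumes length_3: "length vs = 3"
begin

lemma set_vs: "set vs = {vs ! 0, vs ! Suc 0, vs ! 2}"
  using length_3 by (auto simp: set_conv_nth less_3_cases)

lemma corners_distinct: "vs ! 0 \<noteq> vs ! Suc 0" "vs ! Suc 0 \<noteq> vs ! 2" "vs ! 2 \<noteq> vs ! 0"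
  using distinct_corners length_3 by (auto simp: nth_eq_iff_index_eq)

lemma side_eq: "side vs 0 = closed_segment (vs ! 0) (vs ! Suc 0)"
    "side vs (Suc 0) = closed_segment (vs ! Suc 0) (vs ! 2)"
    "side vs 2 = closed_segment (vs ! 2) (vs ! 0)"
  by (simp_all only: side_def length_3 Suc_mod_3)

lemma side_vector_eq: "side_vector vs 0 = vs ! Suc 0 - vs ! 0"
    "side_vector vs (Suc 0) = vs ! 2 - vs ! Suc 0"
    "side_vector vs 2 = vs ! 0 - vs ! 2"
  by (simp_all only: side_vector_def length_3 Suc_mod_3)

lemma not_side_subset:
  assumes "i < 3" "j < 3" "i \<noteq> j" shows "\<not> side vs i \<subseteq> side vs j"
proof
  assume "side vs i \<subseteq> side vs j"
  then have "side vs i \<subseteq> set vs" using sides_meet[of i j] assms length_3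
    by (simp add: subset_iff)
  then have "countable (side vs i)" by (meson List.finite_set countable_finite countable_subset)
  then show False
    using corners_distinct[THEN uncountable_closed_segment] assms(1)
    by (auto simp: less_3_cases side_eq)
qed

text \<open>If one corner lay between the other two, one side would contain another, although
  distinct sides share only corners.\<close>

lemma not_collinear: "\<not> collinear {vs ! 0, vs ! Suc 0, vs ! 2}"
proof
  assume "collinear {vs ! 0, vs ! Suc 0, vs ! 2}"
  then consider "vs ! 0 \<in> closed_segment (vs ! Suc 0) (vs ! 2)"
    | "vs ! Suc 0 \<in> closed_segment (vs ! 2) (vs ! 0)" | "vs ! 2 \<in> closed_segment (vs ! 0) (vs ! Suc 0)"
    unfolding collinear_between_cases between_mem_segment by auto
  then show False
  proof cases
    case 1
    then have "side vs 0 \<subseteq> side vs (Suc 0)" by (simp add: side_eq subset_closed_segment)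
    then show False using not_side_subset[of 0 "Suc 0"] by simp
  next
    case 2
    then have "side vs (Suc 0) \<subseteq> side vs 2" by (simp add: side_eq subset_closed_segment)
    then show False using not_side_subset[of "Suc 0" 2] by simp
  next
    case 3
    then have "side vs 2 \<subseteq> side vs 0" by (simp add: side_eq subset_closed_segment)
    then show False using not_side_subset[of 2 0] by simp
  qed
qed

section \<open>The triangle as an intersection of half-planes\<close>

definition tri :: "complex set" where
  "tri = convex hull {vs ! 0, vs ! Suc 0, vs ! 2}"

lemma convex_tri: "convex tri"
  by (simp add: tri_def)

lemma compact_tri: "compact tri"
  unfolding tri_def by (intro finite_imp_compact_convex_hull) simp

lemma boundary_frontier: "boundary vs = frontier tri"
  unfolding tri_def frontier_of_triangle[OF DIM_complex] boundary_eq length_3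
proof -
  have "{..<3} = {0, Suc 0, 2}" by auto
  then show "(\<Union>i<3. side vs i) = closed_segment (vs ! 0) (vs ! Suc 0)
      \<union> closed_segment (vs ! Suc 0) (vs ! 2) \<union> closed_segment (vs ! 2) (vs ! 0)"
    by (simp add: side_eq Un_assoc)
qed

lemma inside_interior: "inside (boundary vs) = interior tri"
  unfolding boundary_frontier
  by (rule inside_frontier_eq_interior) (use compact_tri convex_tri compact_imp_bounded in auto)

lemma closure_tri: "closure tri = tri"
  by (simp add: closure_closed compact_tri compact_imp_closed)

lemma table_tri: "table vs = tri"
proof -
  have "table vs = (tri - interior tri) \<union> interior tri"
    unfolding table_def inside_interior unfolding boundary_frontier frontier_def closure_tri ..
  then show ?thesis using interior_subset[of tri] by blast
qed

definition area :: real where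
  "area = Im (cnj (vs ! Suc 0 - vs ! 0) * (vs ! 2 - vs ! 0))"

text \<open>The inward normal component of \<open>z\<close> relative to side \<open>i\<close>,
  scaled by the length of the side. The factor \<open>sgn area\<close> makes it positive inwards for
  either orientation of the corner list.\<close>

definition slope :: "nat \<Rightarrow> complex \<Rightarrow> real" where
  "slope i z = sgn area * Im (cnj (side_vector vs i) * z)"

definition elev :: "nat \<Rightarrow> complex \<Rightarrow> real" where
  "elev i z = slope i (z - vs ! i)"

lemma area_nz: "area \<noteq> 0"
proof
  assume "area = 0"
  then obtain r where "vs ! 2 - vs ! 0 = r *\<^sub>R (vs ! Suc 0 - vs ! 0)"
    using Im_cnj_mult_eq_0[of "vs ! Suc 0 - vs ! 0" "vs ! 2 - vs ! 0"] corners_distinct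
    unfolding area_def by auto
  then have "collinear {0, vs ! Suc 0 - vs ! 0, vs ! 2 - vs ! 0}" unfolding collinear_lemma by blast
  then have "collinear {vs ! Suc 0, vs ! 0, vs ! 2}" using collinear_3[of "vs ! Suc 0" "vs ! 0" "vs ! 2"] by simp
  then show False using not_collinear by (simp add: insert_commute)
qed

lemma slope_add: "slope i (y + z) = slope i y + slope i z"
  and slope_diff: "slope i (y - z) = slope i y - slope i z"
  and slope_minus [simp]: "slope i (- z) = - slope i z"
  and slope_scale [simp]: "slope i (c *\<^sub>R z) = c * slope i z"
  by (simp_all only: slope_def distrib_left right_diff_distrib mult_minus_right mult_scaleR_right
      plus_complex.simps minus_complex.simps uminus_complex.simps scaleR_complex.simps mult.left_commute)

lemma slope_reflection:
  assumes "i < 3" shows "slope i (side_reflection vs i z) = - slope i z"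
proof -
  have "cnj (side_vector vs i) * side_reflection vs i z = cnj (cnj (side_vector vs i) * z)"
    using side_vector_nz[of i] length_3 assms by (simp add: side_reflection_def Let_def)
  then show ?thesis unfolding slope_def by (simp only: cnj.simps mult_minus_right)
qed

lemma elev_line: "elev i (x + t *\<^sub>R \<theta>) = elev i x + t * slope i \<theta>"
  by (simp only: elev_def slope_add slope_diff slope_scale)

text \<open>\<open>elev i\<close> is affine, vanishes on the line of side \<open>i\<close>, and
  takes the value \<open>\<bar>area\<bar>\<close> at the opposite corner.\<close>

lemma elev_barycentric:
  assumes "a + b + c = 1" "z = a *\<^sub>R vs ! 0 + b *\<^sub>R vs ! Suc 0 + c *\<^sub>R vs ! 2"
  shows "elev 0 z = c * \<bar>area\<bar>" "elev (Suc 0) z = a * \<bar>area\<bar>" "elev 2 z = b * \<bar>area\<bar>"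
proof -
  have s: "c * \<bar>area\<bar> = sgn area * (c * area)" for c by (simp add: abs_sgn)
  have c: "area = Im (cnj (vs ! 2 - vs ! Suc 0) * (vs ! 0 - vs ! Suc 0))"
    "area = Im (cnj (vs ! 0 - vs ! 2) * (vs ! Suc 0 - vs ! 2))"
    unfolding area_def by (simp_all only: cross_cyclic)
  show "elev 0 z = c * \<bar>area\<bar>"
    unfolding s unfolding elev_def slope_def side_vector_eq assms(2) area_def
    using cross_barycentric[OF assms(1), of "vs ! Suc 0" "vs ! 0" "vs ! 2"] by (simp only:)
  have z: "z = b *\<^sub>R vs ! Suc 0 + c *\<^sub>R vs ! 2 + a *\<^sub>R vs ! 0" "z = c *\<^sub>R vs ! 2 + a *\<^sub>R vs ! 0 + b *\<^sub>R vs ! Suc 0"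
    unfolding assms(2) by (simp_all add: algebra_simps)
  have t: "b + c + a = 1" "c + a + b = 1" using assms(1) by simp_all
  show "elev (Suc 0) z = a * \<bar>area\<bar>"
    unfolding s unfolding elev_def slope_def side_vector_eq z(1) unfolding c(1)
    using cross_barycentric[OF t(1), of "vs ! 2" "vs ! Suc 0" "vs ! 0"] by (simp only:)
  show "elev 2 z = b * \<bar>area\<bar>"
    unfolding s unfolding elev_def slope_def side_vector_eq z(2) unfolding c(2)
    using cross_barycentric[OF t(2), of "vs ! 0" "vs ! 2" "vs ! Suc 0"] by (simp only:)
qed

lemma barycentric_exists:
  obtains a b c where "a + b + c = 1" "z = a *\<^sub>R vs ! 0 + b *\<^sub>R vs ! Suc 0 + c *\<^sub>R vs ! 2"
proof
  let ?A = "Im (cnj (vs ! 2 - vs ! Suc 0) * (z - vs ! Suc 0))" and ?B = "Im (cnj (vs ! 0 - vs ! 2) * (z - vs ! 2))"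
    and ?C = "Im (cnj (vs ! Suc 0 - vs ! 0) * (z - vs ! 0))"
  note e = cross_expansion[where p = "vs ! 0" and q = "vs ! Suc 0" and r = "vs ! 2" and z = z, folded area_def]
  show "?A / area + ?B / area + ?C / area = 1"
    unfolding add_divide_distrib[symmetric] using e(2) area_nz by (simp only: divide_self not_False_eq_True)
  have "z = (1 / area) *\<^sub>R (area *\<^sub>R z)" using area_nz by simp
  then show "z = (?A / area) *\<^sub>R vs ! 0 + (?B / area) *\<^sub>R vs ! Suc 0 + (?C / area) *\<^sub>R vs ! 2"
    unfolding e(1) by (simp add: scaleR_add_right)
qed

lemma tri_iff: "z \<in> tri \<longleftrightarrow> (\<forall>i<3. 0 \<le> elev i z)"
proof -
  obtain a b c where abc: "a + b + c = 1" "z = a *\<^sub>R vs ! 0 + b *\<^sub>R vs ! Suc 0 + c *\<^sub>R vs ! 2"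
    by (rule barycentric_exists)
  have p: "0 < \<bar>area\<bar>" using area_nz by simp
  show ?thesis
  proof
    assume "z \<in> tri"
    then obtain a b c where abc: "a + b + c = 1" "z = a *\<^sub>R vs ! 0 + b *\<^sub>R vs ! Suc 0 + c *\<^sub>R vs ! 2"
      "0 \<le> a" "0 \<le> b" "0 \<le> c" unfolding tri_def convex_hull_3 by blast
    then show "\<forall>i<3. 0 \<le> elev i z" using elev_barycentric[OF abc(1,2)] by (auto simp: less_3_cases)
  next
    assume "\<forall>i<3. 0 \<le> elev i z"
    then have "0 \<le> a" "0 \<le> b" "0 \<le> c"
      using elev_barycentric[OF abc] p by (auto simp: less_3_cases zero_le_mult_iff)
    then show "z \<in> tri" unfolding tri_def convex_hull_3 using abc by blast
  qed
qed

lemma interior_tri_iff: "z \<in> interior tri \<longleftrightarrow> (\<forall>i<3. 0 < elev i z)"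
proof -
  obtain a b c where abc: "a + b + c = 1" "z = a *\<^sub>R vs ! 0 + b *\<^sub>R vs ! Suc 0 + c *\<^sub>R vs ! 2"
    by (rule barycentric_exists)
  have p: "0 < \<bar>area\<bar>" using area_nz by simp
  show ?thesis
  proof
    assume "z \<in> interior tri"
    then obtain a b c where abc: "a + b + c = 1" "z = a *\<^sub>R vs ! 0 + b *\<^sub>R vs ! Suc 0 + c *\<^sub>R vs ! 2"
      "0 < a" "0 < b" "0 < c"
      unfolding tri_def interior_convex_hull_3_minimal[OF not_collinear DIM_complex] by blast
    then show "\<forall>i<3. 0 < elev i z" using elev_barycentric[OF abc(1,2)] p by (auto simp: less_3_cases)
  next
    assume "\<forall>i<3. 0 < elev i z"
    then have "0 < a" "0 < b" "0 < c"
      using elev_barycentric[OF abc] p by (auto simp: less_3_cases zero_less_mult_iff)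
    then show "z \<in> interior tri"
      unfolding tri_def interior_convex_hull_3_minimal[OF not_collinear DIM_complex] using abc by blast
  qed
qed

lemma elev_side: "z \<in> side vs i \<Longrightarrow> elev i z = 0"
  unfolding elev_def slope_def using Im_side_line[of z i "vs ! i"] by (auto simp: side_def)

lemma boundary_tri: "boundary vs \<subseteq> tri"
  unfolding boundary_frontier frontier_def closure_tri by blast

lemma elev_0_side:
  assumes "z \<in> boundary vs" "i < 3" "elev i z = 0"
  shows "z \<in> side vs i"
proof -
  obtain a b c where abc: "a + b + c = 1" "z = a *\<^sub>R vs ! 0 + b *\<^sub>R vs ! Suc 0 + c *\<^sub>R vs ! 2"
    by (rule barycentric_exists)
  have p: "0 < \<bar>area\<bar>" using area_nz by simp
  have nn: "0 \<le> a" "0 \<le> b" "0 \<le> c"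
    using elev_barycentric[OF abc] p assms(1) boundary_tri tri_iff[of z]
    by (auto simp: less_3_cases zero_le_mult_iff)
  consider "i = 0" "c = 0" | "i = Suc 0" "a = 0" | "i = 2" "b = 0"
    using assms(2,3) elev_barycentric[OF abc] p by (auto simp: less_3_cases)
  then show ?thesis
  proof cases
    case 1
    then show ?thesis using abc nn unfolding 1 side_eq in_segment by (intro exI[of _ b]) auto
  next
    case 2
    then show ?thesis using abc nn unfolding 2 side_eq in_segment by (intro exI[of _ c]) auto
  next
    case 3
    then show ?thesis using abc nn unfolding 3 side_eq in_segment by (intro exI[of _ a]) auto
  qed
qed

text \<open>Away from the corners the other two elevations are positive at \<open>z\<close> and stay
  so for a short time, so only the sign of the slope against side \<open>i\<close> matters.\<close>

lemma phase_space_side_iff: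
  assumes i: "i < 3" "z \<in> side vs i" "z \<notin> set vs" and th: "norm \<theta> = 1"
  shows "(z, \<theta>) \<in> phase_space vs \<longleftrightarrow> 0 < slope i \<theta>"
proof
  assume "(z, \<theta>) \<in> phase_space vs"
  then obtain e where "e > 0" "\<And>t. 0 < t \<Longrightarrow> t < e \<Longrightarrow> z + t *\<^sub>R \<theta> \<in> interior tri"
    by (auto simp: phase_space_def inside_interior)
  then have "z + (e/2) *\<^sub>R \<theta> \<in> interior tri" "e > 0" by auto
  then show "0 < slope i \<theta>"
    using i elev_side by (auto simp: interior_tri_iff elev_line zero_less_mult_iff)
next
  assume s: "0 < slope i \<theta>"
  have zb: "z \<in> boundary vs" using i by (auto simp: boundary_eq length_3)
  have pos: "0 < elev j z" if "j < 3" "j \<noteq> i" for j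
    using elev_0_side[OF zb, of j] sides_meet[of i j z] i that length_3 zb boundary_tri tri_iff[of z]
    by (metis order_le_less subsetD)
  have ev: "\<forall>j\<in>{..<3}. \<forall>\<^sub>F t in at_right 0. 0 < elev j (z + t *\<^sub>R \<theta>)"
  proof
    fix j :: nat assume j: "j \<in> {..<3}"
    show "\<forall>\<^sub>F t in at_right 0. 0 < elev j (z + t *\<^sub>R \<theta>)"
    proof (cases "j = i")
      case True
      then show ?thesis using s elev_side[OF i(2)]
        by (auto simp: elev_line intro: eventually_mono[OF eventually_at_right_less[of 0]])
    next
      case False
      have "((\<lambda>t. elev j z + t * slope j \<theta>) \<longlongrightarrow> elev j z + 0 * slope j \<theta>) (at_right 0)"
        by (intro tendsto_intros)
      then show ?thesis
        unfolding elev_line using pos[of j] False j by (intro order_tendstoD(1)) auto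
    qed
  qed
  then have "\<forall>\<^sub>F t in at_right 0. \<forall>j\<in>{..<3}. 0 < elev j (z + t *\<^sub>R \<theta>)"
    by (simp add: eventually_ball_finite)
  then obtain b where "b > 0" "\<And>t. 0 < t \<Longrightarrow> t < b \<Longrightarrow> \<forall>j\<in>{..<3}. 0 < elev j (z + t *\<^sub>R \<theta>)"
    unfolding eventually_at_right_field by auto
  then show "(z, \<theta>) \<in> phase_space vs"
    unfolding phase_space_def inside_interior interior_tri_iff using zb th by auto
qed

section \<open>Rational angles and finitely many directions\<close>

lemma side_ratios_roots_of_unity:
  assumes rat: "rational_polygon vs"
  obtains m where "m > 0" "\<And>i j. i < 3 \<Longrightarrow> j < 3 \<Longrightarrow>
    ((side_vector vs i / cnj (side_vector vs i)) / (side_vector vs j / cnj (side_vector vs j))) ^ m = 1"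
proof -
  define u where "u i = side_vector vs i / cnj (side_vector vs i)" for i
  have sv: "side_vector vs i \<noteq> 0" if "i < 3" for i using side_vector_nz that length_3 by simp
  have nu: "cmod (u i) = 1" if "i < 3" for i using sv[OF that] by (simp add: u_def norm_divide)
  \<comment> \<open>Side \<open>j\<close> ends and side \<open>i\<close> starts at corner
    \<open>i\<close>. Two corners relate all three sides, and the product of the two orders serves
    as a common exponent.\<close>
  have ang: "\<exists>m>0. (u j / u i) ^ m = 1" if "(j, i) \<in> {(0, Suc 0), (Suc 0, 2)}" for i j
  proof -
    have i: "i < 3" "j < 3" "vs ! ((i + length vs - 1) mod length vs) - vs ! i = - side_vector vs j"
      using that length_3 by (auto simp: side_vector_eq)
    obtain q where "q \<in> \<rat>" "interior_angle vs i = q * pi"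
      using rat i(1) by (auto simp: rational_polygon_def length_3)
    then have "Arg2pi (- side_vector vs j / side_vector vs i) = q * pi"
      by (simp only: interior_angle_def i(3))
    then show ?thesis unfolding u_def
      using root_of_unity_conj_quotient[OF sv[OF i(2)] sv[OF i(1)] \<open>q \<in> \<rat>\<close>] by blast
  qed
  obtain m1 m2 where m: "m1 > 0" "m2 > 0" "(u 0 / u (Suc 0)) ^ m1 = 1" "(u (Suc 0) / u 2) ^ m2 = 1"
    using ang[of 0 "Suc 0"] ang[of "Suc 0" 2] by auto
  define m where "m = m1 * m2"
  have m0: "m > 0" using m by (simp add: m_def)
  have u0: "u i \<noteq> 0" if "i < 3" for i using nu[OF that] by auto
  have "(u 0 / u (Suc 0)) ^ m = 1" "(u (Suc 0) / u 2) ^ m = 1"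
    using m(3,4) power_mult[of "u 0 / u (Suc 0)" m1 m2] power_mult[of "u (Suc 0) / u 2" m2 m1]
    by (simp_all add: m_def mult.commute[of m1])
  then have "u 0 ^ m = u (Suc 0) ^ m" "u (Suc 0) ^ m = u 2 ^ m"
    using u0 by (simp_all add: power_divide)
  then have um: "(u i / u 0) ^ m = 1" if "i < 3" for i
    using that u0[of 0] u0[of 2] by (auto simp: less_3_cases power_divide)
  have "(u i / u j) ^ m = 1" if "i < 3" "j < 3" for i j
    using um[OF that(1)] um[OF that(2)] u0[of 0] u0[OF that(2)] by (simp add: power_divide)
  then show thesis using m0 by (intro that[of m]) (simp_all add: u_def)
qed

text \<open>Words of even length in the generators rotate \<open>\<theta>\<close> by an
  \<open>m\<close>-th root of unity; words of odd length do so after the reflection in side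
  0.\<close>

lemma finite_directions:
  assumes rat: "rational_polygon vs" and th: "norm \<theta> = 1"
  shows "finite {g \<theta> |g. g \<in> reflection_group vs}"
proof -
  define u where "u i = side_vector vs i / cnj (side_vector vs i)" for i
  have nu: "cmod (u i) = 1" if "i < 3" for i
    using side_vector_nz[of i] that length_3 by (simp add: u_def norm_divide)
  have u0: "u i \<noteq> 0" if "i < 3" for i using nu[OF that] by auto
  obtain m where m0: "m > 0" and um: "\<And>i. i < 3 \<Longrightarrow> (u i / u 0) ^ m = 1"
    unfolding u_def by (rule side_ratios_roots_of_unity[OF rat]) simp
  define Z where "Z = {z::complex. z ^ m = 1}"
  have "finite Z" unfolding Z_def using m0 by (intro finite_roots_unity) simp
  have "g \<theta> \<in> (\<lambda>z. z * \<theta>) ` Z \<union> (\<lambda>z. z * (u 0 * cnj \<theta>)) ` Z" if "g \<in> reflection_group vs" for g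
    using that
  proof induction
    case one
    have "1 \<in> Z" by (simp add: Z_def)
    then show ?case by force
  next
    case (step g i)
    have i: "i < 3" using step length_3 by simp
    have cu: "cnj (u 0) = 1 / u 0"
      using nu[of 0] u0[of 0] complex_norm_square[of "u 0"] by (simp add: field_simps)
    have r: "side_reflection vs i z = u i * cnj z" for z
      by (simp add: side_reflection_def u_def Let_def)
    have Zi: "(u i / u 0) * cnj z \<in> Z" if "z \<in> Z" for z
    proof -
      have "cnj z ^ m = 1" using that by (simp add: Z_def flip: complex_cnj_power)
      then show ?thesis unfolding Z_def mem_Collect_eq power_mult_distrib um[OF i] by simp
    qed
    from step.IH consider z where "z \<in> Z" "g \<theta> = z * \<theta>" | z where "z \<in> Z" "g \<theta> = z * (u 0 * cnj \<theta>)"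
      by auto
    then show ?case
    proof cases
      case 1
      then have "(side_reflection vs i \<circ> g) \<theta> = ((u i / u 0) * cnj z) * (u 0 * cnj \<theta>)"
        using u0[of 0] by (simp add: r)
      then show ?thesis using Zi[OF 1(1)] by blast
    next
      case 2
      then have "(side_reflection vs i \<circ> g) \<theta> = ((u i / u 0) * cnj z) * \<theta>"
        using u0[of 0] by (simp add: r cu)
      then show ?thesis using Zi[OF 2(1)] by blast
    qed
  qed
  then have "{g \<theta> |g. g \<in> reflection_group vs} \<subseteq> (\<lambda>z. z * \<theta>) ` Z \<union> (\<lambda>z. z * (u 0 * cnj \<theta>)) ` Z"
    by blast
  then show ?thesis using \<open>finite Z\<close> by (meson finite_UnI finite_imageI finite_subset)
qed

end

section \<open>Parallel beams in a triangle\<close>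

text \<open>The coordinate transverse to a unit direction \<open>\<theta>\<close>: it is constant
  along a chord of that direction, so that \<open>level\<close> distinguishes parallel
  chords.\<close>

definition height :: "complex \<Rightarrow> complex \<Rightarrow> real" where
  "height \<theta> z = Im (cnj \<theta> * z)"

abbreviation level :: "phase_point \<Rightarrow> real" where
  "level u \<equiv> height (snd u) (fst u)"

lemma height_add: "height \<theta> (y + z) = height \<theta> y + height \<theta> z"
  and height_diff: "height \<theta> (y - z) = height \<theta> y - height \<theta> z"
  and height_scale: "height \<theta> (c *\<^sub>R z) = c * height \<theta> z"
  and height_minus: "height (- \<theta>) z = - height \<theta> z"
  by (simp_all add: height_def algebra_simps)

lemma height_same [simp]: "height \<theta> \<theta> = 0"
  by (simp add: height_def)

lemma height_normal: "norm \<theta> = 1 \<Longrightarrow> height \<theta> (\<i> * \<theta>) = 1"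
  by (simp add: height_def cmod_def flip: power2_eq_square)

lemma height_line: "height \<theta> (z + t *\<^sub>R \<theta>) = height \<theta> z"
  by (simp add: height_add height_scale)

lemma height_hit_point: "height (snd u) (hit_point vs u) = level u"
  by (simp add: hit_point_def height_line)

lemma same_height_on_line:
  assumes "norm \<theta> = 1" "height \<theta> z = height \<theta> z'"
  obtains r where "z' = z + r *\<^sub>R \<theta>"
proof -
  have "Im (cnj \<theta> * (z' - z)) = 0" using assms(2) height_diff[of \<theta> z' z] by (simp add: height_def)
  moreover have "\<theta> \<noteq> 0" using assms(1) by auto
  ultimately obtain r where "z' - z = r *\<^sub>R \<theta>" by (rule Im_cnj_mult_eq_0)
  then show thesis by (intro that[of r]) (simp add: algebra_simps)
qed

lemma linear_height: "linear (height \<theta>)"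
  by (intro linearI) (simp_all add: height_add height_scale)

context triangle
begin

section \<open>Chords of one direction, parametrized by level\<close>

definition heights :: "complex \<Rightarrow> real set" where
  "heights \<theta> = height \<theta> ` interior tri"

text \<open>The chord of direction \<open>\<theta>\<close> at level \<open>s\<close>. Convexity
  makes it unique (\<open>entry_unique\<close>), so the choice is harmless; the value is meaningful
  only for \<open>s\<close> in \<open>heights \<theta>\<close>.\<close>

definition pt :: "complex \<Rightarrow> real \<Rightarrow> phase_point" where
  "pt \<theta> s = (SOME u. u \<in> phase_space vs \<and> snd u = \<theta> \<and> level u = s)"

lemma boundary_not_interior: "z \<in> boundary vs \<Longrightarrow> z \<notin> interior tri"
  by (simp add: boundary_frontier frontier_def)

text \<open>Each elevation is affine along the line, positive at \<open>p\<close> and nonnegative at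
  the far end, hence positive strictly before that end.\<close>

lemma line_interior:
  assumes p: "p \<in> interior tri" and q: "p + b *\<^sub>R \<theta> \<in> tri" and ab: "0 \<le> a" "a < b"
  shows "p + a *\<^sub>R \<theta> \<in> interior tri"
  unfolding interior_tri_iff
proof (intro allI impI)
  fix i :: nat assume i: "i < 3"
  have "0 < elev i p" "0 \<le> elev i p + b * slope i \<theta>"
    using p q i by (auto simp: interior_tri_iff tri_iff elev_line)
  moreover have "b * slope i \<theta> < a * slope i \<theta> \<or> 0 \<le> a * slope i \<theta>"
    using ab by (cases "slope i \<theta> < 0") auto
  ultimately show "0 < elev i (p + a *\<^sub>R \<theta>)"
    unfolding elev_line by linarith
qed

lemma phase_space_interior:
  assumes "u \<in> phase_space vs"
  obtains t where "t > 0" "\<And>s. 0 < s \<Longrightarrow> s \<le> t \<Longrightarrow> fst u + s *\<^sub>R snd u \<in> interior tri"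
proof -
  obtain e where "e > 0" "\<forall>t. 0 < t \<and> t < e \<longrightarrow> fst u + t *\<^sub>R snd u \<in> interior tri"
    using assms by (auto simp: phase_space_def inside_interior)
  then show thesis by (intro that[of "e / 2"]) auto
qed

lemma hit_unique:
  assumes u: "u \<in> phase_space vs" and t: "0 < t" "fst u + t *\<^sub>R snd u \<in> boundary vs"
  shows "hit_point vs u = fst u + t *\<^sub>R snd u"
proof -
  have h: "0 < hit_time vs u" using hit_time_pos[OF u] .
  have nlt: "\<not> t < hit_time vs u"
    using before_hit_inside[OF u t(1)] t(2) inside_disjoint by blast
  have False if "hit_time vs u < t"
  proof -
    let ?p = "fst u + (hit_time vs u / 2) *\<^sub>R snd u"
    have "?p \<in> interior tri"
      using before_hit_inside[OF u, of "hit_time vs u / 2"] h by (simp add: inside_interior)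
    moreover have e: "?p + (t - hit_time vs u / 2) *\<^sub>R snd u = fst u + t *\<^sub>R snd u"
      by (simp add: algebra_simps)
    have "?p + (t - hit_time vs u / 2) *\<^sub>R snd u \<in> tri"
      unfolding e using t(2) boundary_tri by blast
    ultimately have "?p + (hit_time vs u / 2) *\<^sub>R snd u \<in> interior tri"
      using that h by (intro line_interior[of ?p "t - hit_time vs u / 2"]) auto
    moreover have "?p + (hit_time vs u / 2) *\<^sub>R snd u = hit_point vs u"
      by (simp only: hit_point_def add.assoc scaleR_add_left[symmetric] field_sum_of_halves)
    ultimately show False using hit_point_boundary[OF u] boundary_not_interior by metis
  qed
  then show ?thesis using nlt by (metis hit_point_def linorder_neqE)
qed

text \<open>With two feet on one line, the chord from the first would end at the second, while
  interior points follow beyond the second; by convexity the second foot would then be an interior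
  point.\<close>

lemma entry_unique:
  assumes u: "u \<in> phase_space vs" and v: "v \<in> phase_space vs"
    and eq: "snd u = snd v" "level u = level v"
  shows "u = v"
proof -
  have *: False if uv: "u \<in> phase_space vs" "v \<in> phase_space vs" "snd u = snd v"
    "fst v = fst u + r *\<^sub>R snd u" "r > 0" for u v r
  proof -
    have hp: "hit_point vs u = fst u + r *\<^sub>R snd u"
      using hit_unique[OF uv(1) uv(5)] phase_spaceD[OF uv(2)] uv(4) by simp
    then have "hit_time vs u *\<^sub>R snd u = r *\<^sub>R snd u" by (simp add: hit_point_def)
    moreover have "snd u \<noteq> 0" using phase_spaceD[OF uv(1)] by auto
    ultimately have ht: "hit_time vs u = r" by simp
    let ?p = "fst u + (r / 2) *\<^sub>R snd u"
    have "?p \<in> interior tri"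
      using before_hit_inside[OF uv(1), of "r / 2"] uv(5) ht by (simp add: inside_interior)
    moreover obtain t where t: "t > 0" "fst v + t *\<^sub>R snd v \<in> interior tri"
      using phase_space_interior[OF uv(2)] by (metis order_refl)
    have e: "?p + (r / 2 + t) *\<^sub>R snd u = fst v + t *\<^sub>R snd v"
      by (simp only: uv(4) uv(3)[symmetric] add.assoc scaleR_add_left[symmetric])
        (simp only: add.assoc[symmetric] field_sum_of_halves)
    have "?p + (r / 2 + t) *\<^sub>R snd u \<in> tri" unfolding e using t interior_subset by blast
    ultimately have "?p + (r / 2) *\<^sub>R snd u \<in> interior tri"
      using uv(5) t by (intro line_interior[of ?p "r / 2 + t"]) auto
    moreover have "?p + (r / 2) *\<^sub>R snd u = fst v"
      by (simp only: uv(4) add.assoc scaleR_add_left[symmetric] field_sum_of_halves)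
    ultimately show False using phase_spaceD[OF uv(2)] boundary_not_interior by metis
  qed
  obtain r where r: "fst v = fst u + r *\<^sub>R snd u"
    using same_height_on_line[of "snd u" "fst u" "fst v"] phase_spaceD[OF u] eq by metis
  have "fst u = fst v + (- r) *\<^sub>R snd v" using r eq by simp
  then have "r = 0" using *[of u v r] *[of v u "- r"] u v eq r by (metis linorder_neqE neg_0_less_iff_less)
  then show ?thesis using r eq by (simp add: prod_eq_iff)
qed

lemma entry_exists:
  assumes "p \<in> interior tri" "norm \<theta> = 1"
  obtains d where "d > 0" "(p - d *\<^sub>R \<theta>, \<theta>) \<in> phase_space vs"
    "\<And>e. 0 \<le> e \<Longrightarrow> e < d \<Longrightarrow> p - e *\<^sub>R \<theta> \<in> interior tri"
proof -
  have "bounded tri" "- \<theta> \<noteq> 0" using compact_tri compact_imp_bounded assms(2) by auto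
  then obtain d where d: "d > 0" "p + d *\<^sub>R (- \<theta>) \<in> frontier tri"
    "\<And>e. 0 \<le> e \<Longrightarrow> e < d \<Longrightarrow> p + e *\<^sub>R (- \<theta>) \<in> interior tri"
    using ray_to_frontier[of tri p "- \<theta>"] assms(1) by metis
  have "p - d *\<^sub>R \<theta> + t *\<^sub>R \<theta> \<in> interior tri" if "0 < t" "t < d" for t
    using d(3)[of "d - t"] that by (simp add: algebra_simps)
  then have "(p - d *\<^sub>R \<theta>, \<theta>) \<in> phase_space vs"
    using d assms(2) unfolding phase_space_def inside_interior by (auto simp: boundary_frontier)
  then show thesis using d by (intro that[of d]) auto
qed

lemma pt_props:
  assumes "norm \<theta> = 1" "s \<in> heights \<theta>"
  shows pt_phase_space: "pt \<theta> s \<in> phase_space vs" and snd_pt: "snd (pt \<theta> s) = \<theta>"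
    and level_pt: "height \<theta> (fst (pt \<theta> s)) = s"
proof -
  obtain p where p: "p \<in> interior tri" "s = height \<theta> p" using assms by (auto simp: heights_def)
  obtain d where "d > 0" "(p - d *\<^sub>R \<theta>, \<theta>) \<in> phase_space vs" using entry_exists[OF p(1) assms(1)] by metis
  moreover have "height \<theta> (p - d *\<^sub>R \<theta>) = s" using p height_line[of \<theta> p "- d"] by simp
  ultimately have "\<exists>u. u \<in> phase_space vs \<and> snd u = \<theta> \<and> level u = s" by force
  then have "pt \<theta> s \<in> phase_space vs \<and> snd (pt \<theta> s) = \<theta> \<and> level (pt \<theta> s) = s"
    unfolding pt_def by (rule someI_ex)
  then show "pt \<theta> s \<in> phase_space vs" "snd (pt \<theta> s) = \<theta>" "height \<theta> (fst (pt \<theta> s)) = s" by auto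
qed

lemma level_in_heights:
  assumes "u \<in> phase_space vs" shows "level u \<in> heights (snd u)"
proof -
  obtain t where "t > 0" "fst u + t *\<^sub>R snd u \<in> interior tri"
    using phase_space_interior[OF assms] by (metis order_refl)
  then show ?thesis unfolding heights_def using height_line by (metis imageI)
qed

lemma pt_level: "u \<in> phase_space vs \<Longrightarrow> pt (snd u) (level u) = u"
  using entry_unique pt_props[of "snd u" "level u"] level_in_heights[of u] phase_spaceD by metis

lemma pt_eqI: "u \<in> phase_space vs \<Longrightarrow> snd u = \<theta> \<Longrightarrow> level u = s \<Longrightarrow> pt \<theta> s = u"
  using pt_level by metis

lemma heights_minus: "- s \<in> heights (- \<theta>) \<longleftrightarrow> s \<in> heights \<theta>"
  by (auto simp: heights_def height_minus image_iff)

lemma flip_pt: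
  assumes "norm \<theta> = 1" "s \<in> heights \<theta>" shows "flip vs (pt \<theta> s) = pt (- \<theta>) (- s)"
  using assms pt_props[OF assms] height_hit_point[of "pt \<theta> s" vs]
  by (intro pt_eqI[symmetric]) (auto simp: flip_phase_space height_minus)

lemma hit_point_pt:
  assumes "norm \<theta> = 1" "s \<in> heights \<theta>" shows "hit_point vs (pt \<theta> s) = fst (pt (- \<theta>) (- s))"
  using flip_pt[OF assms] fst_flip by metis

lemma open_heights:
  assumes "norm \<theta> = 1" shows "open (heights \<theta>)"
proof (rule openI)
  fix s assume "s \<in> heights \<theta>"
  then obtain p where p: "p \<in> interior tri" "s = height \<theta> p" by (auto simp: heights_def)
  obtain e where e: "e > 0" "ball p e \<subseteq> interior tri"
    using p(1) open_interior openE by metis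
  have "s' \<in> heights \<theta>" if "dist s s' < e" for s'
  proof -
    have "p + (s' - s) *\<^sub>R (\<i> * \<theta>) \<in> ball p e"
      using that assms by (simp add: dist_norm norm_mult abs_minus_commute)
    then have "p + (s' - s) *\<^sub>R (\<i> * \<theta>) \<in> interior tri" using e by auto
    moreover have "height \<theta> (p + (s' - s) *\<^sub>R (\<i> * \<theta>)) = s'"
      using height_normal[OF assms] p by (simp add: height_add height_scale)
    ultimately show ?thesis unfolding heights_def by (metis imageI)
  qed
  then show "\<exists>T>0. ball s T \<subseteq> heights \<theta>" using e(1) by (intro exI[of _ e]) auto
qed

lemma convex_heights: "convex (heights \<theta>)"
  unfolding heights_def using convex_tri linear_height by (intro convex_linear_image convex_interior)

lemma bounded_heights: "bounded (heights \<theta>)"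
  unfolding heights_def
  by (intro bounded_linear_image linear_conv_bounded_linear[THEN iffD1] linear_height)
    (meson bounded_subset compact_imp_bounded compact_tri interior_subset)

text \<open>A point just before the entry is outside and one just after is inside. Both facts
  persist under a small transverse shift \<open>w\<close>, so the entry of the shifted chord is
  trapped between the two.\<close>

lemma continuous_on_entry:
  assumes th: "norm \<theta> = 1" shows "continuous_on (heights \<theta>) (\<lambda>s. fst (pt \<theta> s))"
  unfolding continuous_on_iff
proof (intro ballI allI impI)
  fix s and \<epsilon> :: real assume s: "s \<in> heights \<theta>" and eps: "0 < \<epsilon>"
  define x where "x = fst (pt \<theta> s)"
  have xp: "(x, \<theta>) \<in> phase_space vs" "height \<theta> x = s"
    using pt_props[OF th s] by (auto simp: x_def) (metis prod.collapse)
  obtain t0 where t0: "t0 > 0" "\<And>r. 0 < r \<Longrightarrow> r \<le> t0 \<Longrightarrow> x + r *\<^sub>R \<theta> \<in> interior tri"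
    using phase_space_interior[OF xp(1)] by auto
  define t where "t = min t0 (\<epsilon> / 4)"
  have t: "t > 0" "x + t *\<^sub>R \<theta> \<in> interior tri" "t \<le> \<epsilon> / 4" using t0 eps by (auto simp: t_def)
  have nb: "x - t *\<^sub>R \<theta> \<notin> tri"
  proof
    assume "x - t *\<^sub>R \<theta> \<in> tri"
    moreover have "(x + t *\<^sub>R \<theta>) + (2 * t) *\<^sub>R (- \<theta>) = x - t *\<^sub>R \<theta>"
      by (simp only: mult_2 scaleR_add_left scaleR_minus_right) simp
    ultimately have m: "(x + t *\<^sub>R \<theta>) + (2 * t) *\<^sub>R (- \<theta>) \<in> tri" by (simp only:)
    have "(x + t *\<^sub>R \<theta>) + t *\<^sub>R (- \<theta>) \<in> interior tri"
      by (rule line_interior[OF t(2) m]) (use t in auto)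
    then show False using boundary_not_interior[of x] phase_spaceD[OF xp(1)] by simp
  qed
  obtain e1 where e1: "e1 > 0" "ball (x + t *\<^sub>R \<theta>) e1 \<subseteq> interior tri"
    using t(2) open_interior openE by metis
  have "open (- tri)" using compact_tri compact_imp_closed by blast
  then obtain e2 where e2: "e2 > 0" "ball (x - t *\<^sub>R \<theta>) e2 \<subseteq> - tri"
    using nb openE by (metis ComplI)
  define d where "d = min (min e1 e2) (\<epsilon> / 4)"
  have "dist (fst (pt \<theta> s')) (fst (pt \<theta> s)) < \<epsilon>" if s': "s' \<in> heights \<theta>" "dist s' s < d" for s'
  proof -
    define w where "w = (s' - s) *\<^sub>R (\<i> * \<theta>)"
    have nw: "norm w < d" using s'(2) th by (simp add: w_def norm_mult dist_real_def)
    let ?q = "x + t *\<^sub>R \<theta> + w"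
    have "?q \<in> ball (x + t *\<^sub>R \<theta>) e1" using nw by (simp add: dist_norm d_def)
    then have q: "?q \<in> interior tri" using e1 by auto
    have "x - t *\<^sub>R \<theta> + w \<in> ball (x - t *\<^sub>R \<theta>) e2" using nw by (simp add: dist_norm d_def)
    then have b: "x - t *\<^sub>R \<theta> + w \<notin> tri" using e2 by auto
    obtain c where c: "c > 0" "(?q - c *\<^sub>R \<theta>, \<theta>) \<in> phase_space vs"
      "\<And>e. 0 \<le> e \<Longrightarrow> e < c \<Longrightarrow> ?q - e *\<^sub>R \<theta> \<in> interior tri"
      using entry_exists[OF q th] by metis
    have "?q - (2 * t) *\<^sub>R \<theta> = x - t *\<^sub>R \<theta> + w"
      by (simp only: mult_2 scaleR_add_left) simp
    then have "c \<le> 2 * t" using c(3)[of "2 * t"] b interior_subset[of tri] t(1) by (metis linorder_not_less mult_nonneg_nonneg order_less_imp_le subsetD zero_le_numeral)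
    have "height \<theta> (?q - c *\<^sub>R \<theta>) = s'"
      using xp(2) height_normal[OF th] by (simp add: height_add height_diff height_scale w_def)
    then have "pt \<theta> s' = (?q - c *\<^sub>R \<theta>, \<theta>)" using c(2) by (intro pt_eqI) auto
    then have "fst (pt \<theta> s') - x = (t - c) *\<^sub>R \<theta> + w" by (simp add: algebra_simps)
    moreover have "norm ((t - c) *\<^sub>R \<theta> + w) \<le> \<bar>t - c\<bar> + norm w"
      using norm_triangle_ineq[of "(t - c) *\<^sub>R \<theta>" w] th by simp
    ultimately have "norm (fst (pt \<theta> s') - x) \<le> t + d" using nw \<open>c \<le> 2 * t\<close> c(1) by auto
    also have "\<dots> < \<epsilon>" using t(3) eps by (auto simp: d_def)
    finally show ?thesis by (simp add: dist_norm x_def)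
  qed
  moreover have "d > 0" using e1 e2 eps by (simp add: d_def)
  ultimately show "\<exists>d>0. \<forall>s'\<in>heights \<theta>. dist s' s < d \<longrightarrow> dist (fst (pt \<theta> s')) (fst (pt \<theta> s)) < \<epsilon>"
    by blast
qed

lemma continuous_on_exit:
  assumes th: "norm \<theta> = 1" shows "continuous_on (heights \<theta>) (\<lambda>s. hit_point vs (pt \<theta> s))"
proof (rule continuous_on_eq)
  show "continuous_on (heights \<theta>) ((\<lambda>s. fst (pt (- \<theta>) s)) \<circ> uminus)"
    using th heights_minus[of _ \<theta>]
    by (intro continuous_on_compose continuous_intros continuous_on_subset[OF continuous_on_entry]) auto
qed (use hit_point_pt th in auto)

text \<open>The reflection fixes the side vector and reverses orientation, so a vector along the
  side has opposite heights with respect to \<open>\<theta>\<close> and its reflection. This is the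
  source of the maps \<open>c - s\<close> of levels below.\<close>

lemma height_reflection:
  assumes "i < 3" "z \<in> side vs i"
  shows "height (side_reflection vs i \<theta>) z =
    height (side_reflection vs i \<theta>) (vs ! i) + height \<theta> (vs ! i) - height \<theta> z"
proof -
  let ?w = "side_vector vs i"
  have w: "?w \<noteq> 0" using side_vector_nz assms length_3 by simp
  have "Im (cnj ?w * (z - vs ! i)) = 0" using Im_side_line assms by (simp add: side_def)
  then obtain r where r: "z - vs ! i = r *\<^sub>R ?w" using w by (rule Im_cnj_mult_eq_0)
  have "cnj (side_reflection vs i \<theta>) * ?w = cnj (cnj \<theta> * ?w)"
    using w by (simp add: side_reflection_def Let_def)
  then have "height (side_reflection vs i \<theta>) ?w = - height \<theta> ?w"
    unfolding height_def by (simp only: cnj.simps)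
  then have "height (side_reflection vs i \<theta>) (z - vs ! i) = - height \<theta> (z - vs ! i)"
    unfolding r height_scale by simp
  then show ?thesis by (simp add: height_diff)
qed

text \<open>Connectedness gives a common exit side, and then \<open>height_reflection\<close>
  applies to all chords with one constant \<open>c\<close>. The arguments on gaps, limit sets and
  periodicity run through this isometry of levels.\<close>

lemma beam_isometry:
  assumes th: "norm \<theta> = 1" and J: "convex J" "J \<subseteq> heights \<theta>" "J \<noteq> {}"
    and nc: "\<And>s. s \<in> J \<Longrightarrow> hit_point vs (pt \<theta> s) \<notin> set vs"
  obtains i c where "i < 3" "\<And>s. s \<in> J \<Longrightarrow> hit_point vs (pt \<theta> s) \<in> side vs i"
    "\<And>s. s \<in> J \<Longrightarrow> billiard_map vs (pt \<theta> s) = pt (side_reflection vs i \<theta>) (c - s)"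
    "\<And>s. s \<in> J \<Longrightarrow> c - s \<in> heights (side_reflection vs i \<theta>)"
proof -
  let ?H = "(\<lambda>s. hit_point vs (pt \<theta> s)) ` J"
  have ps: "pt \<theta> s \<in> phase_space vs" if "s \<in> J" for s using that J th pt_props by blast
  have bd: "?H \<subseteq> boundary vs" using ps hit_point_boundary by blast
  obtain s0 where s0: "s0 \<in> J" using J by auto
  obtain i where i: "i < 3" "hit_point vs (pt \<theta> s0) \<in> side vs i"
    using bd s0 length_3 by (auto simp: boundary_eq)
  have "connected ?H"
    using J convex_connected th by (intro connected_continuous_image continuous_on_subset[OF continuous_on_exit]) auto
  then have H: "?H \<subseteq> side vs i"
    using connected_in_side[of ?H i "hit_point vs (pt \<theta> s0)"] i s0 nc bd length_3 by auto
  define c where "c = height (side_reflection vs i \<theta>) (vs ! i) + height \<theta> (vs ! i)"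
  have "billiard_map vs (pt \<theta> s) = pt (side_reflection vs i \<theta>) (c - s) \<and>
      c - s \<in> heights (side_reflection vs i \<theta>)" if s: "s \<in> J" for s
  proof -
    have p: "snd (pt \<theta> s) = \<theta>" "height \<theta> (fst (pt \<theta> s)) = s" using pt_props J s th by blast+
    have hs: "hit_point vs (pt \<theta> s) \<in> side vs i" using H s by auto
    have T: "billiard_map vs (pt \<theta> s) = (hit_point vs (pt \<theta> s), side_reflection vs i \<theta>)"
      using billiard_map_eq[OF _ hs nc[OF s]] i length_3 p by simp
    have "height \<theta> (hit_point vs (pt \<theta> s)) = s" using height_hit_point[of "pt \<theta> s" vs] p by simp
    then have "level (billiard_map vs (pt \<theta> s)) = c - s" "snd (billiard_map vs (pt \<theta> s)) = side_reflection vs i \<theta>"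
      unfolding T using height_reflection[OF i(1) hs, of \<theta>] by (simp_all add: c_def)
    then show ?thesis
      using billiard_map_phase_space[OF ps[OF s] nc[OF s]] pt_level level_in_heights by metis
  qed
  then show thesis using that[of i c] i H by blast
qed

lemma beam_isometry_iterate:
  assumes th: "norm \<theta> = 1" and J: "convex J" "J \<subseteq> heights \<theta>" "J \<noteq> {}"
    and nc: "\<And>s. s \<in> J \<Longrightarrow> runs n (pt \<theta> s)"
  obtains \<theta>' c where "norm \<theta>' = 1" "\<And>s. s \<in> J \<Longrightarrow> (billiard_map vs ^^ n) (pt \<theta> s) = pt \<theta>' ((-1)^n * s + c)"
    "\<And>s. s \<in> J \<Longrightarrow> (-1)^n * s + c \<in> heights \<theta>'"
proof -
  have "\<exists>\<theta>' c. norm \<theta>' = 1 \<and> (\<forall>s\<in>J. (billiard_map vs ^^ n) (pt \<theta> s) = pt \<theta>' ((-1)^n * s + c) \<and>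
      (-1)^n * s + c \<in> heights \<theta>')"
    using nc
  proof (induction n)
    case 0
    then show ?case using th J by (intro exI[of _ \<theta>] exI[of _ 0]) auto
  next
    case (Suc n)
    then obtain \<theta>' c where IH: "norm \<theta>' = 1"
      "\<And>s. s \<in> J \<Longrightarrow> (billiard_map vs ^^ n) (pt \<theta> s) = pt \<theta>' ((-1)^n * s + c)"
      "\<And>s. s \<in> J \<Longrightarrow> (-1)^n * s + c \<in> heights \<theta>'"
      by (auto simp: runs_Suc)
    let ?J = "(\<lambda>s. (-1)^n * s + c) ` J"
    have "?J = (+) c ` ((*\<^sub>R) ((-1)^n) ` J)" by (auto simp: image_image)
    then have "convex ?J" using J(1) by (metis convex_scaling convex_translation)
    moreover have "?J \<subseteq> heights \<theta>'" "?J \<noteq> {}" using IH J by auto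
    moreover have "hit_point vs (pt \<theta>' r) \<notin> set vs" if "r \<in> ?J" for r
      using that Suc.prems IH(2) by (auto simp: runs_Suc)
    ultimately obtain i d where id: "i < 3"
      "\<And>r. r \<in> ?J \<Longrightarrow> billiard_map vs (pt \<theta>' r) = pt (side_reflection vs i \<theta>') (d - r)"
      "\<And>r. r \<in> ?J \<Longrightarrow> d - r \<in> heights (side_reflection vs i \<theta>')"
      by (rule beam_isometry[OF IH(1), of ?J]) blast+
    have n1: "norm (side_reflection vs i \<theta>') = 1" using norm_side_reflection id(1) IH(1) length_3 by simp
    have *: "(billiard_map vs ^^ Suc n) (pt \<theta> s) = pt (side_reflection vs i \<theta>') ((-1)^Suc n * s + (d - c))"
      "(-1)^Suc n * s + (d - c) \<in> heights (side_reflection vs i \<theta>')"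
      if s: "s \<in> J" for s
      using id(2,3)[of "(-1)^n * s + c"] IH(2)[OF s] s by (auto simp: algebra_simps)
    then show ?case using n1 by blast
  qed
  then show thesis using that by blast
qed

end

section \<open>Invariant sets without gaps\<close>

context triangle
begin

text \<open>The properties of a limit set that the gap argument uses, stated abstractly so that it
  applies to the reversed set as well. The equivalence in the third clause makes the complement
  invariant too, so gaps are carried to gaps.\<close>

definition invariant_set :: "phase_point set \<Rightarrow> bool" where
  "invariant_set K \<longleftrightarrow> K \<subseteq> phase_space vs \<and> finite (snd ` K) \<and>
     (\<forall>u\<in>phase_space vs. hit_point vs u \<notin> set vs \<longrightarrow> (billiard_map vs u \<in> K \<longleftrightarrow> u \<in> K)) \<and>
     (\<forall>u\<in>K. \<forall>n>0. runs n u \<longrightarrow> (billiard_map vs ^^ n) u \<noteq> u)"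

lemma invariant_setD:
  assumes "invariant_set K"
  shows "u \<in> K \<Longrightarrow> u \<in> phase_space vs" "finite (snd ` K)"
    "u \<in> phase_space vs \<Longrightarrow> hit_point vs u \<notin> set vs \<Longrightarrow> billiard_map vs u \<in> K \<longleftrightarrow> u \<in> K"
    "u \<in> K \<Longrightarrow> 0 < n \<Longrightarrow> runs n u \<Longrightarrow> (billiard_map vs ^^ n) u \<noteq> u"
  using assms unfolding invariant_set_def by blast+

lemma invariant_funpow:
  assumes K: "invariant_set K" and r: "runs n u"
  shows "(billiard_map vs ^^ n) u \<in> K \<longleftrightarrow> u \<in> K"
  using r
proof (induction n)
  case (Suc n)
  then show ?case
    using invariant_setD(3)[OF K, of "(billiard_map vs ^^ n) u"] runs_in_phase_space[of n u]
    by (auto simp: runs_Suc)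
qed simp

text \<open>Running the gap argument on the reversed set yields corner hits in the past.\<close>

lemma invariant_set_flip:
  assumes K: "invariant_set K" shows "invariant_set (flip vs ` K)"
proof -
  have mem: "u \<in> flip vs ` K \<longleftrightarrow> flip vs u \<in> K" if "u \<in> phase_space vs" for u
    using flip_flip invariant_setD(1)[OF K] that by (metis image_iff)
  have sub: "flip vs ` K \<subseteq> phase_space vs" using flip_phase_space invariant_setD(1)[OF K] by auto
  have "snd ` (flip vs ` K) = uminus ` (snd ` K)" by (auto simp: image_image)
  then have fin: "finite (snd ` (flip vs ` K))" using invariant_setD(2)[OF K] by simp
  have inv: "billiard_map vs u \<in> flip vs ` K \<longleftrightarrow> u \<in> flip vs ` K"
    if u: "u \<in> phase_space vs" "hit_point vs u \<notin> set vs" for u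
  proof -
    have T: "billiard_map vs u \<in> phase_space vs" using billiard_map_phase_space u by blast
    show ?thesis
      using invariant_setD(3)[OF K flip_phase_space[OF T]] billiard_map_flip[OF u] mem[OF T] mem[OF u(1)] u(2)
      by simp
  qed
  have np: "(billiard_map vs ^^ n) v \<noteq> v" if v: "v \<in> flip vs ` K" "0 < n" "runs n v" for v n
  proof
    assume "(billiard_map vs ^^ n) v = v"
    moreover have "flip vs v \<in> K" using mem v(1) sub by blast
    ultimately show False using runs_flip[OF v(3)] invariant_setD(4)[OF K _ v(2)] by metis
  qed
  show ?thesis unfolding invariant_set_def using sub fin inv np by blast
qed

lemma open_noncorner:
  assumes "norm \<theta> = 1" shows "open {s \<in> heights \<theta>. hit_point vs (pt \<theta> s) \<notin> set vs}"
proof -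
  have "open (heights \<theta> \<inter> (\<lambda>s. hit_point vs (pt \<theta> s)) -` (- set vs))"
    using assms by (intro continuous_open_preimage continuous_on_exit open_heights) (auto intro: finite_imp_closed)
  then show ?thesis by (simp add: Int_def vimage_def)
qed

text \<open>The one-sided gap at an orbit of \<open>K\<close> is carried along isometrically unless it contains a
  corner hit. Each corner lies in the gaps of finitely many orbit points, so the gap length is
  eventually constant, and boundedness forces two orbit points to coincide.\<close>

lemma gap_endpoint_hits_corner:
  assumes K: "invariant_set K" and u: "u \<in> K" and \<sigma>: "\<sigma> \<in> {1, -1}" and \<delta>: "0 < \<delta>"
    and free: "\<And>t. 0 < t \<Longrightarrow> t < \<delta> \<Longrightarrow>
      level u + \<sigma> * t \<in> heights (snd u) \<and> pt (snd u) (level u + \<sigma> * t) \<notin> K"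
  shows "\<exists>k. runs k u \<and> hit_point vs ((billiard_map vs ^^ k) u) \<in> set vs"
proof (rule ccontr)
  assume neg: "\<nexists>k. runs k u \<and> hit_point vs ((billiard_map vs ^^ k) u) \<in> set vs"
  have r: "runs k u" for k
    by (induction k) (use neg u invariant_setD(1)[OF K] in \<open>auto simp: runs_Suc\<close>)
  have nc: "hit_point vs ((billiard_map vs ^^ k) u) \<notin> set vs" for k using r neg by blast
  define a where "a k = (billiard_map vs ^^ k) u" for k
  \<comment> \<open>A step maps levels by \<open>c - s\<close>, so the gap changes sides at each
    step.\<close>
  define sg :: "nat \<Rightarrow> real" where "sg k = (-1)^k * \<sigma>" for k
  have sg: "sg k \<in> {1, -1}" for k using \<sigma> by (cases "even k") (auto simp: sg_def)
  have aK: "a k \<in> K" for k using invariant_funpow[OF K r] u by (simp add: a_def)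
  have ap: "a k \<in> phase_space vs" for k using aK invariant_setD(1)[OF K] by blast
  have an: "norm (snd (a k)) = 1" for k using ap phase_spaceD by blast
  have inj: "k = l" if "a k = a l" for k l
  proof -
    have False if "a k = a l" "k < l" for k l
    proof -
      have "(billiard_map vs ^^ (l - k)) (a k) = a l"
        using that(2) by (simp add: a_def flip: funpow_add[THEN fun_cong, unfolded comp_apply])
      moreover have "runs (l - k) (a k)" using runs_add[of k "l - k" u] r by (simp add: a_def)
      ultimately show False using invariant_setD(4)[OF K aK, of "l - k" k] that by simp
    qed
    then show ?thesis using that by (metis linorder_neqE)
  qed
  have inj': "k = l" if "snd (a k) = snd (a l)" "level (a k) = level (a l)" for k l
    using inj entry_unique[OF ap ap] that by blast
  define gap where "gap k d \<longleftrightarrow> (\<forall>t. 0 < t \<and> t < d \<longrightarrow> level (a k) + sg k * t \<in> heights (snd (a k)) \<and>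
      pt (snd (a k)) (level (a k) + sg k * t) \<notin> K)" for k d
  have step: "gap (Suc k) d" if g: "gap k d" and d: "0 < d"
    and ncg: "\<And>t. 0 < t \<Longrightarrow> t < d \<Longrightarrow> hit_point vs (pt (snd (a k)) (level (a k) + sg k * t)) \<notin> set vs" for k d
  proof -
    define \<theta> s where "\<theta> = snd (a k)" and "s = level (a k)"
    have as: "a k = pt \<theta> s" using pt_level[OF ap] by (simp add: \<theta>_def s_def)
    \<comment> \<open>The half-open interval includes the orbit point itself, so that it leaves
      through the same side as the chords of its gap.\<close>
    let ?J = "(\<lambda>t. s + sg k * t) ` {0..<d}"
    have "?J = (+) s ` ((*\<^sub>R) (sg k) ` {0..<d})" by (auto simp: image_image)
    then have "convex ?J" by (metis convex_scaling convex_translation convex_real_interval(7))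
    moreover have "?J \<subseteq> heights \<theta>"
    proof
      fix x assume "x \<in> ?J"
      then obtain t where "t \<in> {0..<d}" "x = s + sg k * t" by blast
      then show "x \<in> heights \<theta>" using g level_in_heights[OF ap, of k]
        by (cases "t = 0") (auto simp: gap_def \<theta>_def s_def)
    qed
    moreover have "?J \<noteq> {}" using d by auto
    moreover have "hit_point vs (pt \<theta> x) \<notin> set vs" if "x \<in> ?J" for x
    proof -
      obtain t where "t \<in> {0..<d}" "x = s + sg k * t" using \<open>x \<in> ?J\<close> by blast
      then show ?thesis using ncg[of t] nc[of k] as
        by (cases "t = 0") (auto simp: \<theta>_def s_def a_def)
    qed
    ultimately obtain i c where ic: "i < 3" "\<And>x. x \<in> ?J \<Longrightarrow>
        billiard_map vs (pt \<theta> x) = pt (side_reflection vs i \<theta>) (c - x)"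
      "\<And>x. x \<in> ?J \<Longrightarrow> c - x \<in> heights (side_reflection vs i \<theta>)"
      using beam_isometry[of \<theta> ?J] an[of k] unfolding \<theta>_def by metis
    let ?\<theta> = "side_reflection vs i \<theta>"
    have n': "norm ?\<theta> = 1" using norm_side_reflection ic(1) an[of k] length_3 by (simp add: \<theta>_def)
    have "s \<in> ?J" using d by (intro image_eqI[of _ _ 0]) auto
    then have as': "a (Suc k) = pt ?\<theta> (c - s)" "c - s \<in> heights ?\<theta>" using ic as by (auto simp: a_def)
    then have *: "snd (a (Suc k)) = ?\<theta>" using pt_props(2)[OF n'] by simp
    then have **: "level (a (Suc k)) = c - s" using pt_props(3)[OF n' as'(2)] as'(1) by simp
    show ?thesis unfolding gap_def
    proof (intro allI impI)
      fix t assume t: "0 < t \<and> t < d"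
      let ?x = "s + sg k * t"
      have x: "?x \<in> ?J" using t by auto
      have e: "level (a (Suc k)) + sg (Suc k) * t = c - ?x" unfolding ** by (simp add: sg_def)
      have h: "?x \<in> heights \<theta>" "pt \<theta> ?x \<notin> K" using g t by (auto simp: gap_def \<theta>_def s_def)
      have "pt \<theta> ?x \<in> phase_space vs" using pt_props h an[of k] by (simp add: \<theta>_def)
      then have "billiard_map vs (pt \<theta> ?x) \<notin> K"
        using invariant_setD(3)[OF K, of "pt \<theta> ?x"] h(2) ncg[of t] t by (simp add: \<theta>_def s_def)
      then show "level (a (Suc k)) + sg (Suc k) * t \<in> heights (snd (a (Suc k))) \<and>
          pt (snd (a (Suc k))) (level (a (Suc k)) + sg (Suc k) * t) \<notin> K"
        unfolding e unfolding * using ic(2,3)[OF x] by simp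
    qed
  qed
  have shrink: "gap k d'" if "gap k d" "d' \<le> d" for k d d' using that by (auto simp: gap_def)
  have exgap: "\<exists>d>0. gap k d" for k
  proof (induction k)
    case 0
    then show ?case using free \<delta> by (intro exI[of _ \<delta>]) (auto simp: gap_def a_def sg_def)
  next
    case (Suc k)
    then obtain d where d: "d > 0" "gap k d" by blast
    let ?O = "{s \<in> heights (snd (a k)). hit_point vs (pt (snd (a k)) s) \<notin> set vs}"
    have "level (a k) \<in> ?O" using level_in_heights[OF ap] pt_level[OF ap] nc by (simp add: a_def)
    then obtain e where e: "e > 0" "ball (level (a k)) e \<subseteq> ?O"
      using open_noncorner[OF an] openE by metis
    have "gap (Suc k) (min d e)"
    proof (rule step)
      show "gap k (min d e)" using shrink d by auto
      fix t assume t: "0 < t" "t < min d e"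
      then have "level (a k) + sg k * t \<in> ball (level (a k)) e" using sg[of k] by (auto simp: dist_real_def)
      then show "hit_point vs (pt (snd (a k)) (level (a k) + sg k * t)) \<notin> set vs" using e by auto
    qed (use d e in auto)
    then show ?case using d e by (intro exI[of _ "min d e"]) auto
  qed
  define bad where "bad k t \<longleftrightarrow> 0 < t \<and> (\<forall>t'. 0 < t' \<and> t' \<le> t \<longrightarrow> level (a k) + sg k * t' \<in> heights (snd (a k)) \<and>
      pt (snd (a k)) (level (a k) + sg k * t') \<notin> K) \<and>
      hit_point vs (pt (snd (a k)) (level (a k) + sg k * t)) \<in> set vs" for k t
  define bt where "bt k = (SOME t. bad k t)" for k
  have bt: "bad k (bt k)" if "\<exists>t. bad k t" for k unfolding bt_def using that by (rule someI_ex)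
  have dirs: "snd (a k) \<in> snd ` K" for k using aK by auto
  \<comment> \<open>Direction, gap side and corner determine the level of the chord into the corner.
    Of two distinct orbit points sharing these data, the nearer one would lie in the gap of the
    farther one, though orbit points are in \<open>K\<close>.\<close>
  have "finite {k. \<exists>t. bad k t}"
  proof -
    let ?f = "\<lambda>k. (snd (a k), sg k, hit_point vs (pt (snd (a k)) (level (a k) + sg k * bt k)))"
    have "inj_on ?f {k. \<exists>t. bad k t}"
    proof (rule inj_onI)
      fix k l assume kl: "k \<in> {k. \<exists>t. bad k t}" "l \<in> {k. \<exists>t. bad k t}" "?f k = ?f l"
      have b: "bad k (bt k)" "bad l (bt l)" using bt kl by auto
      have hk: "level (a k) + sg k * bt k \<in> heights (snd (a k))" "level (a l) + sg l * bt l \<in> heights (snd (a l))"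
        using b by (auto simp: bad_def)
      have kl3: "snd (a k) = snd (a l)" "sg k = sg l"
        "hit_point vs (pt (snd (a k)) (level (a k) + sg k * bt k)) =
         hit_point vs (pt (snd (a l)) (level (a l) + sg l * bt l))"
        using kl(3) unfolding prod.inject by blast+
      have hh: "height (snd (a k)) (hit_point vs (pt (snd (a k)) (level (a k) + sg k * bt k))) = level (a k) + sg k * bt k"
        "height (snd (a l)) (hit_point vs (pt (snd (a l)) (level (a l) + sg l * bt l))) = level (a l) + sg l * bt l"
        using height_hit_point[of "pt (snd (a k)) (level (a k) + sg k * bt k)" vs]
          height_hit_point[of "pt (snd (a l)) (level (a l) + sg l * bt l)" vs]
          pt_props[OF an hk(1)] pt_props[OF an hk(2)] by (simp_all only:)
      then have e: "level (a k) + sg k * bt k = level (a l) + sg k * bt l"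
        using kl3 by metis
      have *: False if kl: "bad k (bt k)" "bad l (bt l)" "bt l < bt k"
        "level (a k) + sg k * bt k = level (a l) + sg k * bt l" "snd (a k) = snd (a l)" for k l
      proof -
        have lv: "level (a l) = level (a k) + sg k * (bt k - bt l)" using kl(4) by (simp add: algebra_simps)
        have "0 < bt l" using kl(2) by (simp add: bad_def)
        then have "pt (snd (a k)) (level (a k) + sg k * (bt k - bt l)) \<notin> K"
          using kl(1,3) unfolding bad_def by auto
        then show False using pt_level[OF ap, of l] aK[of l] lv kl(5) by simp
      qed
      have "bt k = bt l" using *[of k l] *[of l k] b e kl3 by (metis linorder_neqE)
      then have "level (a k) = level (a l)" using e by simp
      then show "k = l" using kl3(1) inj' by blast
    qed
    moreover have "?f ` {k. \<exists>t. bad k t} \<subseteq> snd ` K \<times> {1, -1} \<times> set vs"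
    proof (rule image_subsetI)
      fix k assume "k \<in> {k. \<exists>t. bad k t}"
      then have "hit_point vs (pt (snd (a k)) (level (a k) + sg k * bt k)) \<in> set vs"
        using bt[of k] unfolding bad_def by blast
      then show "?f k \<in> snd ` K \<times> {1, -1} \<times> set vs" using dirs sg by (intro SigmaI)
    qed
    ultimately show ?thesis
      using invariant_setD(2)[OF K] by (meson List.finite_set finite.emptyI finite.insertI finite_SigmaI finite_imageD finite_subset)
  qed
  then obtain k0 where k0: "\<And>k t. bad k t \<Longrightarrow> k < k0"
    by (metis (mono_tags, lifting) finite_nat_set_iff_bounded mem_Collect_eq)
  obtain d where d: "d > 0" "gap k0 d" using exgap by blast
  have gaps: "gap (k0 + j) d" for j
  proof (induction j)
    case (Suc j)
    have "gap (Suc (k0 + j)) d"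
    proof (rule step[OF Suc d(1)])
      fix t assume t: "0 < t" "t < d"
      show "hit_point vs (pt (snd (a (k0 + j))) (level (a (k0 + j)) + sg (k0 + j) * t)) \<notin> set vs"
      proof
        assume "hit_point vs (pt (snd (a (k0 + j))) (level (a (k0 + j)) + sg (k0 + j) * t)) \<in> set vs"
        then have "bad (k0 + j) t" using t Suc by (auto simp: bad_def gap_def)
        then show False using k0 by fastforce
      qed
    qed
    then show ?case by simp
  qed (use d in simp)
  \<comment> \<open>Cells of length \<open>d\<close>: two distinct orbit points with equal
    direction, gap side and cell would be at distance less than \<open>d\<close>, so one would lie
    in the gap of the other. Boundedness of the levels leaves finitely many cells for infinitely
    many times.\<close>
  let ?g = "\<lambda>j. (snd (a (k0 + j)), sg (k0 + j), \<lfloor>level (a (k0 + j)) / d\<rfloor>)"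
  have "inj ?g"
  proof (rule injI)
    fix j l assume jl: "?g j = ?g l"
    have *: False if jl: "?g j = ?g l" "0 < sg (k0 + j) * (level (a (k0 + l)) - level (a (k0 + j)))" for j l
    proof -
      define t where "t = sg (k0 + j) * (level (a (k0 + l)) - level (a (k0 + j)))"
      have "\<lfloor>level (a (k0 + j)) / d\<rfloor> = \<lfloor>level (a (k0 + l)) / d\<rfloor>" and sj: "snd (a (k0 + j)) = snd (a (k0 + l))"
        using jl(1) unfolding prod.inject by blast+
      then have "\<bar>level (a (k0 + l)) / d - level (a (k0 + j)) / d\<bar> < 1" by linarith
      then have "\<bar>level (a (k0 + l)) - level (a (k0 + j))\<bar> < d"
        using d(1) by (simp add: field_simps flip: diff_divide_distrib)
      then have "0 < t" "t < d" using jl(2) sg[of "k0 + j"] by (auto simp: t_def)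
      moreover have "level (a (k0 + l)) = level (a (k0 + j)) + sg (k0 + j) * t"
        using sg[of "k0 + j"] by (auto simp: t_def)
      ultimately have "pt (snd (a (k0 + j))) (level (a (k0 + l))) \<notin> K" using gaps[of j] unfolding gap_def by auto
      then show False using pt_level[OF ap, of "k0 + l"] aK[of "k0 + l"] sj by simp
    qed
    have "level (a (k0 + j)) = level (a (k0 + l))"
    proof (rule ccontr)
      have jl2: "snd (a (k0 + j)) = snd (a (k0 + l))" "sg (k0 + j) = sg (k0 + l)"
        using jl unfolding prod.inject by blast+
      assume "level (a (k0 + j)) \<noteq> level (a (k0 + l))"
      then have "0 < sg (k0 + j) * (level (a (k0 + l)) - level (a (k0 + j))) \<or>
          0 < sg (k0 + l) * (level (a (k0 + j)) - level (a (k0 + l)))"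
        using sg[of "k0 + j"] unfolding jl2(2) by auto
      then show False using *[OF jl] *[OF jl[symmetric]] by blast
    qed
    moreover have "snd (a (k0 + j)) = snd (a (k0 + l))" using jl unfolding prod.inject by blast
    ultimately show "j = l" using inj'[of "k0 + j" "k0 + l"] by simp
  qed
  moreover obtain B where B: "\<And>k. \<bar>level (a k)\<bar> \<le> B"
  proof -
    have "bounded (\<Union>\<theta>\<in>snd ` K. heights \<theta>)"
      using invariant_setD(2)[OF K] bounded_heights by (intro bounded_UN) auto
    then obtain B where "\<forall>x\<in>(\<Union>\<theta>\<in>snd ` K. heights \<theta>). \<bar>x\<bar> \<le> B" unfolding bounded_iff real_norm_def by blast
    then show thesis using that level_in_heights[OF ap] dirs by blast
  qed
  have "range ?g \<subseteq> snd ` K \<times> {1, -1} \<times> {\<lfloor>- B / d\<rfloor>..\<lfloor>B / d\<rfloor>}"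
  proof -
    have "\<lfloor>level (a k) / d\<rfloor> \<in> {\<lfloor>- B / d\<rfloor>..\<lfloor>B / d\<rfloor>}" for k
    proof -
      have "- B / d \<le> level (a k) / d" "level (a k) / d \<le> B / d"
        using B[of k] d(1) by (intro divide_right_mono; simp add: abs_le_iff)+
      then show ?thesis using floor_mono by (simp only: atLeastAtMost_iff) blast
    qed
    then show ?thesis using dirs sg by (intro image_subsetI SigmaI)
  qed
  then have "finite (range ?g)"
    using invariant_setD(2)[OF K] by (meson finite.emptyI finite.insertI finite_SigmaI finite_atLeastAtMost_int finite_subset)
  ultimately show False using finite_imageD infinite_UNIV_nat by blast
qed

end

section \<open>The limit set of a non-exceptional dense orbit\<close>

lemma reflection_group_comp:
  "h \<in> reflection_group vs \<Longrightarrow> g \<in> reflection_group vs \<Longrightarrow> h \<circ> g \<in> reflection_group vs"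
proof (induction rule: reflection_group.induct)
  case (step h i)
  then show ?case using reflection_group.step[of "h \<circ> g" vs i] by (simp add: o_def)
qed simp

lemma (in triangle) infinite_boundary: "infinite (boundary vs)"
proof
  assume "finite (boundary vs)"
  moreover have "side vs 0 \<subseteq> boundary vs" unfolding boundary_eq length_3 by (rule UN_upper) simp
  ultimately have "countable (side vs 0)" by (meson countable_finite finite_subset)
  then show False using corners_distinct(1)[THEN uncountable_closed_segment] by (simp add: side_eq)
qed

lemma (in triangle) open_runs:
  assumes "norm \<theta> = 1" shows "open {s \<in> heights \<theta>. runs n (pt \<theta> s)}"
proof (induction n)
  case 0
  have "{s \<in> heights \<theta>. runs 0 (pt \<theta> s)} = heights \<theta>" using pt_props[OF assms] by auto
  then show ?case using open_heights[OF assms] by simp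
next
  case (Suc n)
  show ?case
  proof (rule openI)
    fix s assume s': "s \<in> {s \<in> heights \<theta>. runs (Suc n) (pt \<theta> s)}"
    then have s: "s \<in> heights \<theta>" "runs n (pt \<theta> s)" "hit_point vs ((billiard_map vs ^^ n) (pt \<theta> s)) \<notin> set vs"
      by (auto simp: runs_Suc)
    have "s \<in> {s \<in> heights \<theta>. runs n (pt \<theta> s)}" using s by simp
    then obtain e where e: "e > 0" "ball s e \<subseteq> {s \<in> heights \<theta>. runs n (pt \<theta> s)}"
      using openE[OF Suc] by blast
    obtain \<theta>' c where it: "norm \<theta>' = 1"
      "\<And>r. r \<in> ball s e \<Longrightarrow> (billiard_map vs ^^ n) (pt \<theta> r) = pt \<theta>' ((-1)^n * r + c)"
      "\<And>r. r \<in> ball s e \<Longrightarrow> (-1)^n * r + c \<in> heights \<theta>'"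
      by (rule beam_isometry_iterate[OF assms convex_ball, of s e n]) (use e in auto)
    let ?O = "{r \<in> heights \<theta>'. hit_point vs (pt \<theta>' r) \<notin> set vs}"
    have "open (ball s e \<inter> (\<lambda>r. (-1)^n * r + c) -` ?O)"
      by (intro continuous_open_preimage continuous_intros open_noncorner it(1)) auto
    moreover have "s \<in> ball s e \<inter> (\<lambda>r. (-1)^n * r + c) -` ?O" using it(2,3)[of s] s e by auto
    ultimately obtain d where d: "d > 0" "ball s d \<subseteq> ball s e \<inter> (\<lambda>r. (-1)^n * r + c) -` ?O"
      using openE[where S = "ball s e \<inter> (\<lambda>r. (-1)^n * r + c) -` ?O" and x = s] by blast
    have "ball s d \<subseteq> {s \<in> heights \<theta>. runs (Suc n) (pt \<theta> s)}"
    proof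
      fix r assume "r \<in> ball s d"
      then have "r \<in> ball s e" "(-1)^n * r + c \<in> ?O" using d by auto
      then show "r \<in> {s \<in> heights \<theta>. runs (Suc n) (pt \<theta> s)}" using e it(2)[of r] by (auto simp: runs_Suc)
    qed
    then show "\<exists>T>0. ball s T \<subseteq> {s \<in> heights \<theta>. runs (Suc n) (pt \<theta> s)}" using d by blast
  qed
qed

locale dense_orbit = triangle +
  fixes u0 :: phase_point
  assumes orbit: "orbit_defined vs u0"
    and dense: "boundary vs \<subseteq> closure (range (foot vs u0))"
    and rational: "rational_polygon vs"
    and nonexceptional: "\<not> exceptional_point vs u0"
begin

definition orb :: "nat \<Rightarrow> phase_point" where
  "orb n = (billiard_map vs ^^ n) u0"

lemma runs_u0: "runs n u0"
  using orbit by (auto simp: orbit_defined_def runs_def)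

lemma orb_phase_space: "orb n \<in> phase_space vs"
  using runs_in_phase_space[OF runs_u0] by (simp add: orb_def)

lemma orb_noncorner: "hit_point vs (orb n) \<notin> set vs"
  using orbit by (auto simp: orbit_defined_def orb_def)

lemma orb_Suc: "orb (Suc n) = billiard_map vs (orb n)"
  by (simp add: orb_def)

lemma fst_orb: "fst (orb n) = foot vs u0 n"
  by (simp add: foot_def orb_def)

lemma norm_snd_orb: "norm (snd (orb n)) = 1"
  using orb_phase_space phase_spaceD by blast

text \<open>Since the orbit takes finitely many directions, they are required to agree exactly.
  Arbitrarily late times are demanded so that each approximating orbit point may be replaced by its
  predecessor.\<close>

definition limit_set :: "phase_point set" where
  "limit_set = {u \<in> phase_space vs. \<forall>e>0. \<forall>N. \<exists>n\<ge>N. snd (orb n) = snd u \<and> \<bar>level (orb n) - level u\<bar> < e}"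

lemma finite_snd_orb: "finite (range (snd \<circ> orb))"
proof (rule finite_subset)
  show "range (snd \<circ> orb) \<subseteq> {g (snd u0) |g. g \<in> reflection_group vs}"
    using snd_billiard_funpow[OF runs_u0] by (auto simp: orb_def)
  show "finite {g (snd u0) |g. g \<in> reflection_group vs}"
    using finite_directions rational phase_spaceD[OF orb_phase_space[of 0]] by (simp add: orb_def)
qed

lemma limit_setD:
  assumes "u \<in> limit_set" "e > 0"
  obtains n where "n \<ge> N" "snd (orb n) = snd u" "\<bar>level (orb n) - level u\<bar> < e"
proof -
  have "\<exists>n\<ge>N. snd (orb n) = snd u \<and> \<bar>level (orb n) - level u\<bar> < e"
    using assms unfolding limit_set_def by blast
  then show thesis using that by blast
qed

text \<open>Around \<open>u\<close> the map is an isometry of levels, so late orbit points near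
  \<open>u\<close> are carried to orbit points near its image. Conversely, an orbit point near the
  image comes from a chord near \<open>u\<close>, which injectivity identifies with the preceding
  orbit point.\<close>

lemma limit_set_invariant:
  assumes u: "u \<in> phase_space vs" and nc: "hit_point vs u \<notin> set vs"
  shows "billiard_map vs u \<in> limit_set \<longleftrightarrow> u \<in> limit_set"
proof -
  define \<theta> s where "\<theta> = snd u" and "s = level u"
  have us: "u = pt \<theta> s" using pt_level[OF u] by (simp add: \<theta>_def s_def)
  have th: "norm \<theta> = 1" using phase_spaceD[OF u] by (simp add: \<theta>_def)
  have sh: "s \<in> heights \<theta>" using level_in_heights[OF u] by (simp add: \<theta>_def s_def)
  have "hit_point vs (pt \<theta> s) \<notin> set vs" using nc us by simp
  then have "s \<in> {s \<in> heights \<theta>. hit_point vs (pt \<theta> s) \<notin> set vs}" using sh by simp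
  then obtain e where e: "e > 0" "ball s e \<subseteq> {s \<in> heights \<theta>. hit_point vs (pt \<theta> s) \<notin> set vs}"
    using openE[OF open_noncorner[OF th]] by blast
  have "ball s e \<subseteq> heights \<theta>" "ball s e \<noteq> {}" using e by auto
  then obtain i c where ic: "i < 3"
    "\<And>r. r \<in> ball s e \<Longrightarrow> billiard_map vs (pt \<theta> r) = pt (side_reflection vs i \<theta>) (c - r)"
    "\<And>r. r \<in> ball s e \<Longrightarrow> c - r \<in> heights (side_reflection vs i \<theta>)"
    by (rule beam_isometry[OF th convex_ball, of s e]) (use e in auto)
  define \<theta>' where "\<theta>' = side_reflection vs i \<theta>"
  have th': "norm \<theta>' = 1" using norm_side_reflection ic(1) th length_3 by (simp add: \<theta>'_def)
  have T: "snd (billiard_map vs (pt \<theta> r)) = \<theta>'" "level (billiard_map vs (pt \<theta> r)) = c - r"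
    if "r \<in> ball s e" for r
    using ic(2,3)[OF that] pt_props[OF th'] unfolding \<theta>'_def[symmetric] by auto
  have Tu: "snd (billiard_map vs u) = \<theta>'" "level (billiard_map vs u) = c - s"
    using T[of s] e us by auto
  have Tps: "billiard_map vs u \<in> phase_space vs" using billiard_map_phase_space u nc .
  show ?thesis
  proof
    assume K: "u \<in> limit_set"
    have "\<exists>n\<ge>N. snd (orb n) = \<theta>' \<and> \<bar>level (orb n) - (c - s)\<bar> < d" if d: "d > 0" for d N
    proof -
      obtain n where n: "n \<ge> N" "snd (orb n) = \<theta>" "\<bar>level (orb n) - s\<bar> < min d e"
        by (rule limit_setD[OF K, where e = "min d e" and N = N]) (use e(1) d in \<open>auto simp: \<theta>_def s_def\<close>)
      have "level (orb n) \<in> ball s e" using n(3) by (auto simp: dist_real_def)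
      moreover have "orb n = pt \<theta> (level (orb n))" using pt_level[OF orb_phase_space] n(2) by metis
      ultimately have "snd (orb (Suc n)) = \<theta>'" "level (orb (Suc n)) = c - level (orb n)"
        using T unfolding orb_Suc by metis+
      then show ?thesis using n by (intro exI[of _ "Suc n"]) auto
    qed
    then show "billiard_map vs u \<in> limit_set" using Tps Tu by (simp add: limit_set_def)
  next
    assume K: "billiard_map vs u \<in> limit_set"
    have "\<exists>n\<ge>N. snd (orb n) = \<theta> \<and> \<bar>level (orb n) - s\<bar> < d" if d: "d > 0" for d N
    proof -
      obtain n where n: "n \<ge> Suc N" "snd (orb n) = \<theta>'" "\<bar>level (orb n) - (c - s)\<bar> < min d e"
        by (rule limit_setD[OF K, where e = "min d e" and N = "Suc N"]) (use e(1) d Tu in auto)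
      obtain m where m: "n = Suc m" "m \<ge> N" using n(1) by (cases n) auto
      define r where "r = c - level (orb n)"
      have r: "r \<in> ball s e" using n(3) by (auto simp: dist_real_def r_def)
      have rp: "pt \<theta> r \<in> phase_space vs" "hit_point vs (pt \<theta> r) \<notin> set vs"
        using r e pt_props[OF th, of r] by auto
      have "billiard_map vs (pt \<theta> r) = orb n"
        using T[OF r] n(2) billiard_map_phase_space[OF rp] orb_phase_space by (intro entry_unique) (auto simp: r_def)
      then have "orb m = pt \<theta> r"
        using billiard_map_inj[OF orb_phase_space orb_noncorner rp] by (simp add: m orb_Suc)
      then have "snd (orb m) = \<theta>" "level (orb m) = r" using pt_props[OF th, of r] r e by auto
      then show ?thesis using m n(3) by (intro exI[of _ m]) (auto simp: r_def)
    qed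
    then show "u \<in> limit_set" using u by (simp add: limit_set_def \<theta>_def s_def)
  qed
qed

text \<open>Periodicity would leave finitely many feet, which cannot be dense in the infinite
  boundary.\<close>

lemma orb_not_periodic: "0 < p \<Longrightarrow> orb (m + p) \<noteq> orb m"
proof
  assume p: "0 < p" and per: "orb (m + p) = orb m"
  have "orb n \<in> orb ` {..<m + p}" for n
  proof (induction n rule: less_induct)
    case (less n)
    show ?case
    proof (cases "n < m + p")
      case False
      have sh: "orb (j + k) = (billiard_map vs ^^ j) (orb k)" for j k by (simp add: orb_def funpow_add)
      have "orb n = orb (n - (m + p) + (m + p))" using False by simp
      also have "\<dots> = (billiard_map vs ^^ (n - (m + p))) (orb m)" unfolding sh[of _ "m + p"] by (simp only: per)
      also have "\<dots> = orb (n - (m + p) + m)" by (rule sh[symmetric])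
      also have "n - (m + p) + m = n - p" using False by simp
      finally show ?thesis using less[of "n - p"] p False by auto
    qed auto
  qed
  then have "range orb \<subseteq> orb ` {..<m + p}" by blast
  then have "finite (range orb)" by (meson finite_imageI finite_lessThan finite_subset)
  moreover have "range (foot vs u0) = fst ` range orb" by (auto simp: fst_orb[symmetric])
  ultimately have "finite (closure (range (foot vs u0)))" by (simp add: finite_imp_closed closure_closed)
  then show False using dense infinite_boundary finite_subset by blast
qed

text \<open>The doubled period \<open>n + n\<close> acts on levels near \<open>u\<close> as a
  translation, and fixing \<open>u\<close> makes it the identity there. The orbit visits this
  neighbourhood and would be periodic.\<close>

lemma limit_set_not_periodic:
  assumes u: "u \<in> limit_set" and n: "0 < n" and r: "runs n u"
  shows "(billiard_map vs ^^ n) u \<noteq> u"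
proof
  assume per: "(billiard_map vs ^^ n) u = u"
  have up: "u \<in> phase_space vs" using u by (simp add: limit_set_def)
  define \<theta> s where "\<theta> = snd u" and "s = level u"
  have us: "u = pt \<theta> s" using pt_level[OF up] by (simp add: \<theta>_def s_def)
  have th: "norm \<theta> = 1" using phase_spaceD[OF up] by (simp add: \<theta>_def)
  have per2: "runs (n + n) u" "(billiard_map vs ^^ (n + n)) u = u"
    using r per by (simp_all add: runs_add funpow_add)
  have sh: "s \<in> heights \<theta>" using level_in_heights[OF up] by (simp add: \<theta>_def s_def)
  then have "s \<in> {s \<in> heights \<theta>. runs (n + n) (pt \<theta> s)}" using us per2(1) by simp
  then obtain e where e: "e > 0" "ball s e \<subseteq> {s \<in> heights \<theta>. runs (n + n) (pt \<theta> s)}"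
    using openE[OF open_runs[OF th]] by blast
  obtain \<theta>' c where it: "norm \<theta>' = 1"
    "\<And>r. r \<in> ball s e \<Longrightarrow> (billiard_map vs ^^ (n + n)) (pt \<theta> r) = pt \<theta>' ((-1)^(n + n) * r + c)"
    "\<And>r. r \<in> ball s e \<Longrightarrow> (-1)^(n + n) * r + c \<in> heights \<theta>'"
    by (rule beam_isometry_iterate[OF th convex_ball, of s e "n + n"]) (use e in auto)
  have ev: "(-1)^(n + n) = (1::real)" by (simp flip: mult_2)
  have "pt \<theta>' (s + c) = pt \<theta> s" "s + c \<in> heights \<theta>'" "s \<in> heights \<theta>"
    using it(2,3)[of s] per2(2) us e ev sh by auto
  then have "\<theta>' = \<theta>" "c = 0"
    using pt_props[OF it(1), of "s + c"] pt_props[OF th, of s] by auto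
  obtain m where m: "snd (orb m) = \<theta>" "\<bar>level (orb m) - s\<bar> < e"
    by (rule limit_setD[OF u e(1)]) (auto simp: \<theta>_def s_def)
  have "orb m = pt \<theta> (level (orb m))" using pt_level[OF orb_phase_space] m(1) by metis
  moreover have "level (orb m) \<in> ball s e" using m(2) by (auto simp: dist_real_def)
  ultimately have "(billiard_map vs ^^ (n + n)) (orb m) = orb m"
    using it(2) ev \<open>\<theta>' = \<theta>\<close> \<open>c = 0\<close> by (metis add.right_neutral mult_1)
  then have "orb (m + (n + n)) = orb m" by (simp add: orb_def funpow_add add.commute[of m])
  then show False using orb_not_periodic n by (metis add_gr_0)
qed

lemma invariant_limit_set: "invariant_set limit_set"
  unfolding invariant_set_def
proof (intro conjI ballI allI impI)
  show "limit_set \<subseteq> phase_space vs" by (auto simp: limit_set_def)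
  have "snd ` limit_set \<subseteq> range (snd \<circ> orb)"
  proof
    fix \<theta> assume "\<theta> \<in> snd ` limit_set"
    then obtain u where "u \<in> limit_set" "\<theta> = snd u" by blast
    then show "\<theta> \<in> range (snd \<circ> orb)" using limit_setD[of u 1] by (metis comp_apply rangeI zero_less_one)
  qed
  then show "finite (snd ` limit_set)" using finite_snd_orb finite_subset by blast
  show "billiard_map vs u \<in> limit_set \<longleftrightarrow> u \<in> limit_set"
    if "u \<in> phase_space vs" "hit_point vs u \<notin> set vs" for u
    using limit_set_invariant that .
  show "(billiard_map vs ^^ n) u \<noteq> u" if "u \<in> limit_set" "0 < n" "runs n u" for u n
    using limit_set_not_periodic that .
qed

lemma limit_set_saturated:
  assumes u: "u \<in> limit_set" and q: "q \<in> heights (snd u)"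
  shows "pt (snd u) q \<in> limit_set"
proof (rule ccontr)
  assume neg: "pt (snd u) q \<notin> limit_set"
  define \<theta> p where "\<theta> = snd u" and "p = level u"
  note K = invariant_limit_set
  have up: "u \<in> phase_space vs" using u by (simp add: limit_set_def)
  have th: "norm \<theta> = 1" using phase_spaceD[OF up] by (simp add: \<theta>_def)
  have q: "q \<in> heights \<theta>" "pt \<theta> q \<notin> limit_set" using q neg by (auto simp: \<theta>_def)
  have p: "p \<in> heights \<theta>" "pt \<theta> p \<in> limit_set" using level_in_heights[OF up] pt_level[OF up] u by (auto simp: \<theta>_def p_def)
  have "p \<noteq> q" using p q by auto
  define B where "B = {t \<in> heights \<theta>. pt \<theta> t \<notin> limit_set}"
  have "open B"
  proof (rule openI)
    fix t assume t: "t \<in> B"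
    then have tp: "t \<in> heights \<theta>" "pt \<theta> t \<notin> limit_set" by (auto simp: B_def)
    then obtain e N where e: "e > 0" "\<And>n. n \<ge> N \<Longrightarrow> snd (orb n) = \<theta> \<Longrightarrow> \<bar>level (orb n) - t\<bar> < e \<Longrightarrow> False"
      using pt_props[OF th, of t] by (auto simp: limit_set_def)
    obtain d where d: "d > 0" "ball t d \<subseteq> heights \<theta>" using openE[OF open_heights[OF th] tp(1)] by blast
    have "pt \<theta> t' \<notin> limit_set" if t': "t' \<in> ball t (min d (e/2))" for t'
    proof
      assume "pt \<theta> t' \<in> limit_set"
      moreover have "t' \<in> heights \<theta>" using d(2) t' by auto
      ultimately obtain n where "n \<ge> N" "snd (orb n) = \<theta>" "\<bar>level (orb n) - t'\<bar> < e / 2"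
        using limit_setD[of "pt \<theta> t'" "e/2" N] pt_props[OF th, of t'] e(1)
        by (metis half_gt_zero)
      moreover have "\<bar>t - t'\<bar> < e / 2" using t' by (simp add: dist_real_def)
      ultimately have "\<bar>level (orb n) - t\<bar> < e" by linarith
      then show False using e(2) \<open>n \<ge> N\<close> \<open>snd (orb n) = \<theta>\<close> by blast
    qed
    then show "\<exists>T>0. ball t T \<subseteq> B" using d e(1) by (intro exI[of _ "min d (e/2)"]) (auto simp: B_def)
  qed
  define f where "f r = p + r * (q - p)" for r
  have fh: "f r \<in> heights \<theta>" if "r \<in> {0..1}" for r
  proof -
    have "f r = (1 - r) *\<^sub>R p + r *\<^sub>R q" by (simp add: f_def algebra_simps)
    then show ?thesis using convexD[OF convex_heights p(1) q(1), of "1 - r" r] that by auto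
  qed
  define C where "C = {r \<in> {0..1}. pt \<theta> (f r) \<in> limit_set}"
  have "C = {0..1} \<inter> f -` (- B)" using fh by (auto simp: C_def B_def)
  moreover have "closed ({0..1} \<inter> f -` (- B))"
    unfolding f_def using \<open>open B\<close> by (intro continuous_closed_preimage continuous_intros) auto
  ultimately have "closed C" by simp
  have C0: "0 \<in> C" using p by (simp add: C_def f_def)
  have Cb: "bdd_above C" by (intro bdd_aboveI[of _ 1]) (auto simp: C_def)
  \<comment> \<open>The last limit chord on the way from \<open>p\<close> to \<open>q\<close>;
    beyond it lies a gap of length \<open>\<delta>\<close>, the remaining distance to
    \<open>q\<close>.\<close>
  define r where "r = Sup C"
  have rC: "r \<in> C" unfolding r_def using closed_contains_Sup[of C] C0 Cb \<open>closed C\<close> by auto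
  have "r \<noteq> 1" using rC q by (auto simp: C_def f_def)
  then have r01: "0 \<le> r" "r < 1" using rC by (auto simp: C_def)
  have beyond: "pt \<theta> (f r') \<notin> limit_set" if "r < r'" "r' \<le> 1" for r'
    using cSup_upper[OF _ Cb, of r'] that r01 by (force simp: C_def r_def)
  define a where "a = f r"
  have a: "a \<in> heights \<theta>" "pt \<theta> a \<in> limit_set" using rC fh[of r] r01 by (auto simp: C_def a_def)
  define \<sigma> where "\<sigma> = sgn (q - p)"
  define \<delta> where "\<delta> = \<bar>q - p\<bar> * (1 - r)"
  have \<delta>: "\<delta> > 0" using r01 \<open>p \<noteq> q\<close> by (simp add: \<delta>_def)
  have gap: "a + \<sigma> * t \<in> heights \<theta> \<and> pt \<theta> (a + \<sigma> * t) \<notin> limit_set" if t: "0 < t" "t < \<delta>" for t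
  proof -
    have qp: "\<bar>q - p\<bar> > 0" using \<open>p \<noteq> q\<close> by simp
    have "\<sigma> * t = t / \<bar>q - p\<bar> * (q - p)" using qp by (simp add: \<sigma>_def sgn_if field_simps)
    then have "a + \<sigma> * t = f (r + t / \<bar>q - p\<bar>)" by (simp add: a_def f_def algebra_simps)
    moreover have "r < r + t / \<bar>q - p\<bar>" "r + t / \<bar>q - p\<bar> \<le> 1" using t qp by (auto simp: \<delta>_def field_simps)
    ultimately show ?thesis using beyond fh r01 by auto
  qed
  have \<sigma>: "\<sigma> \<in> {1, -1}" using \<open>p \<noteq> q\<close> by (auto simp: \<sigma>_def sgn_if)
  define v where "v = pt \<theta> a"
  have vK: "v \<in> limit_set" using a by (simp add: v_def)
  have v: "v \<in> phase_space vs" "snd v = \<theta>" "level v = a" using pt_props[OF th a(1)] by (auto simp: v_def)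
  obtain k where k: "runs k v" "hit_point vs ((billiard_map vs ^^ k) v) \<in> set vs"
    using gap_endpoint_hits_corner[OF K vK \<sigma> \<delta>] gap v by auto
  have fl: "level (flip vs v) = - a" using height_hit_point[of v vs] v by (simp add: height_minus)
  \<comment> \<open>Reversal negates levels, so the gap of the reversed chord lies on the side
    \<open>- \<sigma>\<close>.\<close>
  have "\<exists>k. runs k (flip vs v) \<and> hit_point vs ((billiard_map vs ^^ k) (flip vs v)) \<in> set vs"
  proof (rule gap_endpoint_hits_corner[OF invariant_set_flip[OF K] _ _ \<delta>, of _ "- \<sigma>"])
    fix t assume t: "0 < t" "t < \<delta>"
    have e: "level (flip vs v) + - \<sigma> * t = - (a + \<sigma> * t)" using fl by simp
    have g: "a + \<sigma> * t \<in> heights \<theta>" "pt \<theta> (a + \<sigma> * t) \<notin> limit_set" using gap[OF t] by auto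
    have "pt (- \<theta>) (- (a + \<sigma> * t)) \<notin> flip vs ` limit_set"
    proof
      assume "pt (- \<theta>) (- (a + \<sigma> * t)) \<in> flip vs ` limit_set"
      then obtain w where w: "w \<in> limit_set" "flip vs (pt \<theta> (a + \<sigma> * t)) = flip vs w"
        using flip_pt[OF th g(1)] by auto
      have "w \<in> phase_space vs" using w(1) by (simp add: limit_set_def)
      then have "pt \<theta> (a + \<sigma> * t) = w"
        using flip_flip[of w] flip_flip[of "pt \<theta> (a + \<sigma> * t)"] w(2) pt_props[OF th g(1)] by metis
      then show False using w g by simp
    qed
    then show "level (flip vs v) + - \<sigma> * t \<in> heights (snd (flip vs v)) \<and>
        pt (snd (flip vs v)) (level (flip vs v) + - \<sigma> * t) \<notin> flip vs ` limit_set"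
      unfolding e using g heights_minus[of "a + \<sigma> * t" \<theta>] v(2) by simp
  qed (use vK \<sigma> in auto)
  then obtain j where j: "runs j (flip vs v)" "hit_point vs ((billiard_map vs ^^ j) (flip vs v)) \<in> set vs" by blast
  \<comment> \<open>The past trajectory turned around at its corner: \<open>w\<close> starts there,
    passes through \<open>v\<close> after \<open>j\<close> steps and meets a corner after
    \<open>k\<close> more.\<close>
  define w where "w = flip vs ((billiard_map vs ^^ j) (flip vs v))"
  have w: "runs j w" "(billiard_map vs ^^ j) w = v"
    using runs_flip[OF j(1)] flip_flip[OF v(1)] by (auto simp: w_def)
  have jk: "runs (j + k) w" using w k by (simp add: runs_add)
  have hjk: "hit_point vs ((billiard_map vs ^^ (j + k)) w) \<in> set vs"
    using k(2) w(2) by (simp add: funpow_add add.commute[of j])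
  have "generalized_diagonal vs w"
    unfolding generalized_diagonal_def
    using jk hjk j(2) by (auto simp: w_def runs_def)
  \<comment> \<open>The orbit of \<open>u0\<close> and the diagonal both take the direction
    \<open>\<theta>\<close> at some time, so their initial directions differ by a group
    element.\<close>
  moreover have "\<exists>h\<in>reflection_group vs. snd u0 = h (snd w)"
  proof -
    obtain g where g: "g \<in> reflection_group vs" "\<theta> = g (snd w)"
      using snd_billiard_funpow[OF w(1)] w(2) v(2) by auto
    obtain n where "snd (orb n) = \<theta>" using limit_setD[OF u, of 1] by (metis \<theta>_def zero_less_one)
    then obtain h where h: "h \<in> reflection_group vs" "\<theta> = h (snd u0)"
      using snd_billiard_funpow[OF runs_u0, of n] by (auto simp: orb_def)
    obtain h' where h': "h' \<in> reflection_group vs" "\<And>z. h' (h z) = z" using reflection_group_sym[OF h(1)] by blast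
    show ?thesis using reflection_group_comp[OF h'(1) g(1)] h' h g by (intro bexI[of _ "h' \<circ> g"]) auto
  qed
  ultimately show False
    using nonexceptional unfolding exceptional_point_def exceptional_direction_def by blast
qed

lemma limit_set_direction: "u \<in> limit_set \<Longrightarrow> v \<in> phase_space vs \<Longrightarrow> snd v = snd u \<Longrightarrow> v \<in> limit_set"
  using limit_set_saturated[of u "level v"] pt_level[of v] level_in_heights[of v] by simp

text \<open>The feet come arbitrarily close to \<open>z\<close> arbitrarily late, and among finitely
  many directions one recurs. Whether a direction points inwards is the same all along the side, so
  this direction is admissible at \<open>z\<close> itself.\<close>

lemma limit_set_over_side:
  assumes i: "i < 3" "z \<in> side vs i" "z \<notin> set vs"
  obtains \<theta> where "(z, \<theta>) \<in> limit_set"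
proof -
  have zb: "z \<in> boundary vs" using i length_3 by (auto simp: boundary_eq)
  have near: "\<exists>n\<ge>N. dist (foot vs u0 n) z < e" if e: "e > 0" for e N
  proof -
    have "infinite (ball z e \<inter> side vs i)"
    proof -
      obtain d where d: "d > 0" "\<And>t. \<bar>t\<bar> < d \<Longrightarrow> z + t *\<^sub>R side_vector vs i \<in> side vs i"
        using noncorner_side_interior i length_3 by metis
      let ?w = "side_vector vs i"
      have w: "?w \<noteq> 0" using side_vector_nz i length_3 by simp
      define m where "m = min d (e / norm ?w)"
      have m: "m > 0" using d e w by (simp add: m_def)
      have "(\<lambda>t. z + t *\<^sub>R ?w) ` {0<..<m} \<subseteq> ball z e \<inter> side vs i"
        using d w by (auto simp: m_def dist_norm field_simps)
      moreover have "infinite ((\<lambda>t. z + t *\<^sub>R ?w) ` {0<..<m})"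
        using m w by (subst finite_image_iff) (auto simp: inj_on_def infinite_Ioo)
      ultimately show ?thesis using finite_subset by blast
    qed
    moreover have "finite (foot vs u0 ` {..<N})" by simp
    ultimately have "infinite ((ball z e \<inter> side vs i) - foot vs u0 ` {..<N})" using Diff_infinite_finite by blast
    then obtain z' where z': "z' \<in> ball z e" "z' \<in> side vs i" "z' \<notin> foot vs u0 ` {..<N}"
      by (metis Diff_iff IntE ex_in_conv finite.emptyI)
    have "open (ball z e - foot vs u0 ` {..<N})" by (intro open_Diff finite_imp_closed) auto
    moreover have "z' \<in> boundary vs" using z' i length_3 by (auto simp: boundary_eq)
    then have "z' \<in> closure (range (foot vs u0))" using dense by blast
    ultimately have "(ball z e - foot vs u0 ` {..<N}) \<inter> range (foot vs u0) \<noteq> {}"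
      using z' open_Int_closure_eq_empty by blast
    then obtain n where "foot vs u0 n \<in> ball z e" "foot vs u0 n \<notin> foot vs u0 ` {..<N}" by blast
    then show ?thesis by (intro exI[of _ n]) (auto simp: dist_commute not_less[symmetric])
  qed
  have "\<exists>\<theta>. \<forall>e>0. \<forall>N. \<exists>n\<ge>N. dist (foot vs u0 n) z < e \<and> snd (orb n) = \<theta>"
  proof (rule ccontr)
    assume "\<not> ?thesis"
    then have "\<forall>\<theta>. \<exists>e N. e > 0 \<and> (\<forall>n\<ge>N. dist (foot vs u0 n) z < e \<longrightarrow> snd (orb n) \<noteq> \<theta>)" by blast
    then obtain E M where EM: "\<And>\<theta>. E \<theta> > 0" "\<And>\<theta> n. n \<ge> M \<theta> \<Longrightarrow> dist (foot vs u0 n) z < E \<theta> \<Longrightarrow> snd (orb n) \<noteq> \<theta>"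
      by metis
    let ?D = "range (snd \<circ> orb)"
    have "finite (E ` ?D)" "finite (M ` ?D)" using finite_snd_orb by auto
    moreover have "E ` ?D \<noteq> {}" by auto
    ultimately have "Min (E ` ?D) > 0" using EM(1) by (subst Min_gr_iff) auto
    then obtain n where n: "n \<ge> Max (M ` ?D)" "dist (foot vs u0 n) z < Min (E ` ?D)"
      using near by blast
    have "Min (E ` ?D) \<le> E (snd (orb n))" using \<open>finite (E ` ?D)\<close> by (intro Min_le) auto
    moreover have "M (snd (orb n)) \<le> Max (M ` ?D)" using \<open>finite (M ` ?D)\<close> by (intro Max_ge) auto
    ultimately show False using EM(2)[of "snd (orb n)" n] n by (metis order_trans less_le_trans)
  qed
  then obtain \<theta> where th: "\<And>e N. e > 0 \<Longrightarrow> \<exists>n\<ge>N. dist (foot vs u0 n) z < e \<and> snd (orb n) = \<theta>" by blast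
  obtain e0 where e0: "e0 > 0" "\<And>y. y \<in> boundary vs \<Longrightarrow> dist y z < e0 \<Longrightarrow> y \<in> side vs i \<and> y \<notin> set vs"
    using side_noncorner_nbhd i length_3 by metis
  obtain n where n: "dist (foot vs u0 n) z < e0" "snd (orb n) = \<theta>" using th[OF e0(1)] by blast
  have nth: "norm \<theta> = 1" using norm_snd_orb n(2) by metis
  have fb: "foot vs u0 n \<in> boundary vs" for n using orb_phase_space phase_spaceD fst_orb by metis
  have "(foot vs u0 n, \<theta>) = orb n" using n(2) fst_orb by (metis prod.collapse)
  then have "(foot vs u0 n, \<theta>) \<in> phase_space vs" using orb_phase_space by simp
  then have "0 < slope i \<theta>" using phase_space_side_iff[OF i(1) _ _ nth] e0(2)[OF fb n(1)] by blast
  then have zp: "(z, \<theta>) \<in> phase_space vs" using phase_space_side_iff[OF i nth] by blast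
  have "\<exists>n\<ge>N. snd (orb n) = \<theta> \<and> \<bar>level (orb n) - height \<theta> z\<bar> < e" if e: "e > 0" for e N
  proof -
    obtain n where n: "n \<ge> N" "dist (foot vs u0 n) z < e" "snd (orb n) = \<theta>" using th[OF e] by blast
    have "level (orb n) - height \<theta> z = height \<theta> (foot vs u0 n - z)"
      using n(3) by (simp add: height_diff fst_orb)
    also have "\<bar>\<dots>\<bar> \<le> norm (cnj \<theta> * (foot vs u0 n - z))" unfolding height_def by (rule abs_Im_le_cmod)
    also have "\<dots> = dist (foot vs u0 n) z" using nth by (simp add: norm_mult dist_norm)
    finally show ?thesis using n by (intro exI[of _ n]) auto
  qed
  then have "(z, \<theta>) \<in> limit_set" using zp by (simp add: limit_set_def)
  then show thesis by (rule that)
qed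

end

section \<open>Unfolding and long chords\<close>

text \<open>Both trajectories meet the same mirrors, \<open>\<rho> k\<close> being the multiplier of
  the linear part of the reflection; the last hypothesis expresses that both hit points lie on one
  mirror line. Undoing the reflections one by one leaves two straight displacements along
  \<open>w 0\<close> and \<open>w' 0\<close>.\<close>

lemma unfolding_distance:
  fixes y y' w w' :: "nat \<Rightarrow> complex"
  assumes "\<And>k. k < n \<Longrightarrow> y (Suc k) = y k + \<tau> k *\<^sub>R w k" "\<And>k. k < n \<Longrightarrow> y' (Suc k) = y' k + \<tau>' k *\<^sub>R w' k"
    and "\<And>k. k < n \<Longrightarrow> w (Suc k) = \<rho> k * cnj (w k)" "\<And>k. k < n \<Longrightarrow> w' (Suc k) = \<rho> k * cnj (w' k)"
    and "\<And>k. k < n \<Longrightarrow> cmod (\<rho> k) = 1"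
    and "\<And>k. k < n \<Longrightarrow> \<rho> k * cnj (y (Suc k) - y' (Suc k)) = y (Suc k) - y' (Suc k)"
  shows "cmod (y n - y' n) =
    cmod (y 0 - y' 0 + ((\<Sum>k<n. \<tau> k) *\<^sub>R w 0 - (\<Sum>k<n. \<tau>' k) *\<^sub>R w' 0))"
  using assms
proof (induction n arbitrary: y y' w w' \<tau> \<tau>' \<rho>)
  case (Suc n)
  define S S' where "S = (\<Sum>k<n. \<tau> (Suc k))" and "S' = (\<Sum>k<n. \<tau>' (Suc k))"
  have "cmod (y (Suc n) - y' (Suc n)) = cmod (y 1 - y' 1 + (S *\<^sub>R w 1 - S' *\<^sub>R w' 1))"
    unfolding S_def S'_def One_nat_def
    by (rule Suc.IH[of "\<lambda>k. y (Suc k)" "\<lambda>k. \<tau> (Suc k)" "\<lambda>k. w (Suc k)" "\<lambda>k. y' (Suc k)"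
        "\<lambda>k. \<tau>' (Suc k)" "\<lambda>k. w' (Suc k)" "\<lambda>k. \<rho> (Suc k)"]; rule Suc.prems; simp)
  also have "y 1 - y' 1 + (S *\<^sub>R w 1 - S' *\<^sub>R w' 1) =
      \<rho> 0 * cnj (y 1 - y' 1) + (S *\<^sub>R (\<rho> 0 * cnj (w 0)) - S' *\<^sub>R (\<rho> 0 * cnj (w' 0)))"
    using Suc.prems(3,4,6)[of 0] by simp
  also have "\<dots> = \<rho> 0 * cnj (y 1 - y' 1 + (S *\<^sub>R w 0 - S' *\<^sub>R w' 0))"
    by (simp add: algebra_simps)
  also have "cmod \<dots> = cmod (y 1 - y' 1 + (S *\<^sub>R w 0 - S' *\<^sub>R w' 0))"
    unfolding norm_mult complex_mod_cnj using Suc.prems(5)[of 0] by simp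
  also have "y 1 - y' 1 + (S *\<^sub>R w 0 - S' *\<^sub>R w' 0) =
      y 0 - y' 0 + ((\<tau> 0 + S) *\<^sub>R w 0 - (\<tau>' 0 + S') *\<^sub>R w' 0)"
    using Suc.prems(1,2)[of 0] by (simp add: algebra_simps)
  finally show ?case
    unfolding S_def S'_def by (simp only: sum.lessThan_Suc_shift)
qed simp

text \<open>For unit vectors, \<open>|S w - S' w'|^2 = (S - S')^2 + S S' |w - w'|^2\<close>: a
  difference in the total lengths of two unfolded trajectories only adds to their distance.\<close>

lemma norm_scaled_unit_diff:
  fixes w w' :: complex
  assumes w: "norm w = 1" "norm w' = 1" and L: "0 \<le> L" "L \<le> S" "L \<le> S'"
  shows "L * norm (w - w') \<le> norm (S *\<^sub>R w - S' *\<^sub>R w')"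
proof (rule power2_le_imp_le)
  have i: "inner w w = 1" "inner w' w' = 1" using w by (simp_all add: norm_eq_1)
  have "(norm (S *\<^sub>R w - S' *\<^sub>R w'))\<^sup>2 = S\<^sup>2 + S'\<^sup>2 - 2 * (S * S') * inner w w'"
    unfolding power2_norm_eq_inner using i
    by (simp add: inner_diff_left inner_diff_right inner_commute power2_eq_square)
  also have "\<dots> = (S - S')\<^sup>2 + S * S' * (2 - 2 * inner w w')"
    by (simp add: power2_eq_square algebra_simps)
  finally have 1: "(norm (S *\<^sub>R w - S' *\<^sub>R w'))\<^sup>2 = (S - S')\<^sup>2 + S * S' * (2 - 2 * inner w w')" .
  have 2: "(norm (w - w'))\<^sup>2 = 2 - 2 * inner w w'"
    unfolding power2_norm_eq_inner using i by (simp add: inner_diff_left inner_diff_right inner_commute)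
  have "L * L \<le> S * S'" using L by (intro mult_mono) auto
  then have "L * L * (norm (w - w'))\<^sup>2 \<le> S * S' * (norm (w - w'))\<^sup>2" by (intro mult_right_mono) auto
  then show "(L * norm (w - w'))\<^sup>2 \<le> (norm (S *\<^sub>R w - S' *\<^sub>R w'))\<^sup>2"
    unfolding 1 2[symmetric] power_mult_distrib power2_eq_square[of L]
    using zero_le_power2[of "S - S'"] by linarith
qed simp

text \<open>The arc length coordinate \<open>f\<close> is injective on the segment, and the image of
  each connected set contains the interval between the coordinates of \<open>x p\<close> and
  \<open>y p\<close>. These intervals are disjoint, so their lengths add up to at most that of the
  segment.\<close>

lemma disjoint_subsets_of_segment:
  fixes A B :: complex
  assumes fin: "finite I" and conn: "\<And>p. p \<in> I \<Longrightarrow> connected (S p)"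
    and sub: "\<And>p. p \<in> I \<Longrightarrow> S p \<subseteq> closed_segment A B"
    and disj: "\<And>p q. p \<in> I \<Longrightarrow> q \<in> I \<Longrightarrow> p \<noteq> q \<Longrightarrow> S p \<inter> S q = {}"
    and xy: "\<And>p. p \<in> I \<Longrightarrow> x p \<in> S p" "\<And>p. p \<in> I \<Longrightarrow> y p \<in> S p"
  shows "(\<Sum>p\<in>I. dist (x p) (y p)) \<le> dist A B"
proof (cases "A = B")
  case True
  then have "x p = y p" if "p \<in> I" for p using sub[OF that] xy[OF that] by auto
  then show ?thesis by simp
next
  case False
  define l where "l = dist A B"
  have l: "l > 0" using False by (simp add: l_def)
  define f where "f z = inner (B - A) (z - A) / l" for z
  have onseg: "f z \<in> {0..l} \<and> z = A + (f z / l) *\<^sub>R (B - A)" if zs: "z \<in> closed_segment A B" for z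
  proof -
    obtain t where t: "0 \<le> t" "t \<le> 1" and z: "z = (1 - t) *\<^sub>R A + t *\<^sub>R B"
      using zs by (auto simp: in_segment)
    have zA: "z - A = t *\<^sub>R (B - A)" unfolding z by (simp add: algebra_simps)
    have "f z = t * l" unfolding f_def zA using l
      by (simp add: l_def dist_norm norm_minus_commute power2_norm_eq_inner[symmetric] power2_eq_square)
    then show ?thesis using t l zA by (simp add: algebra_simps)
  qed
  have fdist: "dist z z' = \<bar>f z - f z'\<bar>" if "z \<in> closed_segment A B" "z' \<in> closed_segment A B" for z z'
  proof -
    have "z - z' = ((f z - f z') / l) *\<^sub>R (B - A)"
      using onseg[OF that(1)] onseg[OF that(2)] by (metis add_diff_cancel_left diff_divide_distrib scaleR_left_diff_distrib)
    then have "dist z z' = \<bar>(f z - f z') / l\<bar> * l" by (simp add: dist_norm l_def norm_minus_commute)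
    then show ?thesis using l by simp
  qed
  define J where "J p = {min (f (x p)) (f (y p))..max (f (x p)) (f (y p))}" for p
  have JS: "J p \<subseteq> f ` S p" if "p \<in> I" for p
  proof -
    have "connected (f ` S p)" unfolding f_def
      using l by (intro connected_continuous_image conn[OF that] continuous_intros) auto
    then show ?thesis unfolding J_def using xy[OF that]
      by (auto simp: min_def max_def connected_contains_Icc split: if_splits
          intro: connected_contains_Icc[THEN subsetD])
  qed
  have fS: "f ` S p \<subseteq> {0..l}" if "p \<in> I" for p using sub[OF that] onseg by blast
  have "disjoint_family_on J I"
    unfolding disjoint_family_on_def
  proof (intro ballI impI)
    fix p q assume pq: "p \<in> I" "q \<in> I" "p \<noteq> q"
    have "inj_on f (closed_segment A B)" using fdist by (auto simp: inj_on_def) (metis abs_zero diff_self dist_eq_0_iff)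
    then have "f ` S p \<inter> f ` S q = {}" using disj[OF pq] sub pq by (metis image_empty inj_on_image_Int)
    then show "J p \<inter> J q = {}" using JS[OF pq(1)] JS[OF pq(2)] by (metis Int_mono subset_empty)
  qed
  moreover have Jm: "J p \<in> sets lborel" "emeasure lborel (J p) \<noteq> \<infinity>" for p by (simp_all add: J_def)
  ultimately have "measure lborel (\<Union>p\<in>I. J p) = (\<Sum>p\<in>I. measure lborel (J p))"
    by (intro measure_finite_Union fin) auto
  also have "\<dots> = (\<Sum>p\<in>I. dist (x p) (y p))"
  proof (rule sum.cong[OF refl])
    fix p assume p: "p \<in> I"
    have "dist (x p) (y p) = \<bar>f (x p) - f (y p)\<bar>"
      by (rule fdist) (use sub[OF p] xy[OF p] in auto)
    then show "measure lborel (J p) = dist (x p) (y p)" by (simp add: J_def min_def max_def)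
  qed
  finally have "(\<Sum>p\<in>I. dist (x p) (y p)) = measure lborel (\<Union>p\<in>I. J p)" ..
  also have "\<dots> \<le> measure lborel {0..l}"
  proof (rule measure_mono_fmeasurable)
    show "(\<Union>p\<in>I. J p) \<subseteq> {0..l}" using JS fS by (meson UN_least order_trans)
    show "(\<Union>p\<in>I. J p) \<in> sets lborel" using fin by (intro sets.finite_UN) (auto simp: J_def)
    show "{0..l} \<in> fmeasurable lborel" by (auto simp: fmeasurable_def emeasure_lborel_Icc_eq)
  qed
  also have "\<dots> = dist A B" using l by (simp add: l_def)
  finally show ?thesis .
qed

text \<open>Cutting at the points of \<open>X\<close> and shrinking each piece a little loses
  arbitrarily little, by continuity. The loss \<open>\<epsilon>\<close> does not depend on the size
  of \<open>X\<close>, which will grow with the number of iterates.\<close>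

lemma variation_off_finite_set:
  fixes G :: "real \<Rightarrow> complex"
  assumes "finite X" "s < s'" "continuous_on {s..s'} G" "0 < \<epsilon>"
  shows "\<exists>I. finite I \<and> (\<forall>p\<in>I. s < fst p \<and> fst p \<le> snd p \<and> snd p < s' \<and> {fst p..snd p} \<inter> X = {}) \<and>
    (\<forall>p\<in>I. \<forall>q\<in>I. p \<noteq> q \<longrightarrow> {fst p..snd p} \<inter> {fst q..snd q} = {}) \<and>
    dist (G s) (G s') \<le> (\<Sum>p\<in>I. dist (G (fst p)) (G (snd p))) + \<epsilon>"
  using assms
proof (induction X arbitrary: s s' \<epsilon>)
  case empty
  obtain d1 where d1: "d1 > 0" "\<And>x. x \<in> {s..s'} \<Longrightarrow> dist x s < d1 \<Longrightarrow> dist (G x) (G s) < \<epsilon> / 2"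
    using empty(2)[unfolded continuous_on_iff, rule_format, of s "\<epsilon> / 2"] empty by auto
  obtain d2 where d2: "d2 > 0" "\<And>x. x \<in> {s..s'} \<Longrightarrow> dist x s' < d2 \<Longrightarrow> dist (G x) (G s') < \<epsilon> / 2"
    using empty(2)[unfolded continuous_on_iff, rule_format, of s' "\<epsilon> / 2"] empty by auto
  define d where "d = min (min d1 d2) (s' - s) / 2"
  have d: "d > 0" "d < d1" "d < d2" "d \<le> (s' - s) / 2" using d1 d2 empty by (auto simp: d_def)
  let ?a = "s + d" and ?b = "s' - d"
  have ab: "s < ?a" "?a \<le> ?b" "?b < s'" using d by auto
  have "dist (G ?a) (G s) < \<epsilon> / 2" using d ab by (intro d1) (auto simp: dist_real_def)
  moreover have "dist (G ?b) (G s') < \<epsilon> / 2" using d ab by (intro d2) (auto simp: dist_real_def)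
  moreover have "dist (G s) (G s') \<le> dist (G ?a) (G s) + dist (G ?a) (G ?b) + dist (G ?b) (G s')"
    using dist_triangle[of "G s" "G s'" "G ?a"] dist_triangle[of "G ?a" "G s'" "G ?b"]
      dist_commute[of "G s" "G ?a"] by linarith
  ultimately show ?case using ab by (intro exI[of _ "{(?a, ?b)}"]) auto
next
  case (insert x X)
  show ?case
  proof (cases "s < x \<and> x < s'")
    case False
    obtain I where I: "finite I" "\<forall>p\<in>I. s < fst p \<and> fst p \<le> snd p \<and> snd p < s' \<and> {fst p..snd p} \<inter> X = {}"
      "\<forall>p\<in>I. \<forall>q\<in>I. p \<noteq> q \<longrightarrow> {fst p..snd p} \<inter> {fst q..snd q} = {}"
      "dist (G s) (G s') \<le> (\<Sum>p\<in>I. dist (G (fst p)) (G (snd p))) + \<epsilon>"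
      using insert.IH[OF insert.prems] by blast
    have "\<forall>p\<in>I. s < fst p \<and> fst p \<le> snd p \<and> snd p < s' \<and> {fst p..snd p} \<inter> insert x X = {}"
      using I(2) False by force
    then show ?thesis using I(1,3,4) by blast
  next
    case True
    have c: "continuous_on {s..x} G" "continuous_on {x..s'} G"
      using insert.prems(2) True by (auto elim: continuous_on_subset)
    have e: "0 < \<epsilon> / 2" using insert.prems by simp
    obtain I where I: "finite I" "\<forall>p\<in>I. s < fst p \<and> fst p \<le> snd p \<and> snd p < x \<and> {fst p..snd p} \<inter> X = {}"
      "\<forall>p\<in>I. \<forall>q\<in>I. p \<noteq> q \<longrightarrow> {fst p..snd p} \<inter> {fst q..snd q} = {}"
      "dist (G s) (G x) \<le> (\<Sum>p\<in>I. dist (G (fst p)) (G (snd p))) + \<epsilon> / 2"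
      using insert.IH[OF conjunct1[OF True] c(1) e] by blast
    obtain I' where I': "finite I'" "\<forall>p\<in>I'. x < fst p \<and> fst p \<le> snd p \<and> snd p < s' \<and> {fst p..snd p} \<inter> X = {}"
      "\<forall>p\<in>I'. \<forall>q\<in>I'. p \<noteq> q \<longrightarrow> {fst p..snd p} \<inter> {fst q..snd q} = {}"
      "dist (G x) (G s') \<le> (\<Sum>p\<in>I'. dist (G (fst p)) (G (snd p))) + \<epsilon> / 2"
      using insert.IH[OF conjunct2[OF True] c(2) e] by blast
    have dj: "{fst p..snd p} \<inter> {fst q..snd q} = {}" if "p \<in> I" "q \<in> I'" for p q
      using bspec[OF I(2) that(1)] bspec[OF I'(2) that(2)] by auto
    have "I \<inter> I' = {}"
    proof -
      have False if "p \<in> I" "p \<in> I'" for p using dj[OF that] bspec[OF I(2) that(1)] by auto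
      then show ?thesis by blast
    qed
    then have "(\<Sum>p\<in>I \<union> I'. dist (G (fst p)) (G (snd p))) =
        (\<Sum>p\<in>I. dist (G (fst p)) (G (snd p))) + (\<Sum>p\<in>I'. dist (G (fst p)) (G (snd p)))"
      by (rule sum.union_disjoint[OF I(1) I'(1)])
    then have "dist (G s) (G s') \<le> (\<Sum>p\<in>I \<union> I'. dist (G (fst p)) (G (snd p))) + \<epsilon>"
      using I(4) I'(4) dist_triangle[of "G s" "G s'" "G x"] by linarith
    moreover have "\<forall>p\<in>I \<union> I'. s < fst p \<and> fst p \<le> snd p \<and> snd p < s' \<and> {fst p..snd p} \<inter> insert x X = {}"
    proof
      fix p assume "p \<in> I \<union> I'"
      then consider "p \<in> I" | "p \<in> I'" by blast
      then show "s < fst p \<and> fst p \<le> snd p \<and> snd p < s' \<and> {fst p..snd p} \<inter> insert x X = {}"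
        using I(2) I'(2) True by cases force+
    qed
    moreover have "\<forall>p\<in>I \<union> I'. \<forall>q\<in>I \<union> I'. p \<noteq> q \<longrightarrow> {fst p..snd p} \<inter> {fst q..snd q} = {}"
      using I(3) I'(3) dj by (metis Int_commute Un_iff)
    ultimately show ?thesis using I(1) I'(1) by blast
  qed
qed

section \<open>A chord of definite length in every time window\<close>

context triangle
begin

lemma side_reflection_rotation:
  "side_reflection vs i (side_reflection vs j z) =
    (side_vector vs i / cnj (side_vector vs i)) / (side_vector vs j / cnj (side_vector vs j)) * z"
  by (simp add: side_reflection_def Let_def)

lemma side_vectors_not_parallel:
  assumes "i < 3" "j < 3" "i \<noteq> j"
  shows "side_vector vs i / cnj (side_vector vs i) \<noteq> side_vector vs j / cnj (side_vector vs j)"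
proof
  assume e: "side_vector vs i / cnj (side_vector vs i) = side_vector vs j / cnj (side_vector vs j)"
  have "side_vector vs i \<noteq> 0" "side_vector vs j \<noteq> 0" using side_vector_nz assms length_3 by auto
  then have "cnj (cnj (side_vector vs i) * side_vector vs j) = cnj (side_vector vs i) * side_vector vs j"
    using e by (simp add: field_simps)
  then have "Im (cnj (side_vector vs i) * side_vector vs j) = 0"
    by (metis cnj.simps(2) neg_equal_zero)
  moreover define cr where "cr k l = Im (cnj (side_vector vs k) * side_vector vs l)" for k l
  have "area = cr 0 (Suc 0)" "area = cr (Suc 0) 2" "area = cr 2 0"
    "area = - cr (Suc 0) 0" "area = - cr 2 (Suc 0)" "area = - cr 0 2"
    unfolding cr_def area_def side_vector_eq by (simp_all add: algebra_simps)
  ultimately show False using area_nz assms unfolding cr_def[symmetric] by (auto simp: less_3_cases)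
qed

lemma elev_sum: "elev 0 z + elev (Suc 0) z + elev 2 z = \<bar>area\<bar>"
proof -
  obtain a b c where abc: "a + b + c = 1" "z = a *\<^sub>R vs ! 0 + b *\<^sub>R vs ! Suc 0 + c *\<^sub>R vs ! 2"
    by (rule barycentric_exists)
  have "c * \<bar>area\<bar> + a * \<bar>area\<bar> + b * \<bar>area\<bar> = (a + b + c) * \<bar>area\<bar>" by (simp add: algebra_simps)
  then show ?thesis unfolding elev_barycentric[OF abc] abc(1) by simp
qed

text \<open>The elevations sum to \<open>\<bar>area\<bar>\<close>, so no point is close to all three
  sides. On side 0 the first elevation is zero and the other two are Lipschitz with the side lengths
  as constants, which gives \<open>\<delta>\<close>.\<close>

lemma sides_apart: "\<exists>\<delta>>0. \<forall>a\<in>side vs 0. \<forall>b\<in>side vs (Suc 0). \<forall>c\<in>side vs 2. \<delta> \<le> dist a b \<or> \<delta> \<le> dist a c"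
proof -
  define M where "M = cmod (side_vector vs (Suc 0)) + cmod (side_vector vs 2)"
  have M: "M > 0" unfolding M_def using side_vector_nz[of 2] length_3 by (simp add: add_nonneg_pos)
  define \<delta> where "\<delta> = \<bar>area\<bar> / M"
  have "\<delta> > 0" using M area_nz by (simp add: \<delta>_def)
  have lip: "\<bar>elev i a - elev i b\<bar> \<le> cmod (side_vector vs i) * dist a b" for i a b
  proof -
    have "elev i a - elev i b = slope i (a - b)" by (simp add: elev_def slope_diff)
    moreover have "\<bar>slope i (a - b)\<bar> \<le> cmod (cnj (side_vector vs i) * (a - b))"
      unfolding slope_def abs_mult using abs_Im_le_cmod[of "cnj (side_vector vs i) * (a - b)"] by (simp add: abs_sgn_eq)
    ultimately show ?thesis by (simp add: norm_mult dist_norm)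
  qed
  have "\<delta> \<le> dist a b \<or> \<delta> \<le> dist a c" if abc: "a \<in> side vs 0" "b \<in> side vs (Suc 0)" "c \<in> side vs 2" for a b c
  proof (rule ccontr)
    assume "\<not> ?thesis"
    then have lt: "dist a b < \<delta>" "dist a c < \<delta>" by auto
    have "elev 0 a = 0" "elev (Suc 0) b = 0" "elev 2 c = 0" using elev_side abc by auto
    then have "\<bar>area\<bar> \<le> cmod (side_vector vs (Suc 0)) * dist a b + cmod (side_vector vs 2) * dist a c"
      using elev_sum[of a] lip[of "Suc 0" a b] lip[of 2 a c] by linarith
    also have "\<dots> < cmod (side_vector vs (Suc 0)) * \<delta> + cmod (side_vector vs 2) * \<delta>"
      using lt side_vector_nz[of 2] side_vector_nz[of "Suc 0"] length_3
      by (intro add_strict_mono mult_strict_left_mono) auto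
    also have "\<dots> = M * \<delta>" by (simp only: M_def distrib_right)
    also have "\<dots> = \<bar>area\<bar>" using M by (simp add: \<delta>_def)
    finally show False by simp
  qed
  then show ?thesis using \<open>\<delta> > 0\<close> by blast
qed

end

context triangle
begin

lemma hit_other_side:
  assumes u: "u \<in> phase_space vs" and i: "i < 3" "fst u \<in> side vs i" "fst u \<notin> set vs"
  shows "hit_point vs u \<notin> side vs i"
proof
  assume h: "hit_point vs u \<in> side vs i"
  have "(fst u, snd u) \<in> phase_space vs" using u by simp
  then have "0 < slope i (snd u)" using phase_space_side_iff[OF i] phase_spaceD[OF u] by blast
  then have "0 < elev i (hit_point vs u)"
    using elev_side[OF i(2)] hit_time_pos[OF u] by (simp add: hit_point_def elev_line)
  then show False using elev_side[OF h] by simp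
qed

lemma linear_slope: "linear (slope i)"
  by (intro linearI) (simp_all add: slope_add)

text \<open>An orbit avoiding side \<open>i\<close> alternates between the other two, so every second step rotates its
  direction by a fixed nontrivial root of unity. These directions sum to zero over a period, but
  all of them point away from one side.\<close>

lemma window_hits_all_sides:
  assumes rat: "rational_polygon vs"
  obtains B where "B > 0"
    "\<And>u i. runs B u \<Longrightarrow> i < 3 \<Longrightarrow> \<exists>k<B. hit_point vs ((billiard_map vs ^^ k) u) \<in> side vs i"
proof -
  obtain m where m: "m > 0" "\<And>i j. i < 3 \<Longrightarrow> j < 3 \<Longrightarrow>
    ((side_vector vs i / cnj (side_vector vs i)) / (side_vector vs j / cnj (side_vector vs j))) ^ m = 1"
    by (rule side_ratios_roots_of_unity[OF rat]) blast
  \<comment> \<open>Each rotation takes two reflections, so \<open>m\<close> rotations fill a window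
    of length \<open>2 * m\<close>.\<close>
  have "\<exists>k<2 * m. hit_point vs ((billiard_map vs ^^ k) u) \<in> side vs i" if r: "runs (2 * m) u" and i: "i < 3" for u i
  proof (rule ccontr)
    assume neg: "\<not> ?thesis"
    define x where "x k = hit_point vs ((billiard_map vs ^^ k) u)" for k
    define \<theta> where "\<theta> k = snd ((billiard_map vs ^^ k) u)" for k
    have ps: "(billiard_map vs ^^ k) u \<in> phase_space vs" if "k < 2 * m" for k
      using runs_in_phase_space runs_mono[OF r, of k] that by simp
    have nc: "x k \<notin> set vs" if "k < 2 * m" for k using r that by (simp add: runs_def x_def)
    have "\<exists>a. k < 2 * m \<longrightarrow> a < 3 \<and> x k \<in> side vs a \<and> \<theta> (Suc k) = side_reflection vs a (\<theta> k)" for k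
      using billiard_map_noncorner[OF ps[of k]] nc[of k] unfolding x_def \<theta>_def length_3
      by (metis funpow.simps(2) comp_apply snd_conv)
    then obtain a where a: "\<And>k. k < 2 * m \<Longrightarrow> a k < 3" "\<And>k. k < 2 * m \<Longrightarrow> x k \<in> side vs (a k)"
      "\<And>k. k < 2 * m \<Longrightarrow> \<theta> (Suc k) = side_reflection vs (a k) (\<theta> k)" by metis
    have ai: "a k \<noteq> i" if "k < 2 * m" for k using neg a(2)[OF that] that by (auto simp: x_def)
    have aS: "a (Suc k) \<noteq> a k" if "Suc k < 2 * m" for k
    proof
      assume e: "a (Suc k) = a k"
      have "fst ((billiard_map vs ^^ Suc k) u) = x k" by (simp add: x_def)
      then have "x (Suc k) \<notin> side vs (a k)"
        using hit_other_side[OF ps[OF that], of "a k"] a(1,2)[of k] nc[of k] that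
        unfolding x_def by auto
      then show False using a(2)[OF that] e by simp
    qed
    have a2: "a (Suc (Suc k)) = a k" if "Suc (Suc k) < 2 * m" for k
      using ai[of k] ai[of "Suc k"] ai[of "Suc (Suc k)"] aS[of k] aS[of "Suc k"]
        a(1)[of k] a(1)[of "Suc k"] a(1)[of "Suc (Suc k)"] i that by (auto simp: less_3_cases)
    have even: "a (2 * k) = a 0" if "2 * k < 2 * m" for k
      using that by (induction k) (auto simp: a2)
    have odd: "a (Suc (2 * k)) = a (Suc 0)" if "Suc (2 * k) < 2 * m" for k
      using that by (induction k) (auto simp: a2)
    define j l where "j = a 0" and "l = a (Suc 0)"
    define \<rho> where "\<rho> = (side_vector vs j / cnj (side_vector vs j)) / (side_vector vs l / cnj (side_vector vs l))"
    have jl: "j < 3" "l < 3" "j \<noteq> l" using a(1) aS[of 0] m(1) by (auto simp: j_def l_def)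
    have \<rho>1: "\<rho> \<noteq> 1"
      using side_vectors_not_parallel[OF jl] side_vector_nz[of l] jl length_3
      by (auto simp: \<rho>_def eq_divide_eq)
    have rot: "\<theta> (Suc (2 * k)) = \<rho> ^ k * \<theta> (Suc 0)" if "k < m" for k
      using that
    proof (induction k)
      case (Suc k)
      have "\<theta> (Suc (2 * Suc k)) = side_reflection vs j (side_reflection vs l (\<theta> (Suc (2 * k))))"
        using a(3)[of "Suc (2 * k)"] a(3)[of "2 * Suc k"] odd[of k] even[of "Suc k"] Suc.prems
        by (simp add: j_def l_def)
      then show ?case using Suc by (simp add: side_reflection_rotation \<rho>_def)
    qed simp
    \<comment> \<open>At time \<open>Suc (2 * k)\<close> the trajectory has just left side
      \<open>j\<close>, so its slope against \<open>j\<close> is positive.\<close>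
    have pos: "0 < slope j (\<rho> ^ k * \<theta> (Suc 0))" if "k < m" for k
    proof -
      have k: "2 * k < 2 * m" "Suc (2 * k) < 2 * m" using that by auto
      have "x (2 * k) \<in> side vs j" using a(2)[OF k(1)] even[OF k(1)] by (simp add: j_def)
      moreover have "(billiard_map vs ^^ Suc (2 * k)) u = (x (2 * k), \<theta> (Suc (2 * k)))"
        by (simp add: x_def \<theta>_def prod_eq_iff)
      then have "(x (2 * k), \<theta> (Suc (2 * k))) \<in> phase_space vs" using ps[OF k(2)] by simp
      ultimately have "0 < slope j (\<theta> (Suc (2 * k)))"
        using phase_space_side_iff[OF jl(1) _ nc[OF k(1)]] phase_spaceD(2) by fastforce
      then show ?thesis using rot[OF that] by simp
    qed
    have "(\<Sum>k<m. \<rho> ^ k) = 0" using geometric_sum[OF \<rho>1, of m] m(2)[OF jl(1,2)] by (simp add: \<rho>_def)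
    then have "(\<Sum>k<m. \<rho> ^ k * \<theta> (Suc 0)) = 0" by (simp flip: sum_distrib_right)
    then have "(\<Sum>k<m. slope j (\<rho> ^ k * \<theta> (Suc 0))) = 0"
      using linear_sum[OF linear_slope, of j "\<lambda>k. \<rho> ^ k * \<theta> (Suc 0)" "{..<m}"] linear_0[OF linear_slope] by simp
    moreover have "0 < (\<Sum>k<m. slope j (\<rho> ^ k * \<theta> (Suc 0)))"
      using pos m(1) by (intro sum_pos) auto
    ultimately show False by simp
  qed
  then show thesis using m(1) by (intro that[of "2 * m"]) auto
qed

text \<open>A window of \<open>B\<close> steps visits all three sides. If its chords were all
  shorter than \<open>\<delta> / B\<close>, its hit points would be pairwise closer than
  \<open>\<delta>\<close>, against \<open>sides_apart\<close>.\<close>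

lemma long_chord:
  assumes rat: "rational_polygon vs"
  obtains \<eta> B where "\<eta> > 0" "B > 0"
    "\<And>u. runs B u \<Longrightarrow> \<exists>k<B. \<eta> \<le> dist (fst ((billiard_map vs ^^ k) u)) (hit_point vs ((billiard_map vs ^^ k) u))"
proof -
  obtain B where B: "B > 0"
    "\<And>u i. runs B u \<Longrightarrow> i < 3 \<Longrightarrow> \<exists>k<B. hit_point vs ((billiard_map vs ^^ k) u) \<in> side vs i"
    using window_hits_all_sides[OF rat] by metis
  obtain \<delta> where \<delta>: "\<delta> > 0" "\<And>a b c. a \<in> side vs 0 \<Longrightarrow> b \<in> side vs (Suc 0) \<Longrightarrow> c \<in> side vs 2 \<Longrightarrow>
      \<delta> \<le> dist a b \<or> \<delta> \<le> dist a c"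
    using sides_apart by blast
  have "\<exists>k<B. \<delta> / B \<le> dist (fst ((billiard_map vs ^^ k) u)) (hit_point vs ((billiard_map vs ^^ k) u))"
    if r: "runs B u" for u
  proof (rule ccontr)
    assume neg: "\<not> ?thesis"
    define x where "x k = hit_point vs ((billiard_map vs ^^ k) u)" for k
    have short: "dist (x k) (x (Suc k)) < \<delta> / B" if "Suc k < B" for k
      using neg that by (auto simp: x_def not_le)
    have tel: "dist (x k) (x (k + n)) \<le> n * (\<delta> / B)" if "k + n < B" for k n
      using that
    proof (induction n)
      case (Suc n)
      then show ?case using short[of "k + n"] dist_triangle[of "x k" "x (Suc (k + n))" "x (k + n)"]
        by (simp add: distrib_right add_divide_distrib)
    qed simp
    have near: "dist (x k) (x l) < \<delta>" if kl: "k < B" "l < B" for k l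
    proof -
      have *: "dist (x k) (x l) < \<delta>" if "k \<le> l" "l < B" for k l
      proof -
        have "dist (x k) (x l) \<le> (l - k) * (\<delta> / B)" using tel[of k "l - k"] that by simp
        also have "\<dots> < real B * (\<delta> / B)" using that \<delta>(1) B(1) by (intro mult_strict_right_mono) auto
        finally show ?thesis using B(1) by simp
      qed
      show ?thesis using *[of k l] *[of l k] kl by (cases "k \<le> l") (auto simp: dist_commute)
    qed
    obtain k0 k1 k2 where k: "k0 < B" "k1 < B" "k2 < B" "x k0 \<in> side vs 0" "x k1 \<in> side vs (Suc 0)" "x k2 \<in> side vs 2"
      using B(2)[OF r, of 0] B(2)[OF r, of "Suc 0"] B(2)[OF r, of 2] by (auto simp: x_def)
    show False using \<delta>(2)[OF k(4-6)] near[OF k(1,2)] near[OF k(1,3)] by auto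
  qed
  then show thesis using \<delta>(1) B(1) by (intro that[of "\<delta> / B" B]) auto
qed

end

section \<open>Order equivalent orbits have constant directions\<close>

locale order_pair = dense_orbit vs u0 + Q: simple_polygon Q
  for vs :: "complex list" and u0 :: phase_point and Q :: "complex list" +
  fixes v0 :: phase_point and \<phi> \<psi> :: "complex \<Rightarrow> complex"
  assumes orbit_Q: "orbit_defined Q v0"
    and homeo: "homeomorphism (boundary vs) (boundary Q) \<phi> \<psi>"
    and feet: "\<And>n. \<phi> (foot vs u0 n) = foot Q v0 n"
begin

lemma \<phi>_boundary: "z \<in> boundary vs \<Longrightarrow> \<phi> z \<in> boundary Q"
  and \<psi>_boundary: "y \<in> boundary Q \<Longrightarrow> \<psi> y \<in> boundary vs"
  and \<psi>\<phi>: "z \<in> boundary vs \<Longrightarrow> \<psi> (\<phi> z) = z"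
  and \<phi>\<psi>: "y \<in> boundary Q \<Longrightarrow> \<phi> (\<psi> y) = y"
  and continuous_\<phi>: "continuous_on (boundary vs) \<phi>"
  and continuous_\<psi>: "continuous_on (boundary Q) \<psi>"
  using homeo unfolding homeomorphism_def by blast+

lemma \<phi>_inj: "z \<in> boundary vs \<Longrightarrow> z' \<in> boundary vs \<Longrightarrow> \<phi> z = \<phi> z' \<Longrightarrow> z = z'"
  using \<psi>\<phi> by metis

definition orbQ :: "nat \<Rightarrow> phase_point" where
  "orbQ n = (billiard_map Q ^^ n) v0"

lemma orbQ_phase_space: "orbQ n \<in> phase_space Q"
  using orbit_Q Q.runs_in_phase_space[of n v0] by (auto simp: orbit_defined_def Q.runs_def orbQ_def)

lemma orbQ_noncorner: "hit_point Q (orbQ n) \<notin> set Q"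
  using orbit_Q by (auto simp: orbit_defined_def orbQ_def)

lemma fst_orbQ: "fst (orbQ n) = \<phi> (fst (orb n))"
  unfolding fst_orb feet by (simp add: foot_def orbQ_def)

lemma hit_point_orbQ: "hit_point Q (orbQ n) = \<phi> (hit_point vs (orb n))"
proof -
  have "hit_point Q (orbQ n) = fst (orbQ (Suc n))" by (simp add: orbQ_def)
  also have "\<dots> = \<phi> (fst (orb (Suc n)))" by (rule fst_orbQ)
  finally show ?thesis by (simp add: orb_Suc)
qed

text \<open>Defined for every chord of P through the images of its ends. Only at orbit points is it
  known at once to be the direction of a billiard chord of Q
  (\<open>image_direction_orb\<close>).\<close>

definition image_direction :: "phase_point \<Rightarrow> complex" where
  "image_direction u = sgn (\<phi> (hit_point vs u) - \<phi> (fst u))"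

lemma hit_point_neq:
  assumes "u \<in> phase_space vs" shows "\<phi> (hit_point vs u) \<noteq> \<phi> (fst u)"
proof
  assume "\<phi> (hit_point vs u) = \<phi> (fst u)"
  then have "hit_point vs u = fst u"
    using \<phi>_inj hit_point_boundary[OF assms] phase_spaceD[OF assms] by blast
  then show False using hit_time_pos[OF assms] phase_spaceD[OF assms] by (auto simp: hit_point_def)
qed

lemma norm_image_direction: "u \<in> phase_space vs \<Longrightarrow> norm (image_direction u) = 1"
  using hit_point_neq by (simp add: image_direction_def norm_sgn)

lemma image_direction_scale:
  "\<phi> (hit_point vs u) = \<phi> (fst u) + dist (\<phi> (fst u)) (\<phi> (hit_point vs u)) *\<^sub>R image_direction u"
proof -
  have "dist (\<phi> (fst u)) (\<phi> (hit_point vs u)) = norm (\<phi> (hit_point vs u) - \<phi> (fst u))"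
    by (simp only: dist_norm norm_minus_commute)
  then show ?thesis
    by (cases "\<phi> (hit_point vs u) = \<phi> (fst u)") (simp_all add: image_direction_def sgn_div_norm)
qed

lemma image_direction_orb: "image_direction (orb n) = snd (orbQ n)"
proof -
  have "\<phi> (hit_point vs (orb n)) - \<phi> (fst (orb n)) = hit_time Q (orbQ n) *\<^sub>R snd (orbQ n)"
    unfolding hit_point_orbQ[symmetric] fst_orbQ[symmetric] by (simp add: hit_point_def)
  then show ?thesis
    using Q.hit_time_pos[OF orbQ_phase_space[of n]] phase_spaceD(2)[OF orbQ_phase_space[of n]]
    by (simp add: image_direction_def sgn_scaleR sgn_div_norm)
qed

lemma image_direction_orb_Suc:
  assumes "j < length Q" "\<phi> (hit_point vs (orb n)) \<in> side Q j"
  shows "image_direction (orb (Suc n)) = side_reflection Q j (image_direction (orb n))"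
proof -
  have "billiard_map Q (orbQ n) = (hit_point Q (orbQ n), side_reflection Q j (snd (orbQ n)))"
    using Q.billiard_map_eq[OF assms(1)] assms(2) orbQ_noncorner hit_point_orbQ by simp
  then show ?thesis unfolding image_direction_orb by (simp add: orbQ_def)
qed

lemma continuous_on_image_entry:
  "norm \<theta> = 1 \<Longrightarrow> continuous_on (heights \<theta>) (\<lambda>s. \<phi> (fst (pt \<theta> s)))"
  using pt_props phase_spaceD
  by (intro continuous_on_compose2[OF continuous_\<phi> continuous_on_entry]) blast+

lemma continuous_on_image_exit:
  "norm \<theta> = 1 \<Longrightarrow> continuous_on (heights \<theta>) (\<lambda>s. \<phi> (hit_point vs (pt \<theta> s)))"
  using pt_props hit_point_boundary
  by (intro continuous_on_compose2[OF continuous_\<phi> continuous_on_exit]) blast+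

lemma continuous_on_image_direction:
  assumes "norm \<theta> = 1" shows "continuous_on (heights \<theta>) (\<lambda>s. image_direction (pt \<theta> s))"
proof -
  have "\<phi> (hit_point vs (pt \<theta> s)) - \<phi> (fst (pt \<theta> s)) \<noteq> 0" if "s \<in> heights \<theta>" for s
    using hit_point_neq[OF pt_phase_space[OF assms that]] by simp
  then show ?thesis unfolding image_direction_def
    by (intro continuous_on_sgn continuous_on_diff continuous_on_image_exit continuous_on_image_entry assms) auto
qed

text \<open>Along the orbit this is the reflection law in Q. The defect \<open>G\<close> of the law
  is continuous in the level near \<open>u\<close>, and orbit points accumulate at \<open>u\<close>,
  so the defect vanishes at \<open>u\<close> too.\<close>

lemma image_direction_reflection:
  assumes u: "u \<in> limit_set" and nc: "hit_point vs u \<notin> set vs"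
    and j: "j < length Q" "\<phi> (hit_point vs u) \<in> side Q j" "\<phi> (hit_point vs u) \<notin> set Q"
  shows "image_direction (billiard_map vs u) = side_reflection Q j (image_direction u)"
proof (rule ccontr)
  assume neq: "image_direction (billiard_map vs u) \<noteq> side_reflection Q j (image_direction u)"
  have up: "u \<in> phase_space vs" using u by (simp add: limit_set_def)
  define \<theta> s where "\<theta> = snd u" and "s = level u"
  have us: "u = pt \<theta> s" using pt_level[OF up] by (simp add: \<theta>_def s_def)
  have th: "norm \<theta> = 1" using phase_spaceD[OF up] by (simp add: \<theta>_def)
  have sh: "s \<in> heights \<theta>" using level_in_heights[OF up] by (simp add: \<theta>_def s_def)
  obtain e1 where e1: "e1 > 0" "\<And>y. y \<in> boundary Q \<Longrightarrow> dist y (\<phi> (hit_point vs u)) < e1 \<Longrightarrow> y \<in> side Q j"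
    using Q.side_noncorner_nbhd[OF j] by blast
  let ?A = "{s \<in> heights \<theta>. hit_point vs (pt \<theta> s) \<notin> set vs}"
  let ?B = "heights \<theta> \<inter> (\<lambda>s. \<phi> (hit_point vs (pt \<theta> s))) -` ball (\<phi> (hit_point vs u)) e1"
  have "open (?A \<inter> ?B)"
    by (intro open_Int open_noncorner continuous_open_preimage continuous_on_image_exit open_heights th open_ball)
  moreover have "s \<in> ?A \<inter> ?B" using sh nc us e1(1) by simp
  ultimately obtain e where e: "e > 0" "ball s e \<subseteq> ?A \<inter> ?B" by (rule openE)
  obtain i c where ic: "i < 3"
    "\<And>r. r \<in> ball s e \<Longrightarrow> billiard_map vs (pt \<theta> r) = pt (side_reflection vs i \<theta>) (c - r)"
    "\<And>r. r \<in> ball s e \<Longrightarrow> c - r \<in> heights (side_reflection vs i \<theta>)"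
    by (rule beam_isometry[OF th convex_ball, of s e]) (use e in auto)
  have th': "norm (side_reflection vs i \<theta>) = 1" using norm_side_reflection ic(1) th length_3 by simp
  define G where "G r = image_direction (pt (side_reflection vs i \<theta>) (c - r)) -
      side_reflection Q j (image_direction (pt \<theta> r))" for r
  have refl: "side_reflection Q j z = (side_vector Q j / cnj (side_vector Q j)) * cnj z" for z
    by (simp add: side_reflection_def Let_def)
  have "continuous_on (ball s e) (\<lambda>r. image_direction (pt (side_reflection vs i \<theta>) (c - r)))"
    using ic(3)
    by (intro continuous_on_compose2[OF continuous_on_image_direction[OF th']] continuous_intros) auto
  moreover have "continuous_on (ball s e) (\<lambda>r. image_direction (pt \<theta> r))"
    using e by (intro continuous_on_subset[OF continuous_on_image_direction[OF th]]) auto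
  ultimately have contG: "continuous_on (ball s e) G"
    unfolding G_def refl by (intro continuous_on_diff continuous_on_mult continuous_on_const continuous_on_cnj)
  have "open (ball s e \<inter> G -` (- {0}))"
    by (rule continuous_open_preimage[OF contG]) auto
  moreover have "s \<in> ball s e \<inter> G -` (- {0})"
    using neq ic(2)[of s] e(1) us by (simp add: G_def)
  ultimately obtain d where d: "d > 0" "ball s d \<subseteq> ball s e \<inter> G -` (- {0})" by (rule openE)
  obtain n where n: "snd (orb n) = \<theta>" "\<bar>level (orb n) - s\<bar> < d"
    by (rule limit_setD[OF u d(1)]) (auto simp: \<theta>_def s_def)
  define r where "r = level (orb n)"
  have "r \<in> ball s d" using n(2) by (auto simp: r_def dist_real_def)
  then have r: "r \<in> ball s e" "G r \<noteq> 0" using d by auto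
  have orb: "orb n = pt \<theta> r" using pt_level[OF orb_phase_space, of n] n(1) by (simp add: r_def)
  have "r \<in> ?B" using r e by auto
  then have "\<phi> (hit_point vs (orb n)) \<in> ball (\<phi> (hit_point vs u)) e1" using orb by simp
  then have "\<phi> (hit_point vs (orb n)) \<in> side Q j"
    using e1(2) \<phi>_boundary hit_point_boundary[OF orb_phase_space] by (simp add: dist_commute)
  then have "image_direction (orb (Suc n)) = side_reflection Q j (image_direction (orb n))"
    using image_direction_orb_Suc[OF j(1)] by blast
  then show False using r(2) ic(2)[OF r(1)] unfolding G_def orb_Suc orb by simp
qed

section \<open>Chords that see no corner of either polygon\<close>

definition marked :: "complex set" where
  "marked = {z \<in> boundary vs. z \<in> set vs \<or> \<phi> z \<in> set Q}"

lemma finite_marked: "finite marked"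
proof (rule finite_subset)
  show "marked \<subseteq> set vs \<union> \<psi> ` set Q" using \<psi>\<phi> by (force simp: marked_def)
qed simp

text \<open>The foot is included besides the first \<open>n\<close> hit points, so that the feet at
  all times up to \<open>n\<close>, including time 0, avoid marked points.\<close>

definition clear :: "nat \<Rightarrow> phase_point \<Rightarrow> bool" where
  "clear n u \<longleftrightarrow> u \<in> limit_set \<and> fst u \<notin> marked \<and> (\<forall>k<n. hit_point vs ((billiard_map vs ^^ k) u) \<notin> marked)"

lemma clear_Suc: "clear (Suc n) u \<longleftrightarrow> clear n u \<and> hit_point vs ((billiard_map vs ^^ n) u) \<notin> marked"
  by (auto simp: clear_def less_Suc_eq)

lemma clear_mono: "clear n u \<Longrightarrow> k \<le> n \<Longrightarrow> clear k u"
  by (simp add: clear_def)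

lemma limit_set_phase_space: "u \<in> limit_set \<Longrightarrow> u \<in> phase_space vs"
  by (simp add: limit_set_def)

lemma clear_runs: "clear n u \<Longrightarrow> runs n u"
proof (induction n)
  case (Suc n)
  then have "runs n u" by (simp add: clear_Suc)
  then have "hit_point vs ((billiard_map vs ^^ n) u) \<in> boundary vs"
    using hit_point_boundary runs_in_phase_space by blast
  then show ?case using Suc.prems \<open>runs n u\<close> by (auto simp: clear_Suc runs_Suc marked_def)
qed (simp add: clear_def limit_set_phase_space)

lemma clear_iterate:
  assumes "clear n u"
  shows "(billiard_map vs ^^ n) u \<in> limit_set" "fst ((billiard_map vs ^^ n) u) \<notin> marked"
proof -
  show "(billiard_map vs ^^ n) u \<in> limit_set"
    using invariant_funpow[OF invariant_limit_set clear_runs[OF assms]] assms by (simp add: clear_def)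
  show "fst ((billiard_map vs ^^ n) u) \<notin> marked"
    using assms by (cases n) (auto simp: clear_def)
qed

text \<open>A chord is recovered from its direction at time \<open>n\<close> and the marked point
  hit then, because levels are constant along chords and the iterates are injective. So each step
  adds only finitely many bad levels.\<close>

lemma finite_not_clear:
  assumes th: "\<theta> \<in> snd ` limit_set"
  shows "finite {s \<in> heights \<theta>. \<not> clear n (pt \<theta> s)}"
proof -
  have nth: "norm \<theta> = 1" using th limit_set_phase_space phase_spaceD by blast
  have K: "pt \<theta> s \<in> limit_set" if "s \<in> heights \<theta>" for s
    using th limit_set_saturated that by blast
  show ?thesis
  proof (induction n)
    case 0
    have "{s \<in> heights \<theta>. \<not> clear 0 (pt \<theta> s)} \<subseteq> height \<theta> ` marked"
    proof
      fix s assume "s \<in> {s \<in> heights \<theta>. \<not> clear 0 (pt \<theta> s)}"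
      then have "s \<in> heights \<theta>" "fst (pt \<theta> s) \<in> marked" using K by (auto simp: clear_def)
      then show "s \<in> height \<theta> ` marked" using level_pt[OF nth] by (metis imageI)
    qed
    then show ?case using finite_marked finite_subset by blast
  next
    case (Suc n)
    let ?A = "{s \<in> heights \<theta>. clear n (pt \<theta> s) \<and> hit_point vs ((billiard_map vs ^^ n) (pt \<theta> s)) \<in> marked}"
    let ?f = "\<lambda>s. (snd ((billiard_map vs ^^ n) (pt \<theta> s)), hit_point vs ((billiard_map vs ^^ n) (pt \<theta> s)))"
    have "inj_on ?f ?A"
    proof (rule inj_onI)
      fix s t assume st: "s \<in> ?A" "t \<in> ?A" "?f s = ?f t"
      have st': "s \<in> heights \<theta>" "t \<in> heights \<theta>" using st by auto
      have r: "runs n (pt \<theta> s)" "runs n (pt \<theta> t)" using st clear_runs by auto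
      let ?u = "(billiard_map vs ^^ n) (pt \<theta> s)" and ?v = "(billiard_map vs ^^ n) (pt \<theta> t)"
      have eq: "snd ?u = snd ?v" "hit_point vs ?u = hit_point vs ?v" using st(3) by auto
      have "level ?u = level ?v"
        using height_hit_point[of ?u vs] height_hit_point[of ?v vs] eq by simp
      then have "?u = ?v" using entry_unique runs_in_phase_space r eq(1) by blast
      then have "pt \<theta> s = pt \<theta> t" using billiard_funpow_inj r by blast
      then show "s = t" using level_pt[OF nth st'(1)] level_pt[OF nth st'(2)] by metis
    qed
    moreover have "?f ` ?A \<subseteq> snd ` limit_set \<times> marked"
    proof (rule image_subsetI)
      fix s assume "s \<in> ?A"
      then have s: "clear n (pt \<theta> s)" "hit_point vs ((billiard_map vs ^^ n) (pt \<theta> s)) \<in> marked" by simp_all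
      show "?f s \<in> snd ` limit_set \<times> marked" using s(2) imageI[OF clear_iterate(1)[OF s(1)]] by (rule SigmaI[rotated])
    qed
    ultimately have "finite ?A"
      using invariant_setD(2)[OF invariant_limit_set] finite_marked
      by (meson finite_SigmaI finite_imageD finite_subset)
    moreover have "{s \<in> heights \<theta>. \<not> clear (Suc n) (pt \<theta> s)} \<subseteq> {s \<in> heights \<theta>. \<not> clear n (pt \<theta> s)} \<union> ?A"
      by (auto simp: clear_Suc)
    ultimately show ?case using Suc finite_subset by blast
  qed
qed

lemma clear_beam:
  assumes th: "\<theta> \<in> snd ` limit_set" and ab: "a \<le> b" "{a..b} \<subseteq> heights \<theta>"
    and cl: "\<And>s. s \<in> {a..b} \<Longrightarrow> clear n (pt \<theta> s)"
  obtains \<theta>' j where "\<theta>' \<in> snd ` limit_set" "j < length Q"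
    "\<And>s. s \<in> {a..b} \<Longrightarrow> snd ((billiard_map vs ^^ n) (pt \<theta> s)) = \<theta>'"
    "\<And>s. s \<in> {a..b} \<Longrightarrow> \<phi> (fst ((billiard_map vs ^^ n) (pt \<theta> s))) \<in> side Q j"
    "connected ((\<lambda>s. \<phi> (fst ((billiard_map vs ^^ n) (pt \<theta> s)))) ` {a..b})"
proof -
  have nth: "norm \<theta> = 1" using th limit_set_phase_space phase_spaceD by blast
  let ?y = "\<lambda>s. \<phi> (fst ((billiard_map vs ^^ n) (pt \<theta> s)))"
  obtain \<theta>' c where it: "norm \<theta>' = 1"
    "\<And>s. s \<in> {a..b} \<Longrightarrow> (billiard_map vs ^^ n) (pt \<theta> s) = pt \<theta>' ((-1)^n * s + c)"
    "\<And>s. s \<in> {a..b} \<Longrightarrow> (-1)^n * s + c \<in> heights \<theta>'"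
    by (rule beam_isometry_iterate[OF nth, of "{a..b}" n]) (use ab cl clear_runs in auto)
  have snd: "snd ((billiard_map vs ^^ n) (pt \<theta> s)) = \<theta>'" if "s \<in> {a..b}" for s
    unfolding it(2)[OF that] by (rule snd_pt[OF it(1) it(3)[OF that]])
  have "continuous_on {a..b} (\<lambda>s. \<phi> (fst (pt \<theta>' ((-1)^n * s + c))))"
    using it(3) by (intro continuous_on_compose2[OF continuous_on_image_entry[OF it(1)]] continuous_intros) auto
  then have "continuous_on {a..b} ?y"
    using it(2) by (subst continuous_on_cong[OF refl, where g = "\<lambda>s. \<phi> (fst (pt \<theta>' ((-1)^n * s + c)))"]) auto
  then have conn: "connected (?y ` {a..b})" by (intro connected_continuous_image connected_Icc)
  have bd: "fst ((billiard_map vs ^^ n) (pt \<theta> s)) \<in> boundary vs" if "s \<in> {a..b}" for s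
    using clear_iterate(1)[OF cl[OF that]] limit_set_phase_space phase_spaceD by blast
  have sub: "?y ` {a..b} \<subseteq> boundary Q" using bd \<phi>_boundary by blast
  have disj: "?y ` {a..b} \<inter> set Q = {}" using clear_iterate(2)[OF cl] bd by (auto simp: marked_def)
  have a: "a \<in> {a..b}" using ab by simp
  then obtain j where j: "j < length Q" "?y a \<in> side Q j"
    using subsetD[OF sub imageI[OF a]] unfolding Q.boundary_eq by blast
  have "?y ` {a..b} \<subseteq> side Q j"
    using Q.connected_in_side[OF conn sub disj j(1) imageI[OF a] j(2)] .
  moreover have "\<theta>' \<in> snd ` limit_set" using clear_iterate(1)[OF cl[OF a]] snd[OF a] by blast
  ultimately show thesis using that[of \<theta>' j] j(1) snd conn by blast
qed

definition variation_bound :: real where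
  "variation_bound = card (snd ` limit_set) * (\<Sum>j<length Q. dist (Q ! j) (Q ! (Suc j mod length Q)))"

text \<open>Pieces are sorted by their direction at time \<open>n\<close> and the side of Q carrying
  their image. Within one class the image curves are disjoint: a common foot and direction at time
  \<open>n\<close> would come from the same chord at time 0. Hence each class contributes at most
  the length of its side.\<close>

lemma variation_bounded:
  assumes th: "\<theta> \<in> snd ` limit_set" and fin: "finite I"
    and I: "\<And>p. p \<in> I \<Longrightarrow> fst p \<le> snd p \<and> {fst p..snd p} \<subseteq> heights \<theta>"
    and disj: "\<And>p q. p \<in> I \<Longrightarrow> q \<in> I \<Longrightarrow> p \<noteq> q \<Longrightarrow> {fst p..snd p} \<inter> {fst q..snd q} = {}"
    and cl: "\<And>p s. p \<in> I \<Longrightarrow> s \<in> {fst p..snd p} \<Longrightarrow> clear n (pt \<theta> s)"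
  shows "(\<Sum>p\<in>I. dist (\<phi> (fst ((billiard_map vs ^^ n) (pt \<theta> (fst p)))))
      (\<phi> (fst ((billiard_map vs ^^ n) (pt \<theta> (snd p)))))) \<le> variation_bound"
proof -
  let ?y = "\<lambda>s. \<phi> (fst ((billiard_map vs ^^ n) (pt \<theta> s)))"
  let ?d = "\<lambda>p. dist (?y (fst p)) (?y (snd p))"
  have nth: "norm \<theta> = 1" using th limit_set_phase_space phase_spaceD by blast
  have "\<exists>c. p \<in> I \<longrightarrow> c \<in> snd ` limit_set \<times> {..<length Q} \<and>
      (\<forall>s\<in>{fst p..snd p}. snd ((billiard_map vs ^^ n) (pt \<theta> s)) = fst c \<and> ?y s \<in> side Q (snd c)) \<and>
      connected (?y ` {fst p..snd p})" for p
  proof (cases "p \<in> I")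
    case True
    obtain \<theta>' j where "\<theta>' \<in> snd ` limit_set" "j < length Q"
      "\<And>s. s \<in> {fst p..snd p} \<Longrightarrow> snd ((billiard_map vs ^^ n) (pt \<theta> s)) = \<theta>'"
      "\<And>s. s \<in> {fst p..snd p} \<Longrightarrow> ?y s \<in> side Q j" "connected (?y ` {fst p..snd p})"
      by (rule clear_beam[OF th, of "fst p" "snd p" n]) (use I[OF True] cl[OF True] in auto)
    then show ?thesis by (intro exI[of _ "(\<theta>', j)"]) auto
  qed simp
  then obtain C where C: "\<And>p. p \<in> I \<Longrightarrow> C p \<in> snd ` limit_set \<times> {..<length Q}"
    "\<And>p s. p \<in> I \<Longrightarrow> s \<in> {fst p..snd p} \<Longrightarrow> snd ((billiard_map vs ^^ n) (pt \<theta> s)) = fst (C p)"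
    "\<And>p s. p \<in> I \<Longrightarrow> s \<in> {fst p..snd p} \<Longrightarrow> ?y s \<in> side Q (snd (C p))"
    "\<And>p. p \<in> I \<Longrightarrow> connected (?y ` {fst p..snd p})"
    by metis
  have finT: "finite (snd ` limit_set \<times> {..<length Q})"
    using invariant_setD(2)[OF invariant_limit_set] by simp
  have cls: "(\<Sum>p\<in>{p \<in> I. C p = c}. ?d p) \<le> dist (Q ! snd c) (Q ! (Suc (snd c) mod length Q))" for c
  proof (rule disjoint_subsets_of_segment)
    show "finite {p \<in> I. C p = c}" using fin by simp
    fix p assume p: "p \<in> {p \<in> I. C p = c}"
    show "connected (?y ` {fst p..snd p})" using C(4) p by simp
    show "?y ` {fst p..snd p} \<subseteq> closed_segment (Q ! snd c) (Q ! (Suc (snd c) mod length Q))"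
    proof (rule image_subsetI)
      fix s assume "s \<in> {fst p..snd p}"
      then show "?y s \<in> closed_segment (Q ! snd c) (Q ! (Suc (snd c) mod length Q))"
        using C(3)[of p s] p unfolding side_def by simp
    qed
    show "?y (fst p) \<in> ?y ` {fst p..snd p}" "?y (snd p) \<in> ?y ` {fst p..snd p}" using I p by auto
  next
    fix p q assume pq: "p \<in> {p \<in> I. C p = c}" "q \<in> {p \<in> I. C p = c}" "p \<noteq> q"
    have False if st: "s \<in> {fst p..snd p}" "t \<in> {fst q..snd q}" "?y s = ?y t" for s t
    proof -
      let ?u = "(billiard_map vs ^^ n) (pt \<theta> s)" and ?v = "(billiard_map vs ^^ n) (pt \<theta> t)"
      have pI: "p \<in> I" "q \<in> I" using pq by simp_all
      have c: "clear n (pt \<theta> s)" "clear n (pt \<theta> t)" using cl[OF pI(1) st(1)] cl[OF pI(2) st(2)] .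
      have h: "s \<in> heights \<theta>" "t \<in> heights \<theta>" using I[OF pI(1)] I[OF pI(2)] st by blast+
      have ps: "?u \<in> phase_space vs" "?v \<in> phase_space vs" using clear_iterate(1) c limit_set_phase_space by auto
      have "fst ?u = fst ?v" using \<phi>_inj st(3) phase_spaceD ps by blast
      moreover have "snd ?u = snd ?v" using C(2)[of p s] C(2)[of q t] pq st by simp
      ultimately have "?u = ?v" by (simp add: prod_eq_iff)
      then have "pt \<theta> s = pt \<theta> t" using billiard_funpow_inj clear_runs c by blast
      then have "s = t" using level_pt[OF nth h(1)] level_pt[OF nth h(2)] by metis
      then show False using disj[OF pI pq(3)] st by blast
    qed
    then show "?y ` {fst p..snd p} \<inter> ?y ` {fst q..snd q} = {}" by blast
  qed
  have "(\<Sum>p\<in>I. ?d p) = (\<Sum>c\<in>snd ` limit_set \<times> {..<length Q}. \<Sum>p\<in>{p \<in> I. C p = c}. ?d p)"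
    by (rule sum.group[symmetric, OF fin finT image_subsetI[OF C(1)]])
  also have "\<dots> \<le> (\<Sum>c\<in>snd ` limit_set \<times> {..<length Q}. dist (Q ! snd c) (Q ! (Suc (snd c) mod length Q)))"
    by (intro sum_mono cls)
  also have "\<dots> = (\<Sum>\<theta>\<in>snd ` limit_set. \<Sum>j<length Q. dist (Q ! j) (Q ! (Suc j mod length Q)))"
    by (subst sum.cartesian_product) (simp only: case_prod_unfold)
  also have "\<dots> = variation_bound" by (simp add: variation_bound_def)
  finally show ?thesis .
qed

text \<open>On a clear beam the two image trajectories are reflected by the same sides of Q at every
  step, so they can be unfolded together. With unfolded lengths at least \<open>L\<close>, an angle
  between the initial directions forces a proportional drift.\<close>

lemma clear_pair_estimate:
  assumes th: "\<theta> \<in> snd ` limit_set" and ab: "a \<le> b" "{a..b} \<subseteq> heights \<theta>"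
    and cl: "\<And>s. s \<in> {a..b} \<Longrightarrow> clear n (pt \<theta> s)"
    and L: "0 \<le> L" "\<And>u. u \<in> limit_set \<Longrightarrow> runs n u \<Longrightarrow>
      L \<le> (\<Sum>k<n. dist (\<phi> (fst ((billiard_map vs ^^ k) u))) (\<phi> (hit_point vs ((billiard_map vs ^^ k) u))))"
  shows "L * dist (image_direction (pt \<theta> a)) (image_direction (pt \<theta> b)) \<le>
    dist (\<phi> (fst (pt \<theta> a))) (\<phi> (fst (pt \<theta> b))) +
    dist (\<phi> (fst ((billiard_map vs ^^ n) (pt \<theta> a)))) (\<phi> (fst ((billiard_map vs ^^ n) (pt \<theta> b))))"
proof -
  define y where "y s k = \<phi> (fst ((billiard_map vs ^^ k) (pt \<theta> s)))" for s k
  define w where "w s k = image_direction ((billiard_map vs ^^ k) (pt \<theta> s))" for s k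
  define \<tau> where "\<tau> s k = dist (y s k) (y s (Suc k))" for s k
  have y_Suc: "y s (Suc k) = \<phi> (hit_point vs ((billiard_map vs ^^ k) (pt \<theta> s)))" for s k by (simp add: y_def)
  have "\<exists>\<rho>. k < n \<longrightarrow> cmod \<rho> = 1 \<and> (\<forall>s\<in>{a..b}. w s (Suc k) = \<rho> * cnj (w s k)) \<and>
      \<rho> * cnj (y a (Suc k) - y b (Suc k)) = y a (Suc k) - y b (Suc k)" for k
  proof (cases "k < n")
    case True
    have cS: "clear (Suc k) (pt \<theta> s)" if "s \<in> {a..b}" for s
      using clear_mono[OF cl[OF that]] True by simp
    obtain \<theta>' j where j: "j < length Q" "\<And>s. s \<in> {a..b} \<Longrightarrow> \<phi> (fst ((billiard_map vs ^^ Suc k) (pt \<theta> s))) \<in> side Q j"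
      by (rule clear_beam[OF th ab cS]) auto
    define W where "W = side_vector Q j"
    have W: "W \<noteq> 0" using Q.side_vector_nz j(1) by (simp add: W_def)
    have ws: "w s (Suc k) = (W / cnj W) * cnj (w s k)" if s: "s \<in> {a..b}" for s
    proof -
      let ?u = "(billiard_map vs ^^ k) (pt \<theta> s)"
      have u: "?u \<in> limit_set" using clear_iterate(1)[OF clear_mono[OF cS[OF s], of k]] by simp
      have m: "hit_point vs ?u \<notin> marked" using cS[OF s] by (simp add: clear_Suc)
      have hb: "hit_point vs ?u \<in> boundary vs" using hit_point_boundary limit_set_phase_space u by blast
      have "image_direction (billiard_map vs ?u) = side_reflection Q j (image_direction ?u)"
        by (rule image_direction_reflection[OF u _ j(1)]) (use m hb j(2)[OF s] in \<open>auto simp: marked_def\<close>)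
      then show ?thesis by (simp add: w_def side_reflection_def Let_def W_def)
    qed
    have "y a (Suc k) \<in> side Q j" "y b (Suc k) \<in> side Q j" using j(2) ab(1) by (auto simp: y_def)
    then have "Im (cnj W * (y a (Suc k) - y b (Suc k))) = 0" unfolding W_def by (rule Q.Im_side_line)
    then obtain r where r: "y a (Suc k) - y b (Suc k) = r *\<^sub>R W" using W by (rule Im_cnj_mult_eq_0)
    have "(W / cnj W) * cnj (y a (Suc k) - y b (Suc k)) = y a (Suc k) - y b (Suc k)"
      unfolding r using W by simp
    moreover have "cmod (W / cnj W) = 1" using W by (simp add: norm_divide)
    ultimately show ?thesis using ws by blast
  qed simp
  then obtain \<rho> where \<rho>: "\<And>k. k < n \<Longrightarrow> cmod (\<rho> k) = 1"
    "\<And>k s. k < n \<Longrightarrow> s \<in> {a..b} \<Longrightarrow> w s (Suc k) = \<rho> k * cnj (w s k)"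
    "\<And>k. k < n \<Longrightarrow> \<rho> k * cnj (y a (Suc k) - y b (Suc k)) = y a (Suc k) - y b (Suc k)"
    by metis
  have step: "y s (Suc k) = y s k + \<tau> s k *\<^sub>R w s k" for s k
    unfolding y_Suc \<tau>_def w_def unfolding y_def by (rule image_direction_scale)
  have aI: "a \<in> {a..b}" "b \<in> {a..b}" using ab by auto
  have "cmod (y a n - y b n) = cmod (y a 0 - y b 0 + ((\<Sum>k<n. \<tau> a k) *\<^sub>R w a 0 - (\<Sum>k<n. \<tau> b k) *\<^sub>R w b 0))"
    by (rule unfolding_distance[where \<rho> = \<rho>]) (use step \<rho> aI in auto)
  then have "cmod ((\<Sum>k<n. \<tau> a k) *\<^sub>R w a 0 - (\<Sum>k<n. \<tau> b k) *\<^sub>R w b 0) \<le> cmod (y a n - y b n) + cmod (y a 0 - y b 0)"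
    using norm_triangle_ineq4[of "y a 0 - y b 0 + ((\<Sum>k<n. \<tau> a k) *\<^sub>R w a 0 - (\<Sum>k<n. \<tau> b k) *\<^sub>R w b 0)" "y a 0 - y b 0"]
    by simp
  moreover have "L * cmod (w a 0 - w b 0) \<le> cmod ((\<Sum>k<n. \<tau> a k) *\<^sub>R w a 0 - (\<Sum>k<n. \<tau> b k) *\<^sub>R w b 0)"
  proof (rule norm_scaled_unit_diff)
    have K: "pt \<theta> s \<in> limit_set" "runs n (pt \<theta> s)" if "s \<in> {a..b}" for s
      using cl[OF that] clear_runs by (auto simp: clear_def)
    show "cmod (w a 0) = 1" "cmod (w b 0) = 1"
      using norm_image_direction limit_set_phase_space K aI by (auto simp: w_def)
    show "0 \<le> L" by (rule L(1))
    show "L \<le> (\<Sum>k<n. \<tau> a k)" "L \<le> (\<Sum>k<n. \<tau> b k)"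
      using L(2) K aI by (simp_all add: \<tau>_def y_def)
  qed
  ultimately show ?thesis by (simp add: w_def y_def dist_norm)
qed

text \<open>Uniform continuity of \<psi> prevents long chords from having short images, and every
  window of \<open>B\<close> steps has a long chord.\<close>

lemma long_images:
  obtains c B where "c > 0" "B > 0"
    "\<And>u n. runs (n * B) u \<Longrightarrow>
      n * c \<le> (\<Sum>k<n * B. dist (\<phi> (fst ((billiard_map vs ^^ k) u))) (\<phi> (hit_point vs ((billiard_map vs ^^ k) u))))"
proof -
  obtain \<eta> B where \<eta>: "\<eta> > 0" "B > 0"
    "\<And>u. runs B u \<Longrightarrow> \<exists>k<B. \<eta> \<le> dist (fst ((billiard_map vs ^^ k) u)) (hit_point vs ((billiard_map vs ^^ k) u))"
    using long_chord[OF rational] by metis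
  have "uniformly_continuous_on (boundary Q) \<psi>"
    using compact_uniformly_continuous continuous_\<psi> Q.compact_boundary by blast
  then obtain c where c: "c > 0" "\<And>y y'. y \<in> boundary Q \<Longrightarrow> y' \<in> boundary Q \<Longrightarrow> dist y' y < c \<Longrightarrow> dist (\<psi> y') (\<psi> y) < \<eta>"
    using \<eta>(1) unfolding uniformly_continuous_on_def by metis
  have chord: "c \<le> dist (\<phi> z) (\<phi> z')" if "z \<in> boundary vs" "z' \<in> boundary vs" "\<eta> \<le> dist z z'" for z z'
    using c(2)[of "\<phi> z'" "\<phi> z"] that \<phi>_boundary \<psi>\<phi> by (metis not_le)
  have "n * c \<le> (\<Sum>k<n * B. dist (\<phi> (fst ((billiard_map vs ^^ k) u))) (\<phi> (hit_point vs ((billiard_map vs ^^ k) u))))"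
    if "runs (n * B) u" for u n
    using that
  proof (induction n)
    case (Suc n)
    let ?g = "\<lambda>k. dist (\<phi> (fst ((billiard_map vs ^^ k) u))) (\<phi> (hit_point vs ((billiard_map vs ^^ k) u)))"
    have r: "runs (n * B) u" "runs B ((billiard_map vs ^^ (n * B)) u)"
      using Suc.prems runs_add[of "n * B" B u] by (simp_all add: add.commute)
    obtain k where k: "k < B" "\<eta> \<le> dist (fst ((billiard_map vs ^^ k) ((billiard_map vs ^^ (n * B)) u)))
        (hit_point vs ((billiard_map vs ^^ k) ((billiard_map vs ^^ (n * B)) u)))"
      using \<eta>(3)[OF r(2)] by blast
    have ps: "(billiard_map vs ^^ k) ((billiard_map vs ^^ (n * B)) u) \<in> phase_space vs"
      using runs_in_phase_space[OF runs_mono[OF r(2), of k]] k(1) by simp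
    have "c \<le> ?g (k + n * B)"
      using chord[OF _ _ k(2)] phase_spaceD[OF ps] hit_point_boundary[OF ps] by (simp add: funpow_add)
    also have "\<dots> \<le> (\<Sum>k\<in>{n * B..<n * B + B}. ?g k)"
      using k(1) by (intro member_le_sum) auto
    finally have "n * c + c \<le> (\<Sum>k\<in>{0..<n * B}. ?g k) + (\<Sum>k\<in>{n * B..<n * B + B}. ?g k)"
      using Suc.IH[OF r(1)] by (simp add: atLeast0LessThan)
    also have "\<dots> = (\<Sum>k\<in>{0..<n * B + B}. ?g k)" by (rule sum.atLeastLessThan_concat) auto
    finally show ?case by (simp add: algebra_simps atLeast0LessThan)
  qed simp
  then show thesis using c(1) \<eta>(2) by (intro that[of c B]) auto
qed

text \<open>Nearby parallel chords whose images in \<open>Q\<close> are not parallel drift apart linearly in time, while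
  the image curves have bounded total length; so the direction has no variation.\<close>

lemma image_direction_const:
  assumes u: "u \<in> limit_set" and v: "v \<in> phase_space vs" "snd v = snd u"
  shows "image_direction v = image_direction u"
proof -
  define \<theta> where "\<theta> = snd u"
  have th: "\<theta> \<in> snd ` limit_set" using u by (simp add: \<theta>_def)
  have nth: "norm \<theta> = 1" using th limit_set_phase_space phase_spaceD by blast
  obtain c B where cB: "c > 0" "B > 0" "\<And>u n. runs (n * B) u \<Longrightarrow>
      n * c \<le> (\<Sum>k<n * B. dist (\<phi> (fst ((billiard_map vs ^^ k) u))) (\<phi> (hit_point vs ((billiard_map vs ^^ k) u))))"
    by (rule long_images) blast
  let ?G = "\<lambda>s. image_direction (pt \<theta> s)"
  \<comment> \<open>\<open>\<epsilon>\<close> is what \<open>variation_off_finite_set\<close> loses;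
    \<open>variation_bound\<close> is counted once for time 0 and once for time
    \<open>n * B\<close>.\<close>
  have est: "n * c * dist (?G s) (?G s') \<le> 2 * variation_bound + n * c * \<epsilon>"
    if st: "s \<in> heights \<theta>" "s' \<in> heights \<theta>" "s < s'" and e: "\<epsilon> > 0" for s s' \<epsilon> and n :: nat
  proof -
    have sub: "{s..s'} \<subseteq> heights \<theta>"
      using convex_heights[of \<theta>] st closed_segment_subset[of s "heights \<theta>" s'] by (simp add: closed_segment_eq_real_ivl)
    let ?X = "{s \<in> heights \<theta>. \<not> clear (n * B) (pt \<theta> s)}"
    obtain I where I: "finite I" "\<forall>p\<in>I. s < fst p \<and> fst p \<le> snd p \<and> snd p < s' \<and> {fst p..snd p} \<inter> ?X = {}"
      "\<forall>p\<in>I. \<forall>q\<in>I. p \<noteq> q \<longrightarrow> {fst p..snd p} \<inter> {fst q..snd q} = {}"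
      "dist (?G s) (?G s') \<le> (\<Sum>p\<in>I. dist (?G (fst p)) (?G (snd p))) + \<epsilon>"
      using variation_off_finite_set[OF finite_not_clear[OF th, of "n * B"] st(3)
          continuous_on_subset[OF continuous_on_image_direction[OF nth] sub] e] by blast
    have Isub: "fst p \<le> snd p \<and> {fst p..snd p} \<subseteq> heights \<theta>" if "p \<in> I" for p
      using bspec[OF I(2) that] sub by fastforce
    have cl: "clear (n * B) (pt \<theta> r)" if "p \<in> I" "r \<in> {fst p..snd p}" for p r
      using bspec[OF I(2) that(1)] Isub[OF that(1)] that(2) by blast
    have cl0: "clear 0 (pt \<theta> r)" if "p \<in> I" "r \<in> {fst p..snd p}" for p r
      using clear_mono[OF cl[OF that]] by simp
    have dj: "{fst p..snd p} \<inter> {fst q..snd q} = {}" if "p \<in> I" "q \<in> I" "p \<noteq> q" for p q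
      using I(3) that by blast
    have "n * c * (\<Sum>p\<in>I. dist (?G (fst p)) (?G (snd p))) = (\<Sum>p\<in>I. n * c * dist (?G (fst p)) (?G (snd p)))"
      by (rule sum_distrib_left)
    also have "\<dots> \<le> (\<Sum>p\<in>I. dist (\<phi> (fst (pt \<theta> (fst p)))) (\<phi> (fst (pt \<theta> (snd p)))) +
        dist (\<phi> (fst ((billiard_map vs ^^ (n * B)) (pt \<theta> (fst p))))) (\<phi> (fst ((billiard_map vs ^^ (n * B)) (pt \<theta> (snd p))))))"
    proof (rule sum_mono)
      fix p assume p: "p \<in> I"
      show "n * c * dist (?G (fst p)) (?G (snd p)) \<le> dist (\<phi> (fst (pt \<theta> (fst p)))) (\<phi> (fst (pt \<theta> (snd p)))) +
        dist (\<phi> (fst ((billiard_map vs ^^ (n * B)) (pt \<theta> (fst p))))) (\<phi> (fst ((billiard_map vs ^^ (n * B)) (pt \<theta> (snd p)))))"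
        using Isub[OF p] cl[OF p] cB by (intro clear_pair_estimate[OF th]) auto
    qed
    also have "\<dots> \<le> variation_bound + variation_bound"
      unfolding sum.distrib
      using variation_bounded[OF th I(1) Isub dj cl0] variation_bounded[OF th I(1) Isub dj cl]
      by (intro add_mono) (simp_all)
    finally have "n * c * (\<Sum>p\<in>I. dist (?G (fst p)) (?G (snd p))) \<le> 2 * variation_bound" by simp
    moreover have "n * c * dist (?G s) (?G s') \<le> n * c * ((\<Sum>p\<in>I. dist (?G (fst p)) (?G (snd p))) + \<epsilon>)"
      using I(4) cB(1) by (intro mult_left_mono) auto
    ultimately show ?thesis by (simp add: distrib_left)
  qed
  have const: "?G s = ?G s'" if st: "s \<in> heights \<theta>" "s' \<in> heights \<theta>" "s < s'" for s s'
  proof (rule ccontr)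
    assume neq: "?G s \<noteq> ?G s'"
    define D where "D = dist (?G s) (?G s')"
    have D: "D > 0" using neq by (simp add: D_def)
    \<comment> \<open>With \<open>\<epsilon> = D / 2\<close> the estimate becomes
      \<open>n * c * (D / 2) \<le> 2 * variation_bound\<close>, which fails for large
      \<open>n\<close>.\<close>
    obtain n :: nat where n: "2 * variation_bound / (c * (D / 2)) < n" using reals_Archimedean2 by blast
    then have "2 * variation_bound < n * c * (D / 2)" using cB(1) D by (simp add: field_simps)
    moreover have "n * c * D \<le> 2 * variation_bound + n * c * (D / 2)"
      using est[OF st, of "D / 2" n] D by (simp add: D_def)
    ultimately show False by (simp add: field_simps)
  qed
  have up: "u \<in> phase_space vs" using u limit_set_phase_space by blast
  have "level u \<in> heights \<theta>" "level v \<in> heights \<theta>" "u = pt \<theta> (level u)" "v = pt \<theta> (level v)"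
    using level_in_heights[OF up] level_in_heights[OF v(1)] pt_level[OF up] pt_level[OF v(1)] v(2)
    by (auto simp: \<theta>_def)
  then show ?thesis using const[of "level u" "level v"] const[of "level v" "level u"]
    by (metis linorder_neqE)
qed

end

section \<open>Corners correspond\<close>

lemma infinite_segment_ball:
  fixes a b c :: complex
  assumes "c \<in> closed_segment a b" "a \<noteq> b" "0 < e"
  shows "infinite (closed_segment a b \<inter> ball c e)"
proof -
  obtain d where d: "d \<in> closed_segment a b" "d \<noteq> c" using assms(2) by (metis ends_in_segment)
  define m where "m = min 1 (e / cmod (d - c))"
  have m: "0 < m" using assms(3) d by (simp add: m_def)
  have "c + t *\<^sub>R (d - c) \<in> closed_segment a b \<inter> ball c e" if t: "t \<in> {0<..<m}" for t
  proof -
    have "t < 1" and "t * cmod (d - c) < e" using t d by (auto simp: m_def field_simps)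
    then have "c + t *\<^sub>R (d - c) \<in> ball c e" using t by (simp add: dist_norm)
    moreover have e: "c + t *\<^sub>R (d - c) = (1 - t) *\<^sub>R c + t *\<^sub>R d" by (simp add: algebra_simps)
    moreover have "c + t *\<^sub>R (d - c) \<in> closed_segment a b" unfolding e
      by (rule convexD[OF convex_closed_segment assms(1) d(1)]) (use t \<open>t < 1\<close> in auto)
    ultimately show ?thesis by blast
  qed
  then have "(\<lambda>t. c + t *\<^sub>R (d - c)) ` {0<..<m} \<subseteq> closed_segment a b \<inter> ball c e" by blast
  moreover have "infinite ((\<lambda>t. c + t *\<^sub>R (d - c)) ` {0<..<m})"
    using m d(2) by (subst finite_image_iff) (auto simp: inj_on_def infinite_Ioo)
  ultimately show ?thesis using finite_subset by blast
qed

lemma predecessor_mod: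
  fixes k n :: nat
  assumes "k < n"
  shows "(k + n - 1) mod n < n" "Suc ((k + n - 1) mod n) mod n = k"
proof -
  show "(k + n - 1) mod n < n" using assms by (intro mod_less_divisor) simp
  have "Suc ((k + n - 1) mod n) mod n = Suc (k + n - 1) mod n" by (rule mod_Suc_eq)
  also have "Suc (k + n - 1) = k + n" using assms by simp
  finally show "Suc ((k + n - 1) mod n) mod n = k" using assms by simp
qed

context simple_polygon
begin

lemma side_noncorner_exists: "i < length vs \<Longrightarrow> \<exists>z\<in>side vs i. z \<notin> set vs"
proof (rule ccontr)
  assume i: "i < length vs" and "\<not> (\<exists>z\<in>side vs i. z \<notin> set vs)"
  then have "finite (side vs i)" using finite_subset[of "side vs i" "set vs"] by blast
  moreover have "vs ! i \<noteq> vs ! (Suc i mod length vs)" using side_vector_nz[OF i] by (auto simp: side_vector_def)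
  ultimately show False
    using uncountable_closed_segment countable_finite unfolding side_def by blast
qed

text \<open>Parallel adjacent sides either continue each other, which gives the excluded angle
  \<pi>, or fold back and overlap in infinitely many points, while sides share only corners.\<close>

lemma adjacent_sides_not_parallel:
  assumes k: "k < length vs" and angle: "interior_angle vs k \<noteq> pi"
    and k': "k' = (k + length vs - 1) mod length vs"
  shows "side_vector vs k / cnj (side_vector vs k) \<noteq> side_vector vs k' / cnj (side_vector vs k')"
proof
  let ?w = "side_vector vs k" and ?w' = "side_vector vs k'"
  assume e: "?w / cnj ?w = ?w' / cnj ?w'"
  have lt: "k' < length vs" and Sk: "Suc k' mod length vs = k"
    unfolding k' using predecessor_mod[OF k] by blast+
  have neq: "k' \<noteq> k" using Sk lt k length_ge by (auto simp: mod_Suc split: if_splits)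
  have nz: "?w \<noteq> 0" "?w' \<noteq> 0" using side_vector_nz k lt by auto
  have "cnj (cnj ?w * ?w') = cnj ?w * ?w'" using e nz by (simp add: field_simps)
  then have "Im (cnj ?w * ?w') = 0" by (metis cnj.simps(2) neg_equal_zero)
  then obtain l where l: "?w' = l *\<^sub>R ?w" using nz by (metis Im_cnj_mult_eq_0)
  have w': "?w' = vs ! k - vs ! k'" by (simp add: side_vector_def Sk)
  have "interior_angle vs k = Arg2pi (- of_real l)"
  proof -
    have "vs ! k' - vs ! k = - (l *\<^sub>R ?w)" unfolding l[symmetric] w' by simp
    then have "(vs ! k' - vs ! k) / ?w = - of_real l" using nz by (simp add: scaleR_conv_of_real)
    then show ?thesis unfolding interior_angle_def k'[symmetric] by simp
  qed
  moreover have "l \<noteq> 0" using l nz by auto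
  ultimately have "l < 0"
    using angle Arg2pi_of_real[of "- l"] by (auto simp: not_less_iff_gr_or_eq split: if_splits)
  define m where "m = min 1 (- l)"
  have m: "0 < m" "m \<le> 1" "m \<le> - l" using \<open>l < 0\<close> by (auto simp: m_def)
  have "vs ! k + t *\<^sub>R ?w \<in> side vs k \<inter> side vs k'" if t: "t \<in> {0<..<m}" for t
  proof -
    have "vs ! k + t *\<^sub>R ?w = (1 - t) *\<^sub>R vs ! k + t *\<^sub>R vs ! (Suc k mod length vs)"
      by (simp add: side_vector_def algebra_simps)
    then have 1: "vs ! k + t *\<^sub>R ?w \<in> side vs k"
      unfolding side_def in_segment using t m by (intro exI[of _ t]) auto
    have v: "vs ! k' = vs ! k - l *\<^sub>R ?w" unfolding l[symmetric] w' by simp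
    have "vs ! k + t *\<^sub>R ?w = (1 - (1 + t / l)) *\<^sub>R vs ! k' + (1 + t / l) *\<^sub>R vs ! k"
      unfolding v using \<open>l < 0\<close> by (simp add: algebra_simps)
    moreover have "0 \<le> 1 + t / l" "1 + t / l \<le> 1" using t m \<open>l < 0\<close> by (auto simp: field_simps)
    ultimately have "vs ! k + t *\<^sub>R ?w \<in> side vs k'"
      unfolding side_def Sk in_segment by blast
    then show ?thesis using 1 by blast
  qed
  then have "(\<lambda>t. vs ! k + t *\<^sub>R ?w) ` {0<..<m} \<subseteq> set vs" using sides_meet[OF k lt neq[symmetric]] by blast
  moreover have "infinite ((\<lambda>t. vs ! k + t *\<^sub>R ?w) ` {0<..<m})"
    using m nz by (subst finite_image_iff) (auto simp: inj_on_def infinite_Ioo)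
  ultimately show False using finite_subset by blast
qed

end

section \<open>Chords of a triangle and images of its sides\<close>

context triangle
begin

lemma sides_cover_corner:
  assumes "i < 3" shows "\<exists>p. set vs = {vs ! i, vs ! (Suc i mod 3), p} \<and> p \<notin> side vs i"
proof -
  have e: "elev 0 (vs ! 2) = \<bar>area\<bar>" "elev (Suc 0) (vs ! 0) = \<bar>area\<bar>" "elev 2 (vs ! Suc 0) = \<bar>area\<bar>"
    using elev_barycentric(1)[of 0 0 1] elev_barycentric(2)[of 1 0 0] elev_barycentric(3)[of 0 1 0] by simp_all
  have "vs ! 2 \<notin> side vs 0" "vs ! 0 \<notin> side vs (Suc 0)" "vs ! Suc 0 \<notin> side vs 2"
    using e elev_side area_nz by fastforce+
  then have c: "{vs ! 0, vs ! Suc 0, vs ! 2} = {vs ! 0, vs ! (Suc 0 mod 3), vs ! 2} \<and> vs ! 2 \<notin> side vs 0"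
    "{vs ! 0, vs ! Suc 0, vs ! 2} = {vs ! Suc 0, vs ! (Suc (Suc 0) mod 3), vs ! 0} \<and> vs ! 0 \<notin> side vs (Suc 0)"
    "{vs ! 0, vs ! Suc 0, vs ! 2} = {vs ! 2, vs ! (Suc 2 mod 3), vs ! Suc 0} \<and> vs ! Suc 0 \<notin> side vs 2"
    unfolding Suc_mod_3 by blast+
  consider "i = 0" | "i = Suc 0" | "i = 2" using assms by (auto simp: less_3_cases)
  then show ?thesis unfolding set_vs using c by cases blast+
qed

lemma chord_phase_space:
  assumes x: "x \<in> boundary vs" and y: "x + \<tau> *\<^sub>R \<theta> \<in> boundary vs" and th: "norm \<theta> = 1" and \<tau>: "0 < \<tau>"
    and mid: "x + (\<tau> / 2) *\<^sub>R \<theta> \<in> interior tri"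
  shows "(x, \<theta>) \<in> phase_space vs" "hit_point vs (x, \<theta>) = x + \<tau> *\<^sub>R \<theta>"
proof -
  have "x + t *\<^sub>R \<theta> \<in> interior tri" if t: "0 < t" "t < \<tau> / 2" for t
  proof -
    have "x + (\<tau> / 2) *\<^sub>R \<theta> + (\<tau> / 2) *\<^sub>R (- \<theta>) \<in> tri" using x boundary_tri by auto
    then have "x + (\<tau> / 2) *\<^sub>R \<theta> + (\<tau> / 2 - t) *\<^sub>R (- \<theta>) \<in> interior tri"
      by (rule line_interior[OF mid]) (use t in auto)
    then show ?thesis by (simp add: algebra_simps)
  qed
  then show ps: "(x, \<theta>) \<in> phase_space vs"
    unfolding phase_space_def inside_interior using x th \<tau>
    by (auto intro!: exI[of _ "\<tau> / 2"])
  show "hit_point vs (x, \<theta>) = x + \<tau> *\<^sub>R \<theta>" using hit_unique[OF ps \<tau>] y by simp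
qed

lemma interior_combination:
  assumes "set vs = {a, b, p}" "0 < \<alpha>" "0 < \<beta>" "0 < \<gamma>" "\<alpha> + \<beta> + \<gamma> = 1"
  shows "\<alpha> *\<^sub>R a + \<beta> *\<^sub>R b + \<gamma> *\<^sub>R p \<in> interior tri"
proof -
  have e: "{vs ! 0, vs ! Suc 0, vs ! 2} = {a, b, p}" using assms(1) set_vs by simp
  show ?thesis
    unfolding tri_def e interior_convex_hull_3_minimal[OF not_collinear[unfolded e] DIM_complex]
    using assms by blast
qed

lemma segment_between_corners:
  assumes "a \<in> set vs" "b \<in> set vs" "a \<noteq> b"
  shows "closed_segment a b \<subseteq> boundary vs"
proof -
  have "side vs 0 \<subseteq> boundary vs" "side vs (Suc 0) \<subseteq> boundary vs" "side vs 2 \<subseteq> boundary vs"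
    unfolding boundary_eq length_3 by (rule UN_upper, simp)+
  then show ?thesis using assms by (auto simp: set_vs side_eq closed_segment_commute)
qed

text \<open>Without its ends a side has a connected image free of corners, which stays on one side;
  closedness restores the ends. The map is arbitrary so that the lemma serves for both \<phi> and
  \<psi>.\<close>

lemma side_image_in_side:
  assumes B: "triangle B" and f: "continuous_on (boundary vs) f" "f ` boundary vs \<subseteq> boundary B"
    and corner: "\<And>z. z \<in> boundary vs \<Longrightarrow> f z \<in> set B \<Longrightarrow> z \<in> set vs" and i: "i < 3"
  shows "\<exists>j<3. f ` side vs i \<subseteq> side B j"
proof -
  interpret B: triangle B by (rule B)
  let ?a = "vs ! i" and ?b = "vs ! (Suc i mod 3)"
  have ab: "?a \<noteq> ?b" using side_vector_nz[of i] i length_3 by (auto simp: side_vector_def)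
  have side: "side vs i = closed_segment ?a ?b" by (simp add: side_def length_3)
  have sb: "side vs i \<subseteq> boundary vs" unfolding boundary_eq length_3 by (rule UN_upper) (use i in simp)
  obtain p where p: "set vs = {?a, ?b, p}" "p \<notin> side vs i" using sides_cover_corner[OF i] by blast
  have S: "open_segment ?a ?b \<inter> set vs = {}" "open_segment ?a ?b \<subseteq> side vs i"
    using p unfolding side open_segment_def by auto
  have conn: "connected (f ` open_segment ?a ?b)"
    by (intro connected_continuous_image continuous_on_subset[OF f(1)] convex_connected convex_open_segment)
      (use S sb in auto)
  have sub: "f ` open_segment ?a ?b \<subseteq> boundary B" using f(2) S(2) sb by blast
  have disj: "f ` open_segment ?a ?b \<inter> set B = {}" using corner S sb by blast
  have "midpoint ?a ?b \<in> open_segment ?a ?b" using ab by simp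
  then have m: "f (midpoint ?a ?b) \<in> f ` open_segment ?a ?b" by (rule imageI)
  then obtain j where j: "j < 3" "f (midpoint ?a ?b) \<in> side B j"
    using subsetD[OF sub m] unfolding B.boundary_eq B.length_3 by blast
  have "f ` open_segment ?a ?b \<subseteq> side B j"
    using B.connected_in_side[OF conn sub disj _ m j(2)] j(1) B.length_3 by simp
  then have "f ` closure (open_segment ?a ?b) \<subseteq> side B j"
    using ab by (intro image_closure_subset continuous_on_subset[OF f(1)] B.closed_side)
      (use sb side in auto)
  then show ?thesis using j(1) ab side by auto
qed

end

section \<open>The map of directions and the corners of Q\<close>

locale polygon_pair = order_pair +
  assumes angles_Q: "\<And>k. k < length Q \<Longrightarrow> interior_angle Q k \<noteq> pi"
begin

definition directions :: "complex set" where
  "directions = snd ` limit_set"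

text \<open>Any chord of the limit set with direction \<open>\<theta>\<close> gives the same value,
  by \<open>image_direction_const\<close>.\<close>

definition dir_map :: "complex \<Rightarrow> complex" where
  "dir_map \<theta> = image_direction (SOME u. u \<in> limit_set \<and> snd u = \<theta>)"

lemma finite_directions_set: "finite directions"
  unfolding directions_def by (rule invariant_setD(2)[OF invariant_limit_set])

lemma norm_directions: "\<theta> \<in> directions \<Longrightarrow> norm \<theta> = 1"
  unfolding directions_def using limit_set_phase_space phase_spaceD by blast

lemma directions_limit_set: "\<theta> \<in> directions \<Longrightarrow> u \<in> phase_space vs \<Longrightarrow> snd u = \<theta> \<Longrightarrow> u \<in> limit_set"
  unfolding directions_def by (metis imageE limit_set_direction)

lemma dir_map_eq: "u \<in> limit_set \<Longrightarrow> dir_map (snd u) = image_direction u"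
proof -
  assume u: "u \<in> limit_set"
  let ?v = "SOME v. v \<in> limit_set \<and> snd v = snd u"
  have "\<exists>v. v \<in> limit_set \<and> snd v = snd u" using u by blast
  then have v: "?v \<in> limit_set \<and> snd ?v = snd u" by (rule someI_ex)
  show ?thesis unfolding dir_map_def
    by (rule image_direction_const[OF u]) (use v limit_set_phase_space in simp_all)
qed

lemma exit_at:
  assumes th: "\<theta> \<in> directions" "slope i \<theta> < 0" and i: "i < 3" "z \<in> side vs i" "z \<notin> set vs"
  obtains u where "u \<in> limit_set" "snd u = \<theta>" "hit_point vs u = z"
    "billiard_map vs u = (z, side_reflection vs i \<theta>)" "billiard_map vs u \<in> limit_set"
proof -
  have "(z, - \<theta>) \<in> phase_space vs"
    using phase_space_side_iff[OF i] th norm_directions by simp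
  then have u: "flip vs (z, - \<theta>) \<in> phase_space vs" "hit_point vs (flip vs (z, - \<theta>)) = z"
    using flip_phase_space hit_point_flip by auto
  have K: "flip vs (z, - \<theta>) \<in> limit_set" using directions_limit_set[OF th(1) u(1)] by simp
  have T: "billiard_map vs (flip vs (z, - \<theta>)) = (z, side_reflection vs i \<theta>)"
    using billiard_map_eq[of i "flip vs (z, - \<theta>)"] i u(2) length_3 by simp
  have "billiard_map vs (flip vs (z, - \<theta>)) \<in> limit_set"
    using limit_set_invariant[OF u(1)] u(2) i(3) K by simp
  then show thesis using that[of "flip vs (z, - \<theta>)"] K u(2) T by simp
qed

text \<open>If \<open>\<theta>\<close> points towards side \<open>i\<close>, a chord of this
  direction is reflected there; if it points away, such a chord is traced one step back. The limit
  set is invariant both ways.\<close>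

lemma reflection_directions:
  assumes th: "\<theta> \<in> directions" "slope i \<theta> \<noteq> 0" and i: "i < 3"
  shows "side_reflection vs i \<theta> \<in> directions"
proof -
  obtain z where z: "z \<in> side vs i" "z \<notin> set vs" using side_noncorner_exists i length_3 by metis
  let ?\<theta> = "side_reflection vs i \<theta>"
  show ?thesis
  proof (cases "slope i \<theta> < 0")
    case True
    obtain u where "billiard_map vs u = (z, ?\<theta>)" "billiard_map vs u \<in> limit_set"
      by (rule exit_at[OF th(1) True i z]) blast
    then show ?thesis unfolding directions_def by (metis image_eqI snd_conv)
  next
    case False
    then have pos: "0 < slope i \<theta>" using th(2) by simp
    have nth: "norm \<theta> = 1" "norm ?\<theta> = 1" using norm_directions[OF th(1)] norm_side_reflection i length_3 by auto
    have "(z, - ?\<theta>) \<in> phase_space vs"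
      using phase_space_side_iff[OF i z] pos slope_reflection[OF i] nth by simp
    then have u: "flip vs (z, - ?\<theta>) \<in> phase_space vs" "hit_point vs (flip vs (z, - ?\<theta>)) = z"
      using flip_phase_space hit_point_flip by auto
    have T: "billiard_map vs (flip vs (z, - ?\<theta>)) = (z, \<theta>)"
      using billiard_map_eq[of i "flip vs (z, - ?\<theta>)"] i z u(2) length_3 side_reflection_involutive by simp
    have "(z, \<theta>) \<in> phase_space vs" using phase_space_side_iff[OF i z nth(1)] pos by simp
    then have "(z, \<theta>) \<in> limit_set" using directions_limit_set[OF th(1)] by simp
    then have "flip vs (z, - ?\<theta>) \<in> limit_set"
      using limit_set_invariant[OF u(1)] u(2) z(2) T by simp
    then show ?thesis unfolding directions_def by (metis image_eqI minus_minus snd_conv snd_flip)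
  qed
qed

lemma corner_of_Q:
  assumes c: "c \<in> set Q" shows "\<psi> c \<in> set vs"
proof (rule ccontr)
  assume nc: "\<psi> c \<notin> set vs"
  have cb: "c \<in> boundary Q" using c Q.corners_subset by blast
  obtain i where i: "i < 3" "\<psi> c \<in> side vs i"
    using \<psi>_boundary[OF cb] unfolding boundary_eq length_3 by blast
  obtain \<theta>' where \<theta>': "(\<psi> c, \<theta>') \<in> limit_set" using limit_set_over_side[OF i nc] .
  define \<theta> where "\<theta> = side_reflection vs i \<theta>'"
  have d': "\<theta>' \<in> directions" using \<theta>' unfolding directions_def by (metis image_eqI snd_conv)
  have "0 < slope i \<theta>'"
    using phase_space_side_iff[OF i nc norm_directions[OF d']] limit_set_phase_space[OF \<theta>'] by simp
  then have d: "\<theta> \<in> directions" "slope i \<theta> < 0"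
    using reflection_directions[OF d' _ i(1)] slope_reflection[OF i(1)] by (simp_all add: \<theta>_def)
  \<comment> \<open>Each side \<open>j\<close> of Q at \<open>c\<close> imposes its own reflection
    law: for a point \<open>y\<close> of side \<open>j\<close> close to \<open>c\<close>, the point
    \<open>\<psi> y\<close> is still in the interior of side \<open>i\<close>, where a chord of
    direction \<open>\<theta>\<close> ends.\<close>
  have law: "dir_map (side_reflection vs i \<theta>) = side_reflection Q j (dir_map \<theta>)"
    if j: "j < length Q" "c \<in> side Q j" for j
  proof -
    obtain e where e: "e > 0" "\<And>y. y \<in> boundary vs \<Longrightarrow> dist y (\<psi> c) < e \<Longrightarrow> y \<in> side vs i \<and> y \<notin> set vs"
      using side_noncorner_nbhd[OF _ i(2) nc] i(1) length_3 by auto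
    obtain d' where d': "d' > 0" "\<And>y. y \<in> boundary Q \<Longrightarrow> dist y c < d' \<Longrightarrow> dist (\<psi> y) (\<psi> c) < e"
      using continuous_\<psi> cb e(1) unfolding continuous_on_iff by blast
    have "Q ! j \<noteq> Q ! (Suc j mod length Q)" using Q.side_vector_nz[OF j(1)] by (auto simp: side_vector_def)
    then have "infinite (side Q j \<inter> ball c d')"
      using infinite_segment_ball j(2) d'(1) unfolding side_def by blast
    then have "infinite ((side Q j \<inter> ball c d') - set Q)" using Diff_infinite_finite by blast
    then obtain y where y: "y \<in> side Q j" "y \<in> ball c d'" "y \<notin> set Q"
      by (metis Diff_iff IntE ex_in_conv finite.emptyI)
    have yb: "y \<in> boundary Q" using y(1) j(1) unfolding Q.boundary_eq by blast
    have z: "\<psi> y \<in> side vs i" "\<psi> y \<notin> set vs"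
      using e(2)[OF \<psi>_boundary[OF yb] d'(2)[OF yb]] y(2) by (auto simp: dist_commute)
    obtain u where u: "u \<in> limit_set" "snd u = \<theta>" "hit_point vs u = \<psi> y"
      "billiard_map vs u = (\<psi> y, side_reflection vs i \<theta>)" "billiard_map vs u \<in> limit_set"
      by (rule exit_at[OF d i(1) z])
    have "image_direction (billiard_map vs u) = side_reflection Q j (image_direction u)"
      using image_direction_reflection[OF u(1) _ j(1)] u(3) z(2) y \<phi>\<psi>[OF yb] by simp
    then show ?thesis
      using dir_map_eq[OF u(5)] dir_map_eq[OF u(1)] unfolding u(2) u(4) by simp
  qed
  obtain k where k: "k < length Q" "c = Q ! k" using c by (auto simp: in_set_conv_nth)
  define k' where "k' = (k + length Q - 1) mod length Q"
  have k': "k' < length Q" "Suc k' mod length Q = k"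
    unfolding k'_def using predecessor_mod[OF k(1)] by blast+
  have "c \<in> side Q k" "c \<in> side Q k'" using k k' by (auto simp: side_def)
  then have "side_reflection Q k (dir_map \<theta>) = side_reflection Q k' (dir_map \<theta>)"
    using law k k' by metis
  moreover have "dir_map \<theta> \<noteq> 0"
  proof -
    obtain u where "u \<in> limit_set" "snd u = \<theta>" using d(1) by (auto simp: directions_def)
    then have "norm (dir_map \<theta>) = 1" using dir_map_eq norm_image_direction limit_set_phase_space by metis
    then show ?thesis by auto
  qed
  ultimately have "side_vector Q k / cnj (side_vector Q k) = side_vector Q k' / cnj (side_vector Q k')"
    unfolding side_reflection_def Let_def by (metis mult_cancel_right complex_cnj_zero_iff)
  then show False using Q.adjacent_sides_not_parallel[OF k(1) angles_Q[OF k(1)] k'_def] by simp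
qed

lemma triangle_Q: "length Q = 3" and corners_Q: "set Q = \<phi> ` set vs"
proof -
  have sub: "set Q \<subseteq> \<phi> ` set vs"
  proof
    fix c assume c: "c \<in> set Q"
    then have "c = \<phi> (\<psi> c)" using \<phi>\<psi> Q.corners_subset by auto
    then show "c \<in> \<phi> ` set vs" using corner_of_Q[OF c] by blast
  qed
  have "card (set Q) = length Q" using Q.distinct_corners by (rule distinct_card)
  moreover have le: "card (\<phi> ` set vs) \<le> 3"
    using card_image_le[of "set vs" \<phi>] card_length[of vs] length_3 by simp
  moreover have "card (set Q) \<le> card (\<phi> ` set vs)" using sub by (intro card_mono) auto
  ultimately show l: "length Q = 3" using Q.length_ge by simp
  show "set Q = \<phi> ` set vs"
    using sub le l \<open>card (set Q) = length Q\<close> by (intro card_seteq) auto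
qed

end

section \<open>The intertwining map\<close>

lemma inner_reflection: "inner (\<rho> * cnj y) z = inner y (\<rho> * cnj z)" for \<rho> y z :: complex
  by (simp add: inner_complex_def algebra_simps)

lemma similar_hulls:
  fixes v V :: "nat \<Rightarrow> complex"
  assumes L: "linear L" "\<And>z. norm (L z) = r * norm z" "0 < r"
    and V: "\<And>i. i \<in> I \<Longrightarrow> L (V i - V0) = v i - v0"
  shows "similar (convex hull (V ` I)) (convex hull (v ` I))"
proof -
  define f where "f z = v0 + L (z - V0)" for z
  have "dist (f x) (f y) = r * dist x y" for x y
    using L(2)[of "x - y"] linear_diff[OF L(1), of "x - V0" "y - V0"] by (simp add: f_def dist_norm)
  moreover have "f ` (convex hull (V ` I)) = convex hull (v ` I)"
  proof -
    have "f ` S = (+) v0 ` L ` (+) (- V0) ` S" for S by (auto simp: f_def image_image)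
    then have "f ` (convex hull (V ` I)) = convex hull (f ` V ` I)"
      by (simp only: convex_hull_translation[symmetric] convex_hull_linear_image[OF L(1)])
    also have "f ` V ` I = v ` I" using V by (force simp: f_def image_iff)
    finally show ?thesis .
  qed
  ultimately show ?thesis unfolding similar_def using L(3) by blast
qed

lemma (in triangle) slope_eq_0_iff: "slope i z = 0 \<longleftrightarrow> Im (cnj (side_vector vs i) * z) = 0"
  by (simp only: slope_def mult_eq_0_iff sgn_zero_iff area_nz simp_thms)

text \<open>\<open>a\<close> and \<open>b\<close> are linearly independent, so every linear relation
  between the sides of a triangle is proportional to the closing one.\<close>

lemma real_multiples_closing:
  fixes a b c :: complex and p q r :: real
  assumes "a + b + c = 0" "p *\<^sub>R a + q *\<^sub>R b + r *\<^sub>R c = 0" "Im (cnj a * b) \<noteq> 0"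
  shows "p = r" "q = r"
proof -
  have c: "c = - a - b" using assms(1) by (simp add: algebra_simps eq_neg_iff_add_eq_0)
  have e: "(p - r) *\<^sub>R a + (q - r) *\<^sub>R b = 0" using assms(2) unfolding c by (simp add: algebra_simps)
  have "Im (cnj a * ((p - r) *\<^sub>R a + (q - r) *\<^sub>R b)) = (q - r) * Im (cnj a * b)" by (simp add: algebra_simps)
  then show q: "q = r" using e assms(3) by simp
  have "Im (cnj b * ((p - r) *\<^sub>R a + (q - r) *\<^sub>R b)) = - (p - r) * Im (cnj a * b)" by (simp add: algebra_simps)
  then show "p = r" using e assms(3) by simp
qed

context polygon_pair
begin

lemma Q_triangle: "triangle Q"
  using Q.simple_polygon_axioms triangle_Q by (simp add: triangle_def triangle_axioms_def)

sublocale QT: triangle Q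
  by (rule Q_triangle)

text \<open>The corner lists of P and Q may start at different corners, so corresponding sides need
  not have equal indices.\<close>

definition side_index :: "nat \<Rightarrow> nat" where
  "side_index i = (SOME j. j < 3 \<and> \<phi> ` side vs i \<subseteq> side Q j)"

lemma side_index:
  assumes i: "i < 3" shows "side_index i < 3" "\<phi> ` side vs i \<subseteq> side Q (side_index i)"
proof -
  have "\<exists>j<3. \<phi> ` side vs i \<subseteq> side Q j"
    by (rule side_image_in_side[OF Q_triangle continuous_\<phi> _ _ i])
      (use \<phi>_boundary corner_of_Q \<psi>\<phi> in fastforce)+
  then have "side_index i < 3 \<and> \<phi> ` side vs i \<subseteq> side Q (side_index i)"
    unfolding side_index_def by (rule someI_ex)
  then show "side_index i < 3" "\<phi> ` side vs i \<subseteq> side Q (side_index i)" by auto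
qed

lemma noncorner_image: "z \<in> boundary vs \<Longrightarrow> z \<notin> set vs \<Longrightarrow> \<phi> z \<notin> set Q"
  using corner_of_Q \<psi>\<phi> by metis

lemma side_boundary: "i < 3 \<Longrightarrow> side vs i \<subseteq> boundary vs"
  unfolding boundary_eq length_3 by (rule UN_upper) simp

lemma side_index_inverse:
  assumes i: "i < 3" and y: "y \<in> side Q (side_index i)" shows "\<psi> y \<in> side vs i"
proof -
  have j: "side_index i < 3" using side_index[OF i] by simp
  have "\<exists>k<3. \<psi> ` side Q (side_index i) \<subseteq> side vs k"
  proof (rule QT.side_image_in_side[OF _ continuous_\<psi> _ _ j])
    show "triangle vs" ..
    show "\<psi> ` boundary Q \<subseteq> boundary vs" using \<psi>_boundary by blast
    show "y \<in> set Q" if "y \<in> boundary Q" "\<psi> y \<in> set vs" for y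
      using corners_Q \<phi>\<psi>[OF that(1)] that(2) by (metis imageI)
  qed
  then obtain k where k: "k < 3" "\<psi> ` side Q (side_index i) \<subseteq> side vs k" by blast
  have "side vs i \<subseteq> side vs k"
  proof
    fix z assume z: "z \<in> side vs i"
    then have "\<phi> z \<in> side Q (side_index i)" using side_index(2)[OF i] by blast
    then have "\<psi> (\<phi> z) \<in> side vs k" using k(2) by blast
    then show "z \<in> side vs k" using \<psi>\<phi> side_boundary[OF i] z by auto
  qed
  then have "k = i" using not_side_subset i k(1) by blast
  then show ?thesis using k(2) y by blast
qed

text \<open>Directed by the corners of P, so that the three vectors sum to zero; compared with the
  side vector of Q its sign is left open, which does not affect the reflection.\<close>

definition image_side :: "nat \<Rightarrow> complex" where
  "image_side i = \<phi> (vs ! (Suc i mod 3)) - \<phi> (vs ! i)"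

lemma image_side_eq:
  assumes i: "i < 3"
  shows "image_side i = side_vector Q (side_index i) \<or> image_side i = - side_vector Q (side_index i)"
proof -
  let ?j = "side_index i"
  let ?a = "vs ! i" and ?b = "vs ! (Suc i mod 3)"
  have j: "?j < 3" using side_index i by blast
  have ab: "?a \<noteq> ?b" "?a \<in> set vs" "?b \<in> set vs" "?a \<in> side vs i" "?b \<in> side vs i"
    using side_vector_nz[of i] i length_3 by (auto simp: side_vector_def side_def)
  obtain p where p: "set Q = {Q ! ?j, Q ! (Suc ?j mod 3), p}" "p \<notin> side Q ?j"
    using QT.sides_cover_corner[OF j] by blast
  have "\<phi> ?a \<in> {Q ! ?j, Q ! (Suc ?j mod 3)}" "\<phi> ?b \<in> {Q ! ?j, Q ! (Suc ?j mod 3)}"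
    using p corners_Q ab side_index(2)[OF i] by blast+
  moreover have "\<phi> ?a \<noteq> \<phi> ?b" using \<phi>_inj ab corners_subset by blast
  ultimately show ?thesis unfolding image_side_def side_vector_def triangle_Q by auto
qed

lemma image_side_reflection:
  assumes "i < 3"
  shows "side_reflection Q (side_index i) z = image_side i / cnj (image_side i) * cnj z"
  using image_side_eq[OF assms] by (auto simp: side_reflection_def Let_def)

text \<open>Chords parallel to a side converge to the side itself. Their image directions are
  constant, so the image of the side has the same direction. This settles the directions whose
  chords never hit that side.\<close>

lemma dir_map_along_side:
  assumes abp: "set vs = {a, b, p}" "a \<noteq> b" "p \<noteq> a" "p \<noteq> b" and d: "sgn (b - a) \<in> directions"
  shows "dir_map (sgn (b - a)) = sgn (\<phi> b - \<phi> a)"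
proof -
  define \<theta> where "\<theta> = sgn (b - a)"
  define en ex where "en t = (1 - t) *\<^sub>R a + t *\<^sub>R p" and "ex t = (1 - t) *\<^sub>R b + t *\<^sub>R p" for t
  have seg: "closed_segment a p \<subseteq> boundary vs" "closed_segment b p \<subseteq> boundary vs"
    using segment_between_corners abp by blast+
  have bd: "en t \<in> boundary vs" "ex t \<in> boundary vs" if "0 \<le> t" "t \<le> 1" for t
  proof -
    have "en t \<in> closed_segment a p" "ex t \<in> closed_segment b p"
      unfolding en_def ex_def in_segment using that by blast+
    then show "en t \<in> boundary vs" "ex t \<in> boundary vs" using seg by blast+
  qed
  have nth: "norm \<theta> = 1" using abp(2) by (simp add: \<theta>_def norm_sgn)
  define G where "G t = sgn (\<phi> (ex t) - \<phi> (en t))" for t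
  have G: "G t = dir_map \<theta>" if t: "t \<in> {0<..1/2}" for t
  proof -
    define \<tau> where "\<tau> = (1 - t) * norm (b - a)"
    have \<tau>: "0 < \<tau>" using t abp(2) by (simp add: \<tau>_def)
    have "\<tau> *\<^sub>R \<theta> = (1 - t) *\<^sub>R (b - a)" using abp(2) by (simp add: \<tau>_def \<theta>_def sgn_div_norm)
    then have ex: "en t + \<tau> *\<^sub>R \<theta> = ex t" by (simp add: en_def ex_def algebra_simps)
    have half: "(\<tau> / 2) *\<^sub>R \<theta> = ((1 - t) / 2) *\<^sub>R (b - a)"
      using abp(2) by (simp add: \<tau>_def \<theta>_def sgn_div_norm)
    have "en t + (\<tau> / 2) *\<^sub>R \<theta> = ((1 - t) / 2) *\<^sub>R a + ((1 - t) / 2) *\<^sub>R b + t *\<^sub>R p"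
    proof -
      have "(1 - t) *\<^sub>R a = ((1 - t) / 2) *\<^sub>R a + ((1 - t) / 2) *\<^sub>R a" by (simp flip: scaleR_add_left)
      then show ?thesis unfolding half en_def by (simp add: scaleR_diff_right)
    qed
    moreover have "\<dots> \<in> interior tri" using t by (intro interior_combination[OF abp(1)]) (auto simp: field_simps)
    ultimately have mid: "en t + (\<tau> / 2) *\<^sub>R \<theta> \<in> interior tri" by simp
    have bt: "en t \<in> boundary vs" "ex t \<in> boundary vs" using bd[of t] t by auto
    have ps: "(en t, \<theta>) \<in> phase_space vs" "hit_point vs (en t, \<theta>) = ex t"
      using chord_phase_space[OF bt(1) _ nth \<tau> mid] bt(2) by (simp_all add: ex)
    have "(en t, \<theta>) \<in> limit_set" using directions_limit_set[OF d ps(1)] by (simp add: \<theta>_def)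
    then show ?thesis using dir_map_eq[of "(en t, \<theta>)"] ps(2) by (simp add: image_direction_def G_def)
  qed
  have cont: "continuous_on {0..1/2} G"
    unfolding G_def
  proof (intro continuous_on_sgn continuous_on_diff ballI)
    show "continuous_on {0..1/2} (\<lambda>t. \<phi> (ex t))" "continuous_on {0..1/2} (\<lambda>t. \<phi> (en t))"
      using bd by (auto intro!: continuous_on_compose2[OF continuous_\<phi>] continuous_intros simp: en_def ex_def)
    fix t :: real assume t: "t \<in> {0..1/2}"
    have "ex t - en t = (1 - t) *\<^sub>R (b - a)" by (simp add: ex_def en_def algebra_simps)
    then have "ex t \<noteq> en t" using t abp(2) by auto
    then show "\<phi> (ex t) - \<phi> (en t) \<noteq> 0" using \<phi>_inj bd[of t] t by auto
  qed
  have cl: "closure {0<..1/2} = {0..1/2::real}" by simp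
  have "G 0 = dir_map \<theta>"
    by (rule continuous_constant_on_closure[of "{0<..1/2}"]) (use cont G in \<open>simp_all add: cl\<close>)
  then show ?thesis by (simp add: G_def en_def ex_def \<theta>_def)
qed

lemma reflection_fixes_parallel:
  assumes "i < 3" "slope i \<theta> = 0" shows "side_reflection vs i \<theta> = \<theta>"
proof -
  have w: "side_vector vs i \<noteq> 0" using side_vector_nz assms length_3 by simp
  have "Im (cnj (side_vector vs i) * \<theta>) = 0" using assms(2) slope_eq_0_iff by blast
  then obtain r where "\<theta> = r *\<^sub>R side_vector vs i" using w by (rule Im_cnj_mult_eq_0)
  then show ?thesis using w by (simp add: side_reflection_def Let_def)
qed

text \<open>A negative slope means that chords of direction \<open>\<theta>\<close> really are
  reflected at side \<open>i\<close>. A positive slope reduces to this because reflections are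
  involutions, and slope zero to \<open>dir_map_along_side\<close>, both reflections then fixing the
  direction.\<close>

lemma dir_map_reflection:
  assumes th: "\<theta> \<in> directions" and i: "i < 3"
  shows "side_reflection vs i \<theta> \<in> directions"
    and "dir_map (side_reflection vs i \<theta>) = side_reflection Q (side_index i) (dir_map \<theta>)"
proof -
  have neg: "dir_map (side_reflection vs i \<theta>) = side_reflection Q (side_index i) (dir_map \<theta>)"
    if th: "\<theta> \<in> directions" "slope i \<theta> < 0" for \<theta>
  proof -
    obtain z where z: "z \<in> side vs i" "z \<notin> set vs" using side_noncorner_exists i length_3 by metis
    obtain u where u: "u \<in> limit_set" "snd u = \<theta>" "hit_point vs u = z"
      "billiard_map vs u = (z, side_reflection vs i \<theta>)" "billiard_map vs u \<in> limit_set"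
      by (rule exit_at[OF th i z])
    have zb: "z \<in> boundary vs" using side_boundary[OF i] z by blast
    have "image_direction (billiard_map vs u) = side_reflection Q (side_index i) (image_direction u)"
      using image_direction_reflection[OF u(1), of "side_index i"] u(3) z side_index[OF i] noncorner_image[OF zb] triangle_Q
      by auto
    then show ?thesis using dir_map_eq[OF u(5)] dir_map_eq[OF u(1)] unfolding u(2) u(4) by simp
  qed
  have si: "side_index i < length Q" using side_index(1)[OF i] triangle_Q by simp
  consider "slope i \<theta> < 0" | "slope i \<theta> > 0" | "slope i \<theta> = 0" by linarith
  then have "side_reflection vs i \<theta> \<in> directions \<and>
      dir_map (side_reflection vs i \<theta>) = side_reflection Q (side_index i) (dir_map \<theta>)"
  proof cases
    case 1
    then show ?thesis using neg[OF th] reflection_directions[OF th _ i] by simp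
  next
    case 2
    then have d: "side_reflection vs i \<theta> \<in> directions" using reflection_directions[OF th _ i] by simp
    moreover have "slope i (side_reflection vs i \<theta>) < 0" using 2 slope_reflection[OF i] by simp
    ultimately have "dir_map \<theta> = side_reflection Q (side_index i) (dir_map (side_reflection vs i \<theta>))"
      using neg[of "side_reflection vs i \<theta>"] side_reflection_involutive[of i \<theta>] i length_3 by simp
    then have "side_reflection Q (side_index i) (dir_map \<theta>) = dir_map (side_reflection vs i \<theta>)"
      using Q.side_reflection_involutive[OF si] by metis
    then show ?thesis using d by simp
  next
    case 3
    let ?a = "vs ! i" and ?b = "vs ! (Suc i mod 3)"
    have fixed: "side_reflection vs i \<theta> = \<theta>" using reflection_fixes_parallel[OF i 3] .
    obtain p where p: "set vs = {?a, ?b, p}" "p \<notin> side vs i" using sides_cover_corner[OF i] by blast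
    have w: "side_vector vs i \<noteq> 0" "side_vector vs i = ?b - ?a"
      using side_vector_nz[of i] i length_3 by (auto simp: side_vector_def)
    have ab: "?a \<noteq> ?b" using w by auto
    have pp: "p \<noteq> ?a" "p \<noteq> ?b" using p(2) by (auto simp: side_def length_3)
    have "Im (cnj (side_vector vs i) * \<theta>) = 0" using 3 slope_eq_0_iff by blast
    then obtain r where r: "\<theta> = r *\<^sub>R (?b - ?a)" using w by (metis Im_cnj_mult_eq_0)
    have nth: "norm \<theta> = 1" using norm_directions[OF th] .
    have "sgn \<theta> = \<theta>" using nth by (simp add: sgn_div_norm)
    then have rs: "\<theta> = sgn r *\<^sub>R sgn (?b - ?a)" unfolding r by (simp add: sgn_scaleR)
    have "r \<noteq> 0" using r nth by auto
    then consider "\<theta> = sgn (?b - ?a)" | "\<theta> = sgn (?a - ?b)"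
      using rs sgn_minus[of "?b - ?a"] by (cases "r > 0") auto
    then have "dir_map \<theta> = sgn (image_side i) \<or> dir_map \<theta> = sgn (- image_side i)"
    proof cases
      case 1
      then show ?thesis using dir_map_along_side[OF p(1) ab pp] th by (simp add: image_side_def)
    next
      case 2
      have "set vs = {?b, ?a, p}" using p(1) by blast
      then show ?thesis using 2 dir_map_along_side[OF _ ab[symmetric] pp(2,1)] th by (simp add: image_side_def)
    qed
    then have "side_reflection Q (side_index i) (dir_map \<theta>) = dir_map \<theta>"
      unfolding image_side_reflection[OF i] by (auto simp: sgn_div_norm scaleR_conv_of_real)
    then show ?thesis using fixed th by simp
  qed
  then show "side_reflection vs i \<theta> \<in> directions"
    "dir_map (side_reflection vs i \<theta>) = side_reflection Q (side_index i) (dir_map \<theta>)" by auto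
qed

text \<open>By equivariance of \<open>dir_map\<close>, this real-linear map intertwines each side reflection of \<open>P\<close>
  with the corresponding one of \<open>Q\<close>; so it maps the sides of \<open>P\<close> and their normals to multiples of
  the sides of \<open>Q\<close> and their normals.\<close>

definition twine :: "complex \<Rightarrow> complex" where
  "twine z = (\<Sum>\<theta>\<in>directions. inner z \<theta> *\<^sub>R dir_map \<theta>)"

lemma linear_twine: "linear twine"
  by (rule linearI)
    (simp_all add: twine_def inner_add_left scaleR_add_left sum.distrib scaleR_sum_right)

text \<open>A reflection is self-adjoint and permutes \<open>directions\<close>; substituting the
  reflected direction in the sum moves the reflection through \<open>dir_map\<close>.\<close>

lemma twine_reflection:
  assumes i: "i < 3"
  shows "twine (side_reflection vs i z) = side_reflection Q (side_index i) (twine z)"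
proof -
  let ?r = "side_reflection vs i" and ?R = "side_reflection Q (side_index i)"
  have inv: "?r (?r \<theta>) = \<theta>" for \<theta> using side_reflection_involutive i length_3 by simp
  have linR: "linear ?R"
    by (rule linearI)
      (simp_all add: side_reflection_def Let_def scaleR_conv_of_real algebra_simps add_divide_distrib)
  have "twine (?r z) = (\<Sum>\<theta>\<in>directions. inner z (?r \<theta>) *\<^sub>R dir_map \<theta>)"
    unfolding twine_def side_reflection_def Let_def inner_reflection ..
  also have "\<dots> = (\<Sum>\<theta>\<in>directions. inner z \<theta> *\<^sub>R dir_map (?r \<theta>))"
    by (rule sum.reindex_bij_witness[of _ ?r ?r]) (use inv dir_map_reflection(1)[OF _ i] in auto)
  also have "\<dots> = (\<Sum>\<theta>\<in>directions. ?R (inner z \<theta> *\<^sub>R dir_map \<theta>))"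
    using dir_map_reflection(2)[OF _ i] linear_scale[OF linR] by (intro sum.cong) auto
  also have "\<dots> = ?R (twine z)" unfolding twine_def by (rule linear_sum[OF linR, symmetric])
  finally show ?thesis .
qed

text \<open>A chord leaving side \<open>i\<close> ends off that side, so its image starts at
  elevation zero over the image side and ends at positive elevation. Negative slopes follow by
  reflecting.\<close>

lemma dir_map_slope:
  assumes th: "\<theta> \<in> directions" and i: "i < 3"
  shows "0 < slope i \<theta> \<Longrightarrow> 0 < QT.slope (side_index i) (dir_map \<theta>)"
    "slope i \<theta> < 0 \<Longrightarrow> QT.slope (side_index i) (dir_map \<theta>) < 0"
proof -
  let ?j = "side_index i"
  have j: "?j < 3" using side_index i by blast
  have pos: "0 < QT.slope ?j (dir_map \<theta>)" if th: "\<theta> \<in> directions" "0 < slope i \<theta>" for \<theta>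
  proof -
    obtain z where z: "z \<in> side vs i" "z \<notin> set vs" using side_noncorner_exists i length_3 by metis
    have u: "(z, \<theta>) \<in> phase_space vs" using phase_space_side_iff[OF i z norm_directions[OF th(1)]] th(2) by simp
    have K: "(z, \<theta>) \<in> limit_set" using directions_limit_set[OF th(1) u] by simp
    let ?y = "hit_point vs (z, \<theta>)"
    have yb: "?y \<in> boundary vs" using hit_point_boundary[OF u] .
    have "?y \<notin> side vs i" using hit_other_side[OF u i] z by simp
    then have "\<phi> ?y \<notin> side Q ?j" using side_index_inverse[OF i, of "\<phi> ?y"] \<psi>\<phi>[OF yb] by auto
    then have "QT.elev ?j (\<phi> ?y) \<noteq> 0" using QT.elev_0_side[OF \<phi>_boundary[OF yb] j] by blast
    moreover have "0 \<le> QT.elev ?j (\<phi> ?y)"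
      using QT.boundary_tri QT.tri_iff \<phi>_boundary[OF yb] j by blast
    moreover have "QT.elev ?j (\<phi> z) = 0" using side_index(2)[OF i] z QT.elev_side by blast
    moreover have "\<phi> ?y = \<phi> z + dist (\<phi> z) (\<phi> ?y) *\<^sub>R dir_map \<theta>"
      using image_direction_scale[of "(z, \<theta>)"] dir_map_eq[OF K] by simp
    then have "QT.elev ?j (\<phi> ?y) = QT.elev ?j (\<phi> z) + dist (\<phi> z) (\<phi> ?y) * QT.slope ?j (dir_map \<theta>)"
      by (metis QT.elev_line)
    ultimately have "0 < dist (\<phi> z) (\<phi> ?y) * QT.slope ?j (dir_map \<theta>)" by linarith
    then show ?thesis by (simp add: zero_less_mult_iff)
  qed
  show "0 < slope i \<theta> \<Longrightarrow> 0 < QT.slope ?j (dir_map \<theta>)" using pos th by blast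
  show "QT.slope ?j (dir_map \<theta>) < 0" if "slope i \<theta> < 0"
    using pos[OF dir_map_reflection(1)[OF th i]] slope_reflection[OF i] that
      dir_map_reflection(2)[OF th i] QT.slope_reflection[OF j] by simp
qed

text \<open>Evaluated at the inward normal \<open>?N\<close> of side 0 and measured by the slope in
  Q, the sum has only nonnegative terms, since \<open>dir_map\<close> preserves the signs of slopes;
  a limit chord starting on side 0 makes one of them positive.\<close>

lemma twine_nonzero: "\<exists>z. twine z \<noteq> 0"
proof -
  let ?N = "sgn area *\<^sub>R (\<i> * side_vector vs 0)"
  have inn: "inner ?N z = slope 0 z" for z
    by (simp add: slope_def inner_complex_def algebra_simps)
  have "QT.slope (side_index 0) (twine ?N) = (\<Sum>\<theta>\<in>directions. slope 0 \<theta> * QT.slope (side_index 0) (dir_map \<theta>))"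
    unfolding twine_def inn linear_sum[OF QT.linear_slope] by simp
  also have "\<dots> > 0"
  proof -
    have nn: "0 \<le> slope 0 \<theta> * QT.slope (side_index 0) (dir_map \<theta>)" if "\<theta> \<in> directions" for \<theta>
      using dir_map_slope[OF that, of 0]
      by (cases "slope 0 \<theta>" "0::real" rule: linorder_cases) (auto intro: mult_nonpos_nonpos less_imp_le)
    obtain z where z: "z \<in> side vs 0" "z \<notin> set vs" using side_noncorner_exists[of 0] length_3 by auto
    obtain \<theta> where \<theta>: "(z, \<theta>) \<in> limit_set" by (rule limit_set_over_side[OF _ z]) simp_all
    have d: "\<theta> \<in> directions" using \<theta> unfolding directions_def by (metis image_eqI snd_conv)
    have "0 < slope 0 \<theta>" using phase_space_side_iff[OF _ z norm_directions[OF d]] limit_set_phase_space[OF \<theta>] by simp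
    then have "0 < slope 0 \<theta> * QT.slope (side_index 0) (dir_map \<theta>)" using dir_map_slope(1)[OF d, of 0] by simp
    then show ?thesis using nn d finite_directions_set by (intro sum_pos2[of _ \<theta>]) auto
  qed
  finally have "twine ?N \<noteq> 0" by (auto simp: QT.slope_def)
  then show ?thesis by blast
qed

section \<open>From the intertwining map to the similarity\<close>

lemma image_side_nz: "i < 3 \<Longrightarrow> image_side i \<noteq> 0"
  using image_side_eq[of i] Q.side_vector_nz[of "side_index i"] side_index(1)[of i] triangle_Q by auto

lemma twine_complex:
  obtains \<alpha> \<beta> where "\<And>z. twine z = \<alpha> * z + \<beta> * cnj z" "\<alpha> \<noteq> 0 \<or> \<beta> \<noteq> 0"
proof -
  define \<alpha> where "\<alpha> = (twine 1 - \<i> * twine \<i>) / 2"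
  define \<beta> where "\<beta> = (twine 1 + \<i> * twine \<i>) / 2"
  have t: "twine z = \<alpha> * z + \<beta> * cnj z" for z
  proof -
    have "twine z = twine (Re z *\<^sub>R 1 + Im z *\<^sub>R \<i>)"
      by (rule arg_cong[where f = twine]) (simp add: complex_eq_iff)
    also have "\<dots> = Re z *\<^sub>R twine 1 + Im z *\<^sub>R twine \<i>"
      by (simp only: linear_add[OF linear_twine] linear_scale[OF linear_twine])
    also have "\<dots> = \<alpha> * z + \<beta> * cnj z"
      by (simp add: \<alpha>_def \<beta>_def complex_eq_iff field_simps)
    finally show ?thesis .
  qed
  have "\<alpha> \<noteq> 0 \<or> \<beta> \<noteq> 0" using twine_nonzero t by auto
  then show thesis using that t by blast
qed

text \<open>The reflection fixes the side vector \<open>d\<close> and negates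
  \<open>\<i> * d\<close>. So \<open>twine d\<close> and \<open>- \<i> * twine (\<i> * d)\<close>
  are both parallel to the image side; their half sum is \<open>\<alpha> * d\<close> and their half
  difference is \<open>\<beta> * cnj d\<close>.\<close>

lemma twine_side:
  assumes i: "i < 3" and t: "\<And>z. twine z = \<alpha> * z + \<beta> * cnj z"
  obtains p q where "\<alpha> * side_vector vs i = p *\<^sub>R image_side i" "\<beta> * cnj (side_vector vs i) = q *\<^sub>R image_side i"
proof -
  let ?d = "side_vector vs i" and ?D = "image_side i"
  have d: "?d \<noteq> 0" using side_vector_nz i length_3 by simp
  have D: "?D \<noteq> 0" using image_side_nz i .
  have fixed: "\<exists>l. x = l *\<^sub>R ?D" if "?D / cnj ?D * cnj x = x" for x
  proof -
    have "cnj (cnj ?D * x) = cnj ?D * x" using that D by (simp add: field_simps)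
    then have "Im (cnj ?D * x) = 0" by (metis cnj.simps(2) neg_equal_zero)
    then show ?thesis using D by (metis Im_cnj_mult_eq_0)
  qed
  have "side_reflection vs i ?d = ?d" using d by (simp add: side_reflection_def Let_def)
  then have "?D / cnj ?D * cnj (twine ?d) = twine ?d"
    using twine_reflection[OF i, of ?d] image_side_reflection[OF i] by simp
  then obtain l where l: "twine ?d = l *\<^sub>R ?D" using fixed by blast
  have "side_reflection vs i (\<i> * ?d) = - (\<i> * ?d)" using d by (simp add: side_reflection_def Let_def)
  then have "twine (- (\<i> * ?d)) = ?D / cnj ?D * cnj (twine (\<i> * ?d))"
    using twine_reflection[OF i, of "\<i> * ?d"] image_side_reflection[OF i] by simp
  then have "- twine (\<i> * ?d) = ?D / cnj ?D * cnj (twine (\<i> * ?d))"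
    using linear_neg[OF linear_twine] by simp
  moreover have "?D / cnj ?D * cnj (- \<i> * twine (\<i> * ?d)) = \<i> * (?D / cnj ?D * cnj (twine (\<i> * ?d)))"
    by simp
  ultimately have "?D / cnj ?D * cnj (- \<i> * twine (\<i> * ?d)) = \<i> * - twine (\<i> * ?d)" by (simp only:)
  then have "?D / cnj ?D * cnj (- \<i> * twine (\<i> * ?d)) = - \<i> * twine (\<i> * ?d)" by simp
  then obtain m where m: "- \<i> * twine (\<i> * ?d) = m *\<^sub>R ?D" using fixed by blast
  have "2 * (\<alpha> * ?d) = twine ?d + - \<i> * twine (\<i> * ?d)" "2 * (\<beta> * cnj ?d) = twine ?d - - \<i> * twine (\<i> * ?d)"
    unfolding t by (simp_all add: algebra_simps)
  then have "2 * (\<alpha> * ?d) = (l + m) *\<^sub>R ?D" "2 * (\<beta> * cnj ?d) = (l - m) *\<^sub>R ?D"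
    unfolding l m by (simp_all add: algebra_simps)
  then have "\<alpha> * ?d = ((l + m) / 2) *\<^sub>R ?D" "\<beta> * cnj ?d = ((l - m) / 2) *\<^sub>R ?D"
    by (simp_all add: scaleR_conv_of_real field_simps)
  then show thesis by (rule that)
qed

text \<open>\<open>g\<close> stands for the identity or conjugation, so that either part of
  \<open>twine\<close> can be used, provided its coefficient \<gamma> is nonzero. The closing
  relation makes the factors \<open>p i\<close> equal; \<open>L\<close> inverts the map on the
  sides, as the similarity leads from Q to P.\<close>

lemma image_sides_similar:
  assumes g: "\<And>y z. g (y + z) = g y + g z" "\<And>z. cmod (g z) = cmod z" "\<And>c z. g (c *\<^sub>R z) = c *\<^sub>R g z"
    and gg: "\<And>z. g (g z) = z"
    and \<gamma>: "\<gamma> \<noteq> 0" and p: "\<And>i. i < 3 \<Longrightarrow> \<gamma> * g (side_vector vs i) = p i *\<^sub>R image_side i"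
  shows "similar (table Q) (table vs)"
proof -
  have g0: "g z = 0 \<longleftrightarrow> z = 0" for z using g(2)[of z] by (metis norm_eq_zero)
  have p0: "p i \<noteq> 0" if "i < 3" for i
  proof
    assume "p i = 0"
    then have "g (side_vector vs i) = 0" using p[OF that] \<gamma> by simp
    then show False using g0 side_vector_nz[of i] that length_3 by simp
  qed
  have D': "g (image_side i / \<gamma>) = (1 / p i) *\<^sub>R side_vector vs i" if i: "i < 3" for i
  proof -
    have "image_side i = (1 / p i) *\<^sub>R (p i *\<^sub>R image_side i)" using p0[OF i] by simp
    also have "\<dots> = (1 / p i) *\<^sub>R (\<gamma> * g (side_vector vs i))" by (simp only: p[OF i])
    finally have "image_side i / \<gamma> = (1 / p i) *\<^sub>R g (side_vector vs i)"
      using \<gamma> by (simp add: scaleR_conv_of_real)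
    then show ?thesis by (simp only: g(3) gg)
  qed
  have g00: "g 0 = 0" using g0 by simp
  have "image_side 0 + image_side (Suc 0) + image_side 2 = 0"
    by (simp add: image_side_def Suc_mod_3)
  then have "g ((image_side 0 + image_side (Suc 0) + image_side 2) / \<gamma>) = 0" using g00 by simp
  then have "(1 / p 0) *\<^sub>R side_vector vs 0 + (1 / p (Suc 0)) *\<^sub>R side_vector vs (Suc 0) + (1 / p 2) *\<^sub>R side_vector vs 2 = 0"
    unfolding add_divide_distrib g(1) using D' by simp
  moreover have "side_vector vs 0 + side_vector vs (Suc 0) + side_vector vs 2 = 0" by (simp add: side_vector_eq)
  moreover have "Im (cnj (side_vector vs 0) * side_vector vs (Suc 0)) \<noteq> 0"
  proof -
    have "area = Im (cnj (side_vector vs 0) * side_vector vs (Suc 0))"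
      unfolding area_def side_vector_eq by (simp add: algebra_simps)
    then show ?thesis using area_nz by simp
  qed
  ultimately have "1 / p 0 = 1 / p 2" "1 / p (Suc 0) = 1 / p 2"
    using real_multiples_closing by blast+
  then have pe: "p i = p 0" if "i < 3" for i using that by (auto simp: less_3_cases)
  define L where "L z = p 0 *\<^sub>R g (z / \<gamma>)" for z
  have "linear L"
  proof (rule linearI)
    show "L (y + z) = L y + L z" for y z by (simp only: L_def add_divide_distrib g(1) scaleR_add_right)
    have "c *\<^sub>R z / \<gamma> = c *\<^sub>R (z / \<gamma>)" for c z by (simp add: scaleR_conv_of_real)
    then show "L (c *\<^sub>R z) = c *\<^sub>R L z" for c z by (simp only: L_def g(3) scaleR_left_commute)
  qed
  have L: "L (image_side i) = side_vector vs i" if "i < 3" for i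
    unfolding L_def D'[OF that] pe[OF that] using p0[of 0] by simp
  have nL: "norm (L z) = (\<bar>p 0\<bar> / cmod \<gamma>) * norm z" for z by (simp add: L_def g(2) norm_divide)
  have r: "0 < \<bar>p 0\<bar> / cmod \<gamma>" using p0[of 0] \<gamma> by simp
  let ?V = "\<lambda>i. \<phi> (vs ! i)"
  have LV: "L (?V i - ?V 0) = vs ! i - vs ! 0" if "i \<in> {0, Suc 0, 2}" for i
  proof -
    have "L (?V 0 - ?V 0) = 0" by (simp add: L_def g00)
    moreover have "L (?V (Suc 0) - ?V 0) = vs ! Suc 0 - vs ! 0"
      using L[of 0] by (simp add: image_side_def side_vector_eq)
    moreover have "L (?V 2 - ?V 0) = vs ! 2 - vs ! 0"
    proof -
      have "?V 2 - ?V 0 = image_side 0 + image_side (Suc 0)" by (simp add: image_side_def Suc_mod_3)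
      then show ?thesis using L[of 0] L[of "Suc 0"] linear_add[OF \<open>linear L\<close>] by (simp add: side_vector_eq)
    qed
    ultimately show ?thesis using that by auto
  qed
  have "similar (convex hull (?V ` {0, Suc 0, 2})) (convex hull ((!) vs ` {0, Suc 0, 2}))"
    by (rule similar_hulls[OF \<open>linear L\<close> nL r LV])
  moreover have "?V ` {0, Suc 0, 2} = {Q ! 0, Q ! Suc 0, Q ! 2}"
    using corners_Q unfolding QT.set_vs set_vs by simp
  ultimately show ?thesis unfolding table_tri QT.table_tri tri_def QT.tri_def by simp
qed

theorem similar_tables: "similar (table Q) (table vs)"
proof -
  obtain \<alpha> \<beta> where t: "\<And>z. twine z = \<alpha> * z + \<beta> * cnj z" and ab: "\<alpha> \<noteq> 0 \<or> \<beta> \<noteq> 0"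
    by (rule twine_complex) blast
  have "\<exists>p. \<alpha> * side_vector vs i = p *\<^sub>R image_side i" "\<exists>q. \<beta> * cnj (side_vector vs i) = q *\<^sub>R image_side i"
    if "i < 3" for i
    using twine_side[OF that t] by metis+
  then obtain p q where pq: "\<And>i. i < 3 \<Longrightarrow> \<alpha> * side_vector vs i = p i *\<^sub>R image_side i"
    "\<And>i. i < 3 \<Longrightarrow> \<beta> * cnj (side_vector vs i) = q i *\<^sub>R image_side i" by metis
  show ?thesis
  proof (cases "\<alpha> = 0")
    case False
    show ?thesis by (rule image_sides_similar[where g = "\<lambda>z. z" and \<gamma> = \<alpha> and p = p]) (use False pq in simp_all)
  next
    case True
    then have "\<beta> \<noteq> 0" using ab by simp
    then show ?thesis by (intro image_sides_similar[where g = cnj and \<gamma> = \<beta> and p = q]) (use pq in simp_all)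
  qed
qed

end

theorem corollary5p2:
  fixes P Q :: "complex list" and u0 v0 :: "complex \<times> complex"
  assumes "polygon P" and "polygon Q"
    and "order_equivalent P u0 Q v0"
    and "length P = 3" and "rational_polygon P"
    and "\<not> exceptional_point P u0"
  shows "similar (table Q) (table P)"
proof -
  have P: "simple_polygon P" and Q: "simple_polygon Q"
    using assms(1,2) by (simp_all add: polygon_def simple_polygon_def)
  have orbits: "orbit_defined P u0" "orbit_defined Q v0"
    and dense: "boundary P \<subseteq> closure (range (foot P u0))" "boundary Q \<subseteq> closure (range (foot Q v0))"
    and order: "same_combinatorial_order P (foot P u0) Q (foot Q v0)"
    using assms(3) by (simp_all add: order_equivalent_def)
  have foot_boundary: "foot vs u n \<in> boundary vs" if "simple_polygon vs" "orbit_defined vs u" for vs u n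
  proof -
    interpret simple_polygon vs by (rule that(1))
    have "runs n u" using that(2) by (auto simp: orbit_defined_def runs_def)
    then show ?thesis unfolding foot_def using runs_in_phase_space phase_spaceD by blast
  qed
  obtain \<phi> \<psi> where "homeomorphism (boundary P) (boundary Q) \<phi> \<psi>" "\<And>n. \<phi> (foot P u0 n) = foot Q v0 n"
    using boundary_homeomorphism[OF P Q foot_boundary[OF P orbits(1)] foot_boundary[OF Q orbits(2)] dense order]
    by blast
  moreover have "\<And>k. k < length Q \<Longrightarrow> interior_angle Q k \<noteq> pi"
    using assms(2) by (simp add: polygon_def)
  ultimately have "polygon_pair P u0 Q v0 \<phi> \<psi>"
    using P Q orbits dense assms(4-6)
    by (intro polygon_pair.intro order_pair.intro dense_orbit.intro triangle.intro triangle_axioms.intro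
        dense_orbit_axioms.intro order_pair_axioms.intro polygon_pair_axioms.intro)
  then show ?thesis by (rule polygon_pair.similar_tables)
qed

end
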